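(* Let $\mathcal{C}$ be a cartesian monoidal category with pullbacks. Let $(\mathcal{A}: \mathcal{C}^{\mathrm{op}} \to \mathbf{Cat},\ T: \mathcal{C} \to \mathsf{Lens}_{\mathcal{A}})$ be a contravariant dynamical system doctrine such that $\mathcal{A}$ is monoidal and $T$ is oplax monoidal. Then there exists a lax monoidal functor $$\mathsf{RSM}: \mathsf{Lens}_{\mathcal{A}} \times \mathsf{Span}_{\mathcal{C}} \to \mathbf{Set}$$ (where $\mathbf{Set}$ has the cartesian monoidal structure) defined as follows. (On objects) For $\binom{I}{O} \in \mathrm{ob}\,\mathsf{Lens}_{\mathcal{A}}$ and $M \in \mathrm{ob}\,\mathcal{C}$, $$\mathsf{RSM}\left(\binom{I}{O}, M\right) = \left\{ \left(S, \binom{u}{r}, p\right) \;\Big|\; S \in \mathrm{ob}\,\mathcal{C},\ \binom{u}{r} \in \mathsf{Lens}_{\mathcal{A}}\left(\binom{TS}{S}, \binom{I}{O}\right),\ p \in \mathcal{C}(S, M) \right\}.$$ (On morphisms) For a morphism $\binom{f^\#}{f}: \binom{I}{O} \leftrightarrows \binom{I'}{O'}$ in $\mathsf{Lens}_{\mathcal{A}}$ and a span $M \xleftarrow{i} Q \xrightarrow{i'} M'$ in $\mathsf{Span}_{\mathcal{C}}$, the set map $\mathsf{RSM}\left(\binom{f^\#}{f}, M \xleftarrow{i} Q \xrightarrow{i'} M'\right)$ sends the triple $\left(S, \binom{u}{r}, p\right) \in \mathsf{RSM}\left(\binom{I}{O}, M\right)$ to $$\left(S \times_M Q,\ \binom{T\tilde{i}^\#}{\tilde{i}}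 ; \binom{u}{r} ; \binom{f^\#}{f},\ \tilde{p} ; i'\right) \in \mathsf{RSM}\left(\binom{I'}{O'}, M'\right),$$ where $S \times_M Q$ is the pullback of $S \xrightarrow{p} M \xleftarrow{i} Q$, with projections $\tilde{i}: S \times_M Q \to S$ and $\tilde{p}: S \times_M Q \to Q$ (so $\tilde{i} ; p = \tilde{p} ; i$), and the induced lens is the composite $$\binom{T(S\times_M Q)}{S \times_M Q} \leftrightarrows \binom{TS}{S} \leftrightarrows \binom{I}{O} \leftrightarrows \binom{I'}{O'}$$ of $\binom{T\tilde{i}^\#}{\tilde{i}}$, $\binom{u}{r}$ and $\binom{f^\#}{f}$.
   Context: Notation: $f ; g$ denotes composition in diagrammatic order (first $f$, then $g$). Indexed categories: an indexed category is a pseudofunctor $\mathcal{A}: \mathcal{C}^{\mathrm{op}} \to \mathbf{Cat}$; it is a monoidal indexed category if the pseudofunctor is lax monoidal (with respect to the monoidal structure of $\mathcal{C}$ and the cartesian product of categories). For $f: O \to O'$ in $\mathcal{C}$, write $f^* = \mathcal{A}(f): \mathcal{A}(O') \to \mathcal{A}(O)$. Lenses: for an indexed category $\mathcal{A}: \mathcal{C}^{\mathrm{op}} \to \mathbf{Cat}$, the category $\mathsf{Lens}_{\mathcal{A}}$ is the Grothendieck construction of the pointwise opposite of $\mathcal{A}$. Explicitly, its objects are pairs $\binom{I}{O}$ with $O \in \mathrm{ob}\,\mathcal{C}$ and $I \in \mathrm{ob}\,\mathcal{A}(O)$. Its morphisms (lenses) $\binom{f^\#}{f}: \binom{I}{O}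 \leftrightarrows \binom{I'}{O'}$ consist of $f: O \to O'$ in $\mathcal{C}$ and $f^\#: f^* I' \to I$ in $\mathcal{A}(O)$. The composite $\binom{f^\#}{f};\binom{g^\#}{g}$ has underlying map $f;g$ and second component $(f;g)^* I'' \cong f^* g^* I'' \xrightarrow{f^*(g^\#)} f^* I' \xrightarrow{f^\#} I$. When $\mathcal{A}$ is monoidal, $\mathsf{Lens}_{\mathcal{A}}$ has a monoidal structure given on objects by $\binom{I}{O} \otimes \binom{I'}{O'} = \binom{I \boxtimes I'}{O \otimes O'}$, where $O \otimes O'$ is the monoidal product in $\mathcal{C}$ (here the cartesian product) and $I \boxtimes I'$ is the image of $(I, I') \in \mathcal{A}(O) \times \mathcal{A}(O')$ under the laxator of $\mathcal{A}$. Contravariant dynamical system doctrine: an indexed category $\mathcal{A}: \mathcal{C}^{\mathrm{op}} \to \mathbf{Cat}$ together with a section $T: \mathcal{C} \to \mathsf{Lens}_{\mathcal{A}}$ of the forgetful functor $U: \mathsf{Lens}_{\mathcal{A}} \to \mathcal{C}$, $\binom{I}{O} \mapsto O$, $\binom{f^\#}{f} \mapsto f$ (i.e. $T$ is a functor with $T ; U = \mathrm{id}_{\mathcal{C}}$). We write $T$ on objects as $S \mapsto \binom{TS}{S}$ and on morphisms as $f \mapsto \binom{Tf^\#}{f}$. "$T$ is oplax" means $T$ is an oplax monoidal functor from $(\mathcal{C}, \times, 1)$ to $\mathsf{Lens}_{\mathcal{A}}$. Spans: $\mathsf{Span}_{\mathcal{C}}$ is the category with the objects of $\mathcal{C}$,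 whose morphisms $M \to M'$ are spans $M \leftarrow Q \to M'$ in $\mathcal{C}$, composed by pullback; its monoidal structure is induced by the cartesian product of $\mathcal{C}$. The product category $\mathsf{Lens}_{\mathcal{A}} \times \mathsf{Span}_{\mathcal{C}}$ has the componentwise monoidal structure.
   Formalization: Triples (S,(u,r),p) in RSM, like spans, are taken up to isomorphism of the state object S, and the action formula is stated on classes for any choice of pullback; with raw triples an identity span would send S to S×_M M, which need not equal S, so functoriality would fail. *)

theory Defs
  imports Main
begin

section \<open>Categories, functors, natural isomorphisms\<close>

text \<open>Composition is written in diagrammatic order. Only the values on \<open>obs\<close>, \<open>ars\<close> and on
  composable pairs are meaningful; the fields are unconstrained elsewhere.\<close>

record ('o, 'a) cat =
  obs :: "'o set"
  ars :: "'a set"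
  src :: "'a \<Rightarrow> 'o"
  tgt :: "'a \<Rightarrow> 'o"
  ident :: "'o \<Rightarrow> 'a"
  cmp :: "'a \<Rightarrow> 'a \<Rightarrow> 'a" (infixl "\<Zsemi>\<index>" 70)

definition homs :: "('o, 'a, 'z) cat_scheme \<Rightarrow> 'o \<Rightarrow> 'o \<Rightarrow> 'a set" where
  "homs C x y = {f \<in> ars C. src C f = x \<and> tgt C f = y}"

locale category =
  fixes C :: "('o, 'a, 'z) cat_scheme" (structure)
  assumes src_obs: "f \<in> ars C \<Longrightarrow> src C f \<in> obs C"
    and tgt_obs: "f \<in> ars C \<Longrightarrow> tgt C f \<in> obs C"
    and ident_homs: "x \<in> obs C \<Longrightarrow> ident C x \<in> homs C x x"
    and cmp_homs: "\<lbrakk>f \<in> ars C; g \<in> ars C; tgt C f = src C g\<rbrakk>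
      \<Longrightarrow> f \<Zsemi> g \<in> homs C (src C f) (tgt C g)"
    and ident_cmp: "f \<in> ars C \<Longrightarrow> ident C (src C f) \<Zsemi> f = f"
    and cmp_ident: "f \<in> ars C \<Longrightarrow> f \<Zsemi> ident C (tgt C f) = f"
    and cmp_assoc: "\<lbrakk>f \<in> ars C; g \<in> ars C; h \<in> ars C; tgt C f = src C g; tgt C g = src C h\<rbrakk>
      \<Longrightarrow> (f \<Zsemi> g) \<Zsemi> h = f \<Zsemi> (g \<Zsemi> h)"

definition isos :: "('o, 'a, 'z) cat_scheme \<Rightarrow> 'a set" where
  "isos C = {f \<in> ars C. \<exists>g \<in> homs C (tgt C f) (src C f).
     f \<Zsemi>\<^bsub>C\<^esub> g = ident C (src C f) \<and> g \<Zsemi>\<^bsub>C\<^esub> f = ident C (tgt C f)}"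

definition prod_cat ::
  "('o, 'a, 'z) cat_scheme \<Rightarrow> ('p, 'b, 'y) cat_scheme \<Rightarrow> ('o \<times> 'p, 'a \<times> 'b) cat" where
  "prod_cat C D =
    \<lparr>obs = obs C \<times> obs D, ars = ars C \<times> ars D,
     src = map_prod (src C) (src D), tgt = map_prod (tgt C) (tgt D),
     ident = map_prod (ident C) (ident D),
     cmp = (\<lambda>(f, f') (g, g'). (f \<Zsemi>\<^bsub>C\<^esub> g, f' \<Zsemi>\<^bsub>D\<^esub> g'))\<rparr>"

locale cat_functor =
  fixes C :: "('o, 'a, 'z) cat_scheme" and D :: "('p, 'b, 'y) cat_scheme"
    and Fo :: "'o \<Rightarrow> 'p" and Fa :: "'a \<Rightarrow> 'b"
  assumes Fo_obs: "x \<in> obs C \<Longrightarrow> Fo x \<in> obs D"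
    and Fa_homs: "f \<in> ars C \<Longrightarrow> Fa f \<in> homs D (Fo (src C f)) (Fo (tgt C f))"
    and Fa_ident: "x \<in> obs C \<Longrightarrow> Fa (ident C x) = ident D (Fo x)"
    and Fa_cmp: "\<lbrakk>f \<in> ars C; g \<in> ars C; tgt C f = src C g\<rbrakk>
      \<Longrightarrow> Fa (f \<Zsemi>\<^bsub>C\<^esub> g) = Fa f \<Zsemi>\<^bsub>D\<^esub> Fa g"

locale nat_iso =
  fixes C :: "('o, 'a, 'z) cat_scheme" and D :: "('p, 'b, 'y) cat_scheme"
    and Fo :: "'o \<Rightarrow> 'p" and Fa :: "'a \<Rightarrow> 'b"
    and Go :: "'o \<Rightarrow> 'p" and Ga :: "'a \<Rightarrow> 'b"
    and t :: "'o \<Rightarrow> 'b"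
  assumes component_homs: "x \<in> obs C \<Longrightarrow> t x \<in> homs D (Fo x) (Go x)"
    and component_iso: "x \<in> obs C \<Longrightarrow> t x \<in> isos D"
    and naturality: "f \<in> ars C \<Longrightarrow>
      Fa f \<Zsemi>\<^bsub>D\<^esub> t (tgt C f) = t (src C f) \<Zsemi>\<^bsub>D\<^esub> Ga f"


section \<open>Monoidal structure\<close>

record ('o, 'a) moncat = "('o, 'a) cat" +
  ten :: "'o \<Rightarrow> 'o \<Rightarrow> 'o"
  tenar :: "'a \<Rightarrow> 'a \<Rightarrow> 'a"
  munit :: 'o
  assoc :: "'o \<Rightarrow> 'o \<Rightarrow> 'o \<Rightarrow> 'a"  \<comment> \<open>\<open>(x \<otimes> y) \<otimes> z \<rightarrow> x \<otimes> (y \<otimes> z)\<close>\<close>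
  lunit :: "'o \<Rightarrow> 'a"  \<comment> \<open>\<open>1 \<otimes> x \<rightarrow> x\<close>\<close>
  runit :: "'o \<Rightarrow> 'a"  \<comment> \<open>\<open>x \<otimes> 1 \<rightarrow> x\<close>\<close>

definition prod_moncat ::
  "('o, 'a, 'z) moncat_scheme \<Rightarrow> ('p, 'b, 'y) moncat_scheme \<Rightarrow> ('o \<times> 'p, 'a \<times> 'b) moncat" where
  "prod_moncat M N = cat.extend (prod_cat M N) (moncat.fields
     (\<lambda>(x, x') (y, y'). (ten M x y, ten N x' y'))
     (\<lambda>(f, f') (g, g'). (tenar M f g, tenar N f' g'))
     (munit M, munit N)
     (\<lambda>(x, x') (y, y') (z, z'). (assoc M x y z, assoc N x' y' z'))
     (map_prod (lunit M) (lunit N))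
     (map_prod (runit M) (runit N)))"

locale oplax_monoidal_functor =
  cat_functor M N Fo Fa
  for M :: "('o, 'a, 'z) moncat_scheme" and N :: "('p, 'b, 'y) moncat_scheme"
    and Fo :: "'o \<Rightarrow> 'p" and Fa :: "'a \<Rightarrow> 'b" +
  fixes e :: 'b and d :: "'o \<Rightarrow> 'o \<Rightarrow> 'b"
  assumes e_homs: "e \<in> homs N (Fo (munit M)) (munit N)"
    and d_homs: "\<lbrakk>x \<in> obs M; y \<in> obs M\<rbrakk> \<Longrightarrow> d x y \<in> homs N (Fo (ten M x y)) (ten N (Fo x) (Fo y))"
    and d_natural: "\<lbrakk>f \<in> ars M; g \<in> ars M\<rbrakk> \<Longrightarrow>
      Fa (tenar M f g) \<Zsemi>\<^bsub>N\<^esub> d (tgt M f) (tgt M g)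
      = d (src M f) (src M g) \<Zsemi>\<^bsub>N\<^esub> tenar N (Fa f) (Fa g)"
    and d_assoc: "\<lbrakk>x \<in> obs M; y \<in> obs M; z \<in> obs M\<rbrakk> \<Longrightarrow>
      d (ten M x y) z \<Zsemi>\<^bsub>N\<^esub> tenar N (d x y) (ident N (Fo z)) \<Zsemi>\<^bsub>N\<^esub> assoc N (Fo x) (Fo y) (Fo z)
      = Fa (assoc M x y z) \<Zsemi>\<^bsub>N\<^esub> d x (ten M y z) \<Zsemi>\<^bsub>N\<^esub> tenar N (ident N (Fo x)) (d y z)"
    and d_lunit: "x \<in> obs M \<Longrightarrow>
      d (munit M) x \<Zsemi>\<^bsub>N\<^esub> tenar N e (ident N (Fo x)) \<Zsemi>\<^bsub>N\<^esub> lunit N (Fo x) = Fa (lunit M x)"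
    and d_runit: "x \<in> obs M \<Longrightarrow>
      d x (munit M) \<Zsemi>\<^bsub>N\<^esub> tenar N (ident N (Fo x)) e \<Zsemi>\<^bsub>N\<^esub> runit N (Fo x) = Fa (runit M x)"

text \<open>Lax monoidal functors into \<open>(Set, \<times>, 1)\<close>. Since the cartesian product of sets changes the HOL
  type, the category of sets is not packaged as a \<open>moncat\<close>; instead the definition is spelled out
  on elements. The map \<open>Fo x \<times> Fo y \<rightarrow> Fo (x \<otimes> y)\<close> is the curried \<open>m x y\<close>, and \<open>u\<close> is the value
  of \<open>1 \<rightarrow> Fo 1\<close>.\<close>

locale lax_monoidal_functor_to_Set =
  fixes M :: "('o, 'a, 'z) moncat_scheme"
    and Fo :: "'o \<Rightarrow> 'e set" and Fa :: "'a \<Rightarrow> 'e \<Rightarrow> 'e"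
    and u :: 'e and m :: "'o \<Rightarrow> 'o \<Rightarrow> 'e \<Rightarrow> 'e \<Rightarrow> 'e"
  assumes Fa_maps: "\<lbrakk>f \<in> ars M; a \<in> Fo (src M f)\<rbrakk> \<Longrightarrow> Fa f a \<in> Fo (tgt M f)"
    and Fa_ident: "\<lbrakk>x \<in> obs M; a \<in> Fo x\<rbrakk> \<Longrightarrow> Fa (ident M x) a = a"
    and Fa_cmp: "\<lbrakk>f \<in> ars M; g \<in> ars M; tgt M f = src M g; a \<in> Fo (src M f)\<rbrakk>
      \<Longrightarrow> Fa (f \<Zsemi>\<^bsub>M\<^esub> g) a = Fa g (Fa f a)"
    and u_in: "u \<in> Fo (munit M)"
    and m_maps: "\<lbrakk>x \<in> obs M; y \<in> obs M; a \<in> Fo x; b \<in> Fo y\<rbrakk> \<Longrightarrow> m x y a b \<in> Fo (ten M x y)"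
    and m_natural: "\<lbrakk>f \<in> ars M; g \<in> ars M; a \<in> Fo (src M f); b \<in> Fo (src M g)\<rbrakk> \<Longrightarrow>
      Fa (tenar M f g) (m (src M f) (src M g) a b) = m (tgt M f) (tgt M g) (Fa f a) (Fa g b)"
    and m_assoc: "\<lbrakk>x \<in> obs M; y \<in> obs M; z \<in> obs M; a \<in> Fo x; b \<in> Fo y; c \<in> Fo z\<rbrakk> \<Longrightarrow>
      Fa (assoc M x y z) (m (ten M x y) z (m x y a b) c) = m x (ten M y z) a (m y z b c)"
    and m_lunit: "\<lbrakk>x \<in> obs M; a \<in> Fo x\<rbrakk> \<Longrightarrow> Fa (lunit M x) (m (munit M) x u a) = a"
    and m_runit: "\<lbrakk>x \<in> obs M; a \<in> Fo x\<rbrakk> \<Longrightarrow> Fa (runit M x) (m x (munit M) a u) = a"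


section \<open>Cartesian monoidal categories and pullbacks\<close>

record ('o, 'a) cartcat = "('o, 'a) cat" +
  one :: 'o
  prd :: "'o \<Rightarrow> 'o \<Rightarrow> 'o"
  pr1 :: "'o \<Rightarrow> 'o \<Rightarrow> 'a"
  pr2 :: "'o \<Rightarrow> 'o \<Rightarrow> 'a"

locale cartesian_category = category C
  for C :: "('o, 'a, 'z) cartcat_scheme" (structure) +
  assumes one_obs: "one C \<in> obs C"
    and one_terminal: "x \<in> obs C \<Longrightarrow> \<exists>!f. f \<in> homs C x (one C)"
    and prd_obs: "\<lbrakk>x \<in> obs C; y \<in> obs C\<rbrakk> \<Longrightarrow> prd C x y \<in> obs C"
    and pr1_homs: "\<lbrakk>x \<in> obs C; y \<in> obs C\<rbrakk> \<Longrightarrow> pr1 C x y \<in> homs C (prd C x y) x"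
    and pr2_homs: "\<lbrakk>x \<in> obs C; y \<in> obs C\<rbrakk> \<Longrightarrow> pr2 C x y \<in> homs C (prd C x y) y"
    and prd_universal: "\<lbrakk>f \<in> ars C; g \<in> ars C; src C f = src C g\<rbrakk> \<Longrightarrow>
      \<exists>!h. h \<in> homs C (src C f) (prd C (tgt C f) (tgt C g))
        \<and> h \<Zsemi> pr1 C (tgt C f) (tgt C g) = f \<and> h \<Zsemi> pr2 C (tgt C f) (tgt C g) = g"

definition pairing :: "('o, 'a, 'z) cartcat_scheme \<Rightarrow> 'a \<Rightarrow> 'a \<Rightarrow> 'a" where
  "pairing C f g = (THE h. h \<in> homs C (src C f) (prd C (tgt C f) (tgt C g))
     \<and> h \<Zsemi>\<^bsub>C\<^esub> pr1 C (tgt C f) (tgt C g) = f \<and> h \<Zsemi>\<^bsub>C\<^esub> pr2 C (tgt C f) (tgt C g) = g)"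

definition prdar :: "('o, 'a, 'z) cartcat_scheme \<Rightarrow> 'a \<Rightarrow> 'a \<Rightarrow> 'a" where
  "prdar C f g = pairing C (pr1 C (src C f) (src C g) \<Zsemi>\<^bsub>C\<^esub> f) (pr2 C (src C f) (src C g) \<Zsemi>\<^bsub>C\<^esub> g)"

definition prd_assoc :: "('o, 'a, 'z) cartcat_scheme \<Rightarrow> 'o \<Rightarrow> 'o \<Rightarrow> 'o \<Rightarrow> 'a" where
  "prd_assoc C x y z = pairing C (pr1 C (prd C x y) z \<Zsemi>\<^bsub>C\<^esub> pr1 C x y)
     (pairing C (pr1 C (prd C x y) z \<Zsemi>\<^bsub>C\<^esub> pr2 C x y) (pr2 C (prd C x y) z))"

definition prd_lunit :: "('o, 'a, 'z) cartcat_scheme \<Rightarrow> 'o \<Rightarrow> 'a" where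
  "prd_lunit C x = pr2 C (one C) x"

definition prd_runit :: "('o, 'a, 'z) cartcat_scheme \<Rightarrow> 'o \<Rightarrow> 'a" where
  "prd_runit C x = pr1 C x (one C)"

definition cart_moncat :: "('o, 'a, 'z) cartcat_scheme \<Rightarrow> ('o, 'a) moncat" where
  "cart_moncat C = cat.extend (cat.truncate C) (moncat.fields
     (prd C) (prdar C) (one C) (prd_assoc C) (prd_lunit C) (prd_runit C))"

definition is_pullback :: "('o, 'a, 'z) cat_scheme \<Rightarrow> 'a \<Rightarrow> 'a \<Rightarrow> 'a \<Rightarrow> 'a \<Rightarrow> bool" where
  "is_pullback C h k p i \<longleftrightarrow>
     h \<in> ars C \<and> k \<in> ars C \<and> p \<in> ars C \<and> i \<in> ars C \<and>
     src C h = src C k \<and> tgt C h = src C p \<and> tgt C k = src C i \<and> tgt C p = tgt C i \<and>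
     h \<Zsemi>\<^bsub>C\<^esub> p = k \<Zsemi>\<^bsub>C\<^esub> i \<and>
     (\<forall>h' k'. h' \<in> ars C \<and> k' \<in> ars C \<and> src C h' = src C k' \<and> tgt C h' = src C p \<and>
        tgt C k' = src C i \<and> h' \<Zsemi>\<^bsub>C\<^esub> p = k' \<Zsemi>\<^bsub>C\<^esub> i
        \<longrightarrow> (\<exists>!t. t \<in> homs C (src C h') (src C h) \<and> t \<Zsemi>\<^bsub>C\<^esub> h = h' \<and> t \<Zsemi>\<^bsub>C\<^esub> k = k'))"

definition has_pullbacks :: "('o, 'a, 'z) cat_scheme \<Rightarrow> bool" where
  "has_pullbacks C \<longleftrightarrow>
     (\<forall>p \<in> ars C. \<forall>i \<in> ars C. tgt C p = tgt C i \<longrightarrow> (\<exists>h k. is_pullback C h k p i))"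


section \<open>Indexed categories\<close>

text \<open>A pseudofunctor \<open>C\<^sup>o\<^sup>p \<rightarrow> Cat\<close>: \<open>pb_ob A f\<close>, \<open>pb_ar A f\<close> are the object and arrow parts of
  \<open>f\<^sup>* : A (tgt f) \<rightarrow> A (src f)\<close>. The coherence isomorphisms are oriented as they occur in the
  composition of lenses.\<close>

record ('o, 'a, 'p, 'q) indexed =
  fib :: "'o \<Rightarrow> ('p, 'q) cat"
  pb_ob :: "'a \<Rightarrow> 'p \<Rightarrow> 'p"
  pb_ar :: "'a \<Rightarrow> 'q \<Rightarrow> 'q"
  pb_id :: "'o \<Rightarrow> 'p \<Rightarrow> 'q"  \<comment> \<open>\<open>(id x)\<^sup>* I \<rightarrow> I\<close>\<close>
  pb_cmp :: "'a \<Rightarrow> 'a \<Rightarrow> 'p \<Rightarrow> 'q"  \<comment> \<open>\<open>(f \<Zsemi> g)\<^sup>* I \<rightarrow> f\<^sup>* (g\<^sup>* I)\<close>\<close>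

locale indexed_category = category C
  for C :: "('o, 'a, 'z) cat_scheme" (structure)
    and A :: "('o, 'a, 'p, 'q, 'y) indexed_scheme" +
  assumes fib_category: "x \<in> obs C \<Longrightarrow> category (fib A x)"
    and pb_functor: "f \<in> ars C \<Longrightarrow>
      cat_functor (fib A (tgt C f)) (fib A (src C f)) (pb_ob A f) (pb_ar A f)"
    and pb_id_iso: "x \<in> obs C \<Longrightarrow>
      nat_iso (fib A x) (fib A x) (pb_ob A (ident C x)) (pb_ar A (ident C x)) id id (pb_id A x)"
    and pb_cmp_iso: "\<lbrakk>f \<in> ars C; g \<in> ars C; tgt C f = src C g\<rbrakk> \<Longrightarrow>
      nat_iso (fib A (tgt C g)) (fib A (src C f)) (pb_ob A (f \<Zsemi> g)) (pb_ar A (f \<Zsemi> g))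
        (pb_ob A f \<circ> pb_ob A g) (pb_ar A f \<circ> pb_ar A g) (pb_cmp A f g)"
    and pb_assoc: "\<lbrakk>f \<in> ars C; g \<in> ars C; h \<in> ars C; tgt C f = src C g; tgt C g = src C h;
        I \<in> obs (fib A (tgt C h))\<rbrakk> \<Longrightarrow>
      pb_cmp A (f \<Zsemi> g) h I \<Zsemi>\<^bsub>fib A (src C f)\<^esub> pb_cmp A f g (pb_ob A h I)
      = pb_cmp A f (g \<Zsemi> h) I \<Zsemi>\<^bsub>fib A (src C f)\<^esub> pb_ar A f (pb_cmp A g h I)"
    and pb_id_cmp: "\<lbrakk>f \<in> ars C; I \<in> obs (fib A (tgt C f))\<rbrakk> \<Longrightarrow>
      pb_cmp A (ident C (src C f)) f I \<Zsemi>\<^bsub>fib A (src C f)\<^esub> pb_id A (src C f) (pb_ob A f I)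
      = ident (fib A (src C f)) (pb_ob A f I)"
    and pb_cmp_id: "\<lbrakk>f \<in> ars C; I \<in> obs (fib A (tgt C f))\<rbrakk> \<Longrightarrow>
      pb_cmp A f (ident C (tgt C f)) I \<Zsemi>\<^bsub>fib A (src C f)\<^esub> pb_ar A f (pb_id A (tgt C f) I)
      = ident (fib A (src C f)) (pb_ob A f I)"

text \<open>A lax monoidal structure on the pseudofunctor, from \<open>(C, \<times>, 1)\<close> to \<open>(Cat, \<times>, 1)\<close>: the laxator
  \<open>A x \<times> A y \<rightarrow> A (x \<times> y)\<close>, written \<open>I \<boxtimes> J\<close>, which is pseudonatural through \<open>box_pb\<close>; the unit
  object of \<open>A 1\<close>; and invertible modifications for associativity and units.\<close>

record ('o, 'a, 'p, 'q) mon_indexed = "('o, 'a, 'p, 'q) indexed" +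
  box :: "'o \<Rightarrow> 'o \<Rightarrow> 'p \<Rightarrow> 'p \<Rightarrow> 'p"
  boxar :: "'o \<Rightarrow> 'o \<Rightarrow> 'q \<Rightarrow> 'q \<Rightarrow> 'q"
  box_pb :: "'a \<Rightarrow> 'a \<Rightarrow> 'p \<Rightarrow> 'p \<Rightarrow> 'q"  \<comment> \<open>\<open>(f \<times> g)\<^sup>* (I \<boxtimes> J) \<rightarrow> f\<^sup>* I \<boxtimes> g\<^sup>* J\<close>\<close>
  box_unit :: 'p
  box_assoc :: "'o \<Rightarrow> 'o \<Rightarrow> 'o \<Rightarrow> 'p \<Rightarrow> 'p \<Rightarrow> 'p \<Rightarrow> 'q"
    \<comment> \<open>\<open>\<alpha>\<^sup>* (I \<boxtimes> (J \<boxtimes> K)) \<rightarrow> (I \<boxtimes> J) \<boxtimes> K\<close>\<close>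
  box_lunit :: "'o \<Rightarrow> 'p \<Rightarrow> 'q"  \<comment> \<open>\<open>\<lambda>\<^sup>* I \<rightarrow> box_unit \<boxtimes> I\<close>\<close>
  box_runit :: "'o \<Rightarrow> 'p \<Rightarrow> 'q"  \<comment> \<open>\<open>\<rho>\<^sup>* I \<rightarrow> I \<boxtimes> box_unit\<close>\<close>

locale monoidal_indexed_category = cartesian_category C + indexed_category C A
  for C :: "('o, 'a, 'z) cartcat_scheme" (structure)
    and A :: "('o, 'a, 'p, 'q, 'y) mon_indexed_scheme" +
  assumes box_functor: "\<lbrakk>x \<in> obs C; y \<in> obs C\<rbrakk> \<Longrightarrow>
      cat_functor (prod_cat (fib A x) (fib A y)) (fib A (prd C x y))
        (\<lambda>(I, J). box A x y I J) (\<lambda>(m, n). boxar A x y m n)"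
    and box_pb_iso: "\<lbrakk>f \<in> ars C; g \<in> ars C\<rbrakk> \<Longrightarrow>
      nat_iso (prod_cat (fib A (tgt C f)) (fib A (tgt C g))) (fib A (prd C (src C f) (src C g)))
        (\<lambda>(I, J). pb_ob A (prdar C f g) (box A (tgt C f) (tgt C g) I J))
        (\<lambda>(m, n). pb_ar A (prdar C f g) (boxar A (tgt C f) (tgt C g) m n))
        (\<lambda>(I, J). box A (src C f) (src C g) (pb_ob A f I) (pb_ob A g J))
        (\<lambda>(m, n). boxar A (src C f) (src C g) (pb_ar A f m) (pb_ar A g n))
        (\<lambda>(I, J). box_pb A f g I J)"
    and box_pb_ident: "\<lbrakk>x \<in> obs C; y \<in> obs C; I \<in> obs (fib A x); J \<in> obs (fib A y)\<rbrakk> \<Longrightarrow>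
      box_pb A (ident C x) (ident C y) I J
        \<Zsemi>\<^bsub>fib A (prd C x y)\<^esub> boxar A x y (pb_id A x I) (pb_id A y J)
      = pb_id A (prd C x y) (box A x y I J)"
    and box_pb_cmp: "\<lbrakk>f \<in> ars C; f' \<in> ars C; tgt C f = src C f'; g \<in> ars C; g' \<in> ars C;
        tgt C g = src C g'; I \<in> obs (fib A (tgt C f')); J \<in> obs (fib A (tgt C g'));
        F = fib A (prd C (src C f) (src C g))\<rbrakk> \<Longrightarrow>
      pb_cmp A (prdar C f g) (prdar C f' g') (box A (tgt C f') (tgt C g') I J)
        \<Zsemi>\<^bsub>F\<^esub> pb_ar A (prdar C f g) (box_pb A f' g' I J)
        \<Zsemi>\<^bsub>F\<^esub> box_pb A f g (pb_ob A f' I) (pb_ob A g' J)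
      = box_pb A (f \<Zsemi> f') (g \<Zsemi> g') I J
        \<Zsemi>\<^bsub>F\<^esub> boxar A (src C f) (src C g) (pb_cmp A f f' I) (pb_cmp A g g' J)"
    and box_unit_obs: "box_unit A \<in> obs (fib A (one C))"
    and box_assoc_iso: "\<lbrakk>x \<in> obs C; y \<in> obs C; z \<in> obs C\<rbrakk> \<Longrightarrow>
      nat_iso (prod_cat (prod_cat (fib A x) (fib A y)) (fib A z)) (fib A (prd C (prd C x y) z))
        (\<lambda>((I, J), K). pb_ob A (prd_assoc C x y z) (box A x (prd C y z) I (box A y z J K)))
        (\<lambda>((l, m), n). pb_ar A (prd_assoc C x y z) (boxar A x (prd C y z) l (boxar A y z m n)))
        (\<lambda>((I, J), K). box A (prd C x y) z (box A x y I J) K)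
        (\<lambda>((l, m), n). boxar A (prd C x y) z (boxar A x y l m) n)
        (\<lambda>((I, J), K). box_assoc A x y z I J K)"
    and box_assoc_modification: "\<lbrakk>f \<in> homs C x x'; g \<in> homs C y y'; h \<in> homs C z z';
        I \<in> obs (fib A x'); J \<in> obs (fib A y'); K \<in> obs (fib A z');
        F = fib A (prd C (prd C x y) z); X = box A x' (prd C y' z') I (box A y' z' J K)\<rbrakk> \<Longrightarrow>
      pb_cmp A (prdar C (prdar C f g) h) (prd_assoc C x' y' z') X
        \<Zsemi>\<^bsub>F\<^esub> pb_ar A (prdar C (prdar C f g) h) (box_assoc A x' y' z' I J K)
        \<Zsemi>\<^bsub>F\<^esub> box_pb A (prdar C f g) h (box A x' y' I J) K
        \<Zsemi>\<^bsub>F\<^esub> boxar A (prd C x y) z (box_pb A f g I J) (ident (fib A z) (pb_ob A h K))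
      = pb_cmp A (prd_assoc C x y z) (prdar C f (prdar C g h)) X
        \<Zsemi>\<^bsub>F\<^esub> pb_ar A (prd_assoc C x y z)
             (box_pb A f (prdar C g h) I (box A y' z' J K)
              \<Zsemi>\<^bsub>fib A (prd C x (prd C y z))\<^esub>
                boxar A x (prd C y z) (ident (fib A x) (pb_ob A f I)) (box_pb A g h J K))
        \<Zsemi>\<^bsub>F\<^esub> box_assoc A x y z (pb_ob A f I) (pb_ob A g J) (pb_ob A h K)"
    and box_lunit_iso: "x \<in> obs C \<Longrightarrow>
      nat_iso (fib A x) (fib A (prd C (one C) x))
        (pb_ob A (prd_lunit C x)) (pb_ar A (prd_lunit C x))
        (box A (one C) x (box_unit A))
        (boxar A (one C) x (ident (fib A (one C)) (box_unit A)))
        (box_lunit A x)"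
    and box_lunit_modification: "\<lbrakk>f \<in> homs C x x'; I \<in> obs (fib A x');
        F = fib A (prd C (one C) x)\<rbrakk> \<Longrightarrow>
      pb_cmp A (prd_lunit C x) f I \<Zsemi>\<^bsub>F\<^esub> box_lunit A x (pb_ob A f I)
      = pb_cmp A (prdar C (ident C (one C)) f) (prd_lunit C x') I
        \<Zsemi>\<^bsub>F\<^esub> pb_ar A (prdar C (ident C (one C)) f) (box_lunit A x' I)
        \<Zsemi>\<^bsub>F\<^esub> box_pb A (ident C (one C)) f (box_unit A) I
        \<Zsemi>\<^bsub>F\<^esub> boxar A (one C) x (pb_id A (one C) (box_unit A)) (ident (fib A x) (pb_ob A f I))"
    and box_runit_iso: "x \<in> obs C \<Longrightarrow>
      nat_iso (fib A x) (fib A (prd C x (one C)))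
        (pb_ob A (prd_runit C x)) (pb_ar A (prd_runit C x))
        (\<lambda>I. box A x (one C) I (box_unit A))
        (\<lambda>m. boxar A x (one C) m (ident (fib A (one C)) (box_unit A)))
        (box_runit A x)"
    and box_runit_modification: "\<lbrakk>f \<in> homs C x x'; I \<in> obs (fib A x');
        F = fib A (prd C x (one C))\<rbrakk> \<Longrightarrow>
      pb_cmp A (prd_runit C x) f I \<Zsemi>\<^bsub>F\<^esub> box_runit A x (pb_ob A f I)
      = pb_cmp A (prdar C f (ident C (one C))) (prd_runit C x') I
        \<Zsemi>\<^bsub>F\<^esub> pb_ar A (prdar C f (ident C (one C))) (box_runit A x' I)
        \<Zsemi>\<^bsub>F\<^esub> box_pb A f (ident C (one C)) I (box_unit A)
        \<Zsemi>\<^bsub>F\<^esub> boxar A x (one C) (ident (fib A x) (pb_ob A f I)) (pb_id A (one C) (box_unit A))"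
    and box_pentagon: "\<lbrakk>w \<in> obs C; x \<in> obs C; y \<in> obs C; z \<in> obs C;
        H \<in> obs (fib A w); I \<in> obs (fib A x); J \<in> obs (fib A y); K \<in> obs (fib A z);
        F = fib A (prd C (prd C (prd C w x) y) z);
        X = box A w (prd C x (prd C y z)) H (box A x (prd C y z) I (box A y z J K));
        Y = box A w (prd C (prd C x y) z) H (box A (prd C x y) z (box A x y I J) K);
        a1 = prd_assoc C (prd C w x) y z; a2 = prd_assoc C w x (prd C y z);
        b1 = prdar C (prd_assoc C w x y) (ident C z); b2 = prd_assoc C w (prd C x y) z;
        b3 = prdar C (ident C w) (prd_assoc C x y z)\<rbrakk> \<Longrightarrow>
      pb_cmp A a1 a2 X
        \<Zsemi>\<^bsub>F\<^esub> pb_ar A a1 (box_assoc A w x (prd C y z) H I (box A y z J K))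
        \<Zsemi>\<^bsub>F\<^esub> box_assoc A (prd C w x) y z (box A w x H I) J K
      = pb_cmp A (b1 \<Zsemi> b2) b3 X
        \<Zsemi>\<^bsub>F\<^esub> pb_ar A (b1 \<Zsemi> b2)
             (box_pb A (ident C w) (prd_assoc C x y z) H (box A x (prd C y z) I (box A y z J K))
              \<Zsemi>\<^bsub>fib A (prd C w (prd C (prd C x y) z))\<^esub>
                boxar A w (prd C (prd C x y) z) (pb_id A w H) (box_assoc A x y z I J K))
        \<Zsemi>\<^bsub>F\<^esub> pb_cmp A b1 b2 Y
        \<Zsemi>\<^bsub>F\<^esub> pb_ar A b1 (box_assoc A w (prd C x y) z H (box A x y I J) K)
        \<Zsemi>\<^bsub>F\<^esub> box_pb A (prd_assoc C w x y) (ident C z) (box A w (prd C x y) H (box A x y I J)) K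
        \<Zsemi>\<^bsub>F\<^esub> boxar A (prd C (prd C w x) y) z (box_assoc A w x y H I J) (pb_id A z K)"
    and box_triangle: "\<lbrakk>x \<in> obs C; y \<in> obs C; I \<in> obs (fib A x); J \<in> obs (fib A y);
        F = fib A (prd C (prd C x (one C)) y); a = prd_assoc C x (one C) y\<rbrakk> \<Longrightarrow>
      pb_cmp A a (prdar C (ident C x) (prd_lunit C y)) (box A x y I J)
        \<Zsemi>\<^bsub>F\<^esub> pb_ar A a
             (box_pb A (ident C x) (prd_lunit C y) I J
              \<Zsemi>\<^bsub>fib A (prd C x (prd C (one C) y))\<^esub>
                boxar A x (prd C (one C) y) (pb_id A x I) (box_lunit A y J))
        \<Zsemi>\<^bsub>F\<^esub> box_assoc A x (one C) y I (box_unit A) J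
      = box_pb A (prd_runit C x) (ident C y) I J
        \<Zsemi>\<^bsub>F\<^esub> boxar A (prd C x (one C)) y (box_runit A x I) (pb_id A y J)"


section \<open>Lenses\<close>

text \<open>Objects are pairs \<open>(I, x)\<close> with \<open>I\<close> an object of \<open>A x\<close>. A lens records its source and target,
  since they are not determined by its two components.\<close>

datatype ('o, 'a, 'p, 'q) lens =
  Lens (lens_src: "'p \<times> 'o") (lens_tgt: "'p \<times> 'o") (lens_bwd: 'q) (lens_fwd: 'a)

definition lens_obs ::
  "('o, 'a, 'z) cat_scheme \<Rightarrow> ('o, 'a, 'p, 'q, 'y) indexed_scheme \<Rightarrow> ('p \<times> 'o) set" where
  "lens_obs C A = {(I, x). x \<in> obs C \<and> I \<in> obs (fib A x)}"

definition lens_ars ::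
  "('o, 'a, 'z) cat_scheme \<Rightarrow> ('o, 'a, 'p, 'q, 'y) indexed_scheme \<Rightarrow> ('o, 'a, 'p, 'q) lens set" where
  "lens_ars C A = {Lens (I, x) (I', x') b f | I x I' x' b f.
     (I, x) \<in> lens_obs C A \<and> (I', x') \<in> lens_obs C A \<and>
     f \<in> homs C x x' \<and> b \<in> homs (fib A x) (pb_ob A f I') I}"

definition lens_ident ::
  "('o, 'a, 'z) cat_scheme \<Rightarrow> ('o, 'a, 'p, 'q, 'y) indexed_scheme \<Rightarrow> 'p \<times> 'o \<Rightarrow> ('o, 'a, 'p, 'q) lens" where
  "lens_ident C A = (\<lambda>(I, x). Lens (I, x) (I, x) (pb_id A x I) (ident C x))"

definition lens_cmp ::
  "('o, 'a, 'z) cat_scheme \<Rightarrow> ('o, 'a, 'p, 'q, 'y) indexed_scheme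
    \<Rightarrow> ('o, 'a, 'p, 'q) lens \<Rightarrow> ('o, 'a, 'p, 'q) lens \<Rightarrow> ('o, 'a, 'p, 'q) lens" where
  "lens_cmp C A k l =
    (let f = lens_fwd k; g = lens_fwd l; F = fib A (src C f) in
     Lens (lens_src k) (lens_tgt l)
       (pb_cmp A f g (fst (lens_tgt l)) \<Zsemi>\<^bsub>F\<^esub> pb_ar A f (lens_bwd l) \<Zsemi>\<^bsub>F\<^esub> lens_bwd k)
       (f \<Zsemi>\<^bsub>C\<^esub> g))"

definition lens_cat ::
  "('o, 'a, 'z) cat_scheme \<Rightarrow> ('o, 'a, 'p, 'q, 'y) indexed_scheme
    \<Rightarrow> ('p \<times> 'o, ('o, 'a, 'p, 'q) lens) cat" where
  "lens_cat C A = \<lparr>obs = lens_obs C A, ars = lens_ars C A, src = lens_src, tgt = lens_tgt,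
     ident = lens_ident C A, cmp = lens_cmp C A\<rparr>"

definition lens_ten ::
  "('o, 'a, 'z) cartcat_scheme \<Rightarrow> ('o, 'a, 'p, 'q, 'y) mon_indexed_scheme
    \<Rightarrow> 'p \<times> 'o \<Rightarrow> 'p \<times> 'o \<Rightarrow> 'p \<times> 'o" where
  "lens_ten C A = (\<lambda>(I, x) (J, y). (box A x y I J, prd C x y))"

definition lens_tenar ::
  "('o, 'a, 'z) cartcat_scheme \<Rightarrow> ('o, 'a, 'p, 'q, 'y) mon_indexed_scheme
    \<Rightarrow> ('o, 'a, 'p, 'q) lens \<Rightarrow> ('o, 'a, 'p, 'q) lens \<Rightarrow> ('o, 'a, 'p, 'q) lens" where
  "lens_tenar C A k l =
    (let f = lens_fwd k; g = lens_fwd l; x = src C f; y = src C g in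
     Lens (lens_ten C A (lens_src k) (lens_src l)) (lens_ten C A (lens_tgt k) (lens_tgt l))
       (box_pb A f g (fst (lens_tgt k)) (fst (lens_tgt l))
          \<Zsemi>\<^bsub>fib A (prd C x y)\<^esub> boxar A x y (lens_bwd k) (lens_bwd l))
       (prdar C f g))"

definition lens_assoc ::
  "('o, 'a, 'z) cartcat_scheme \<Rightarrow> ('o, 'a, 'p, 'q, 'y) mon_indexed_scheme
    \<Rightarrow> 'p \<times> 'o \<Rightarrow> 'p \<times> 'o \<Rightarrow> 'p \<times> 'o \<Rightarrow> ('o, 'a, 'p, 'q) lens" where
  "lens_assoc C A = (\<lambda>(I, x) (J, y) (K, z).
     Lens (lens_ten C A (lens_ten C A (I, x) (J, y)) (K, z))
       (lens_ten C A (I, x) (lens_ten C A (J, y) (K, z)))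
       (box_assoc A x y z I J K) (prd_assoc C x y z))"

definition lens_munit ::
  "('o, 'a, 'z) cartcat_scheme \<Rightarrow> ('o, 'a, 'p, 'q, 'y) mon_indexed_scheme \<Rightarrow> 'p \<times> 'o" where
  "lens_munit C A = (box_unit A, one C)"

definition lens_lunit ::
  "('o, 'a, 'z) cartcat_scheme \<Rightarrow> ('o, 'a, 'p, 'q, 'y) mon_indexed_scheme
    \<Rightarrow> 'p \<times> 'o \<Rightarrow> ('o, 'a, 'p, 'q) lens" where
  "lens_lunit C A = (\<lambda>(I, x). Lens (lens_ten C A (lens_munit C A) (I, x)) (I, x)
     (box_lunit A x I) (prd_lunit C x))"

definition lens_runit ::
  "('o, 'a, 'z) cartcat_scheme \<Rightarrow> ('o, 'a, 'p, 'q, 'y) mon_indexed_scheme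
    \<Rightarrow> 'p \<times> 'o \<Rightarrow> ('o, 'a, 'p, 'q) lens" where
  "lens_runit C A = (\<lambda>(I, x). Lens (lens_ten C A (I, x) (lens_munit C A)) (I, x)
     (box_runit A x I) (prd_runit C x))"

definition lens_moncat ::
  "('o, 'a, 'z) cartcat_scheme \<Rightarrow> ('o, 'a, 'p, 'q, 'y) mon_indexed_scheme
    \<Rightarrow> ('p \<times> 'o, ('o, 'a, 'p, 'q) lens) moncat" where
  "lens_moncat C A = cat.extend (lens_cat C A) (moncat.fields
     (lens_ten C A) (lens_tenar C A) (lens_munit C A)
     (lens_assoc C A) (lens_lunit C A) (lens_runit C A))"

locale dynamical_system_doctrine =
  indexed_category C A + cat_functor C "lens_cat C A" To Ta
  for C :: "('o, 'a, 'z) cat_scheme" (structure)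
    and A :: "('o, 'a, 'p, 'q, 'y) indexed_scheme"
    and To :: "'o \<Rightarrow> 'p \<times> 'o" and Ta :: "'a \<Rightarrow> ('o, 'a, 'p, 'q) lens" +
  assumes section_obs: "x \<in> obs C \<Longrightarrow> snd (To x) = x"
    and section_ars: "f \<in> ars C \<Longrightarrow> lens_fwd (Ta f) = f"


section \<open>Spans\<close>

text \<open>Composition by pullback is associative and unital only up to isomorphism of spans, so a morphism
  of the category of spans is an isomorphism class of spans, tagged with its source and target.\<close>

definition span_iso :: "('o, 'a, 'z) cat_scheme \<Rightarrow> (('a \<times> 'a) \<times> ('a \<times> 'a)) set" where
  "span_iso C = {((i, i'), (j, j')). i \<in> ars C \<and> i' \<in> ars C \<and> src C i = src C i' \<and>
     j \<in> ars C \<and> j' \<in> ars C \<and> src C j = src C j' \<and>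
     (\<exists>t \<in> isos C. t \<in> homs C (src C i) (src C j) \<and> t \<Zsemi>\<^bsub>C\<^esub> j = i \<and> t \<Zsemi>\<^bsub>C\<^esub> j' = i')}"

definition span_class :: "('o, 'a, 'z) cat_scheme \<Rightarrow> 'a \<Rightarrow> 'a \<Rightarrow> 'o \<times> ('a \<times> 'a) set \<times> 'o" where
  "span_class C i i' = (tgt C i, span_iso C `` {(i, i')}, tgt C i')"

definition span_ars :: "('o, 'a, 'z) cat_scheme \<Rightarrow> ('o \<times> ('a \<times> 'a) set \<times> 'o) set" where
  "span_ars C = {span_class C i i' | i i'. i \<in> ars C \<and> i' \<in> ars C \<and> src C i = src C i'}"

text \<open>In \<open>span_cmp\<close> and \<open>span_tenar\<close> all sets in the union coincide, by independence of the
  representatives and of the pullback.\<close>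

definition span_cmp ::
  "('o, 'a, 'z) cat_scheme \<Rightarrow> 'o \<times> ('a \<times> 'a) set \<times> 'o \<Rightarrow> 'o \<times> ('a \<times> 'a) set \<times> 'o
    \<Rightarrow> 'o \<times> ('a \<times> 'a) set \<times> 'o" where
  "span_cmp C = (\<lambda>(x, X, y) (y', Y, z).
     (x, \<Union>{span_iso C `` {(h \<Zsemi>\<^bsub>C\<^esub> i, k \<Zsemi>\<^bsub>C\<^esub> j')} | h k i i' j j'.
           (i, i') \<in> X \<and> (j, j') \<in> Y \<and> is_pullback C h k i' j}, z))"

definition span_tenar ::
  "('o, 'a, 'z) cartcat_scheme \<Rightarrow> 'o \<times> ('a \<times> 'a) set \<times> 'o \<Rightarrow> 'o \<times> ('a \<times> 'a) set \<times> 'o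
    \<Rightarrow> 'o \<times> ('a \<times> 'a) set \<times> 'o" where
  "span_tenar C = (\<lambda>(x, X, x') (y, Y, y').
     (prd C x y, \<Union>{span_iso C `` {(prdar C i j, prdar C i' j')} | i i' j j'.
           (i, i') \<in> X \<and> (j, j') \<in> Y}, prd C x' y'))"

definition span_of :: "('o, 'a, 'z) cat_scheme \<Rightarrow> 'a \<Rightarrow> 'o \<times> ('a \<times> 'a) set \<times> 'o" where
  "span_of C f = span_class C (ident C (src C f)) f"

definition span_moncat ::
  "('o, 'a, 'z) cartcat_scheme \<Rightarrow> ('o, 'o \<times> ('a \<times> 'a) set \<times> 'o) moncat" where
  "span_moncat C =
    \<lparr>obs = obs C, ars = span_ars C, src = fst, tgt = snd \<circ> snd,
     ident = (\<lambda>x. span_of C (ident C x)), cmp = span_cmp C,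
     ten = prd C, tenar = span_tenar C, munit = one C,
     assoc = (\<lambda>x y z. span_of C (prd_assoc C x y z)),
     lunit = (\<lambda>x. span_of C (prd_lunit C x)), runit = (\<lambda>x. span_of C (prd_runit C x))\<rparr>"


section \<open>The values of RSM\<close>

text \<open>As with spans, triples have to be taken up to isomorphism of the state object \<open>S\<close> for the action
  of spans by pullback to be strictly functorial.\<close>

definition rsm_triples ::
  "('o, 'a, 'z) cat_scheme \<Rightarrow> ('o, 'a, 'p, 'q, 'y) indexed_scheme \<Rightarrow> ('o \<Rightarrow> 'p \<times> 'o)
    \<Rightarrow> ('p \<times> 'o) \<times> 'o \<Rightarrow> ('o \<times> ('o, 'a, 'p, 'q) lens \<times> 'a) set" where
  "rsm_triples C A To = (\<lambda>(IO, M). {(S, l, p).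
     S \<in> obs C \<and> l \<in> homs (lens_cat C A) (To S) IO \<and> p \<in> homs C S M})"

definition rsm_iso ::
  "('o, 'a, 'z) cat_scheme \<Rightarrow> ('o, 'a, 'p, 'q, 'y) indexed_scheme \<Rightarrow> ('o \<Rightarrow> 'p \<times> 'o)
    \<Rightarrow> ('a \<Rightarrow> ('o, 'a, 'p, 'q) lens) \<Rightarrow> ('p \<times> 'o) \<times> 'o
    \<Rightarrow> (('o \<times> ('o, 'a, 'p, 'q) lens \<times> 'a) \<times> ('o \<times> ('o, 'a, 'p, 'q) lens \<times> 'a)) set" where
  "rsm_iso C A To Ta x = {((S, l, p), (S', l', p')).
     (S, l, p) \<in> rsm_triples C A To x \<and> (S', l', p') \<in> rsm_triples C A To x \<and>
     (\<exists>t \<in> isos C. t \<in> homs C S S' \<and> Ta t \<Zsemi>\<^bsub>lens_cat C A\<^esub> l' = l \<and> t \<Zsemi>\<^bsub>C\<^esub> p' = p)}"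

end

theory Submission
  imports Defs
begin

text \<open>The set \<open>RSM (X, M)\<close> consists of spans \<open>X \<leftarrow> S \<rightarrow> M\<close> whose left leg is a lens out of \<open>T S\<close>, and
  spans in \<open>C\<close> act on the right leg by the composition of spans. Every identity is therefore checked on
  one conveniently chosen pullback: pasting pullbacks gives functoriality, and the product of two
  pullback squares is a pullback square, which gives naturality of the laxator
  \<open>((S, l, p), (S', l', p')) \<mapsto> (S \<times> S', d \<Zsemi> (l \<otimes> l'), p \<times> p')\<close>. In the coherence laws the isomorphism
  of triples is the associator or unitor of \<open>C\<close> on state objects; it is an isomorphism of triples by
  the oplax laws for \<open>d\<close> and \<open>e\<close> and naturality of the structure lenses.\<close>

text \<open>The obstacle that shapes the proof is the lack of canonical choices: pullbacks are only
  known to exist, and both spans and triples are isomorphism classes. Nothing is chosen;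
  \<open>span_cmp\<close>, \<open>span_tenar\<close>, \<open>rsm_ar\<close> and
  \<open>rsm_mul\<close> are unions over all representatives and, where one occurs, over all
  pullbacks. Each of them has one evaluation lemma (\<open>span_cmp_class\<close>,
  \<open>span_tenar_class\<close>, \<open>rsm_ar_class\<close>, \<open>rsm_mul_class\<close>) saying
  that all sets in the union agree with the one computed from any given data; after that no union is
  seen again. Independence of the pullback always comes from \<open>pullback_iso\<close>. The laws
  of lenses are not assumed either. That they form a category, the interchange law and the
  naturality of the structure lenses are derived from the coherence data of \<open>A\<close>,
  typically one coherence axiom together with naturality of one family of fibre maps. Associators
  and unitors of spans are graphs of maps, so by \<open>rsm_ar_span_of\<close> they only compose
  with the right leg; this is why the coherence laws need no pullback except the trivial
  one.\<close>

lemma Union_eq: "\<lbrakk>c \<in> S; \<And>x. x \<in> S \<Longrightarrow> x = c\<rbrakk> \<Longrightarrow> \<Union>S = c"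
  by blast

lemma mem_homs [simp]: "f \<in> homs C x y \<longleftrightarrow> f \<in> ars C \<and> src C f = x \<and> tgt C f = y"
  by (simp add: homs_def)

section \<open>Composition, inverses and isomorphisms in a category\<close>

context category
begin

lemma cmp_ars [simp]: "\<lbrakk>f \<in> ars C; g \<in> ars C; tgt C f = src C g\<rbrakk> \<Longrightarrow> f \<Zsemi> g \<in> ars C"
  using cmp_homs by simp

lemma src_cmp [simp]: "\<lbrakk>f \<in> ars C; g \<in> ars C; tgt C f = src C g\<rbrakk> \<Longrightarrow> src C (f \<Zsemi> g) = src C f"
  using cmp_homs by simp

lemma tgt_cmp [simp]: "\<lbrakk>f \<in> ars C; g \<in> ars C; tgt C f = src C g\<rbrakk> \<Longrightarrow> tgt C (f \<Zsemi> g) = tgt C g"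
  using cmp_homs by simp

lemma ident_ars [simp]: "x \<in> obs C \<Longrightarrow> ident C x \<in> ars C"
  using ident_homs by simp

lemma src_ident [simp]: "x \<in> obs C \<Longrightarrow> src C (ident C x) = x"
  using ident_homs by simp

lemma tgt_ident [simp]: "x \<in> obs C \<Longrightarrow> tgt C (ident C x) = x"
  using ident_homs by simp

lemma ident_cmp_eq [simp]: "\<lbrakk>f \<in> ars C; src C f = x\<rbrakk> \<Longrightarrow> ident C x \<Zsemi> f = f"
  using ident_cmp by auto

lemma cmp_ident_eq [simp]: "\<lbrakk>f \<in> ars C; tgt C f = x\<rbrakk> \<Longrightarrow> f \<Zsemi> ident C x = f"
  using cmp_ident by auto

lemmas [simp] = src_obs tgt_obs cmp_assoc

text \<open>The simplifier nests composites to the right, so an equation between two-fold composites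
  cannot fire inside a longer one. This is its form with a tail \<open>h\<close>.\<close>

lemma cmp_reassoc:
  assumes "f \<Zsemi> g = f' \<Zsemi> g'" "f \<in> ars C" "g \<in> ars C" "f' \<in> ars C" "g' \<in> ars C" "h \<in> ars C"
    "tgt C f = src C g" "tgt C f' = src C g'" "tgt C g = src C h"
  shows "f \<Zsemi> (g \<Zsemi> h) = f' \<Zsemi> (g' \<Zsemi> h)"
  using assms by (metis cmp_assoc tgt_cmp)

lemma isosE:
  assumes "t \<in> isos C"
  obtains s where "s \<in> isos C" "s \<in> ars C" "src C s = tgt C t" "tgt C s = src C t"
    "t \<Zsemi> s = ident C (src C t)" "s \<Zsemi> t = ident C (tgt C t)" "t \<in> ars C"
  using assms unfolding isos_def by force

lemma cmp_inverse_cancel: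
  "\<lbrakk>s \<Zsemi> t = ident C x; s \<in> ars C; t \<in> ars C; tgt C s = src C t; h \<in> ars C; src C h = tgt C t; x = tgt C t\<rbrakk>
    \<Longrightarrow> s \<Zsemi> (t \<Zsemi> h) = h"
  by (simp flip: cmp_assoc)

lemma ident_isos [simp]: "x \<in> obs C \<Longrightarrow> ident C x \<in> isos C"
  unfolding isos_def by auto

lemma isosI:
  "\<lbrakk>t \<in> ars C; s \<in> ars C; src C s = tgt C t; tgt C s = src C t;
    t \<Zsemi> s = ident C (src C t); s \<Zsemi> t = ident C (tgt C t)\<rbrakk> \<Longrightarrow> t \<in> isos C"
  unfolding isos_def by auto

lemma cmp_isos:
  assumes "f \<in> isos C" "g \<in> isos C" "tgt C f = src C g"
  shows "f \<Zsemi> g \<in> isos C"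
proof -
  obtain f' where f: "f' \<in> ars C" "src C f' = tgt C f" "tgt C f' = src C f"
    "f \<Zsemi> f' = ident C (src C f)" "f' \<Zsemi> f = ident C (tgt C f)" "f \<in> ars C"
    using isosE[OF assms(1)] by metis
  obtain g' where g: "g' \<in> ars C" "src C g' = tgt C g" "tgt C g' = src C g"
    "g \<Zsemi> g' = ident C (src C g)" "g' \<Zsemi> g = ident C (tgt C g)" "g \<in> ars C"
    using isosE[OF assms(2)] by metis
  have "g \<Zsemi> (g' \<Zsemi> f') = f'" "f' \<Zsemi> (f \<Zsemi> g) = g"
    using f g assms(3) by (simp_all flip: cmp_assoc)
  then show ?thesis
    using f g assms(3) by (intro isosI[where s = "g' \<Zsemi> f'"]) simp_all
qed

end

context cat_functor
begin

lemma Fa_ars [simp]: "f \<in> ars C \<Longrightarrow> Fa f \<in> ars D"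
  and src_Fa [simp]: "f \<in> ars C \<Longrightarrow> src D (Fa f) = Fo (src C f)"
  and tgt_Fa [simp]: "f \<in> ars C \<Longrightarrow> tgt D (Fa f) = Fo (tgt C f)"
  using Fa_homs by simp_all

lemmas [simp] = Fo_obs Fa_ident Fa_cmp

end


section \<open>The category of lenses\<close>

lemma lens_cat_sel [simp]:
  "obs (lens_cat C A) = lens_obs C A" "ars (lens_cat C A) = lens_ars C A"
  "src (lens_cat C A) = lens_src" "tgt (lens_cat C A) = lens_tgt"
  "ident (lens_cat C A) = lens_ident C A" "cmp (lens_cat C A) = lens_cmp C A"
  by (simp_all add: lens_cat_def)

context indexed_category
begin

text \<open>The fibre varies with the object, so \<open>category\<close> is not interpreted once and
  for all; its facts become rewrite rules conditional on \<open>x \<in> obs C\<close>.\<close>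

lemma fib_obs [simp]:
  assumes "x \<in> obs C"
  shows "f \<in> ars (fib A x) \<Longrightarrow> src (fib A x) f \<in> obs (fib A x)"
    and "f \<in> ars (fib A x) \<Longrightarrow> tgt (fib A x) f \<in> obs (fib A x)"
    and "I \<in> obs (fib A x) \<Longrightarrow> ident (fib A x) I \<in> ars (fib A x)"
    and "I \<in> obs (fib A x) \<Longrightarrow> src (fib A x) (ident (fib A x) I) = I"
    and "I \<in> obs (fib A x) \<Longrightarrow> tgt (fib A x) (ident (fib A x) I) = I"
  using assms fib_category by (simp_all add: category.src_obs category.tgt_obs
      category.ident_ars category.src_ident category.tgt_ident)

lemma fib_cmp [simp]:
  assumes "x \<in> obs C" "f \<in> ars (fib A x)" "g \<in> ars (fib A x)" "tgt (fib A x) f = src (fib A x) g"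
  shows "f \<Zsemi>\<^bsub>fib A x\<^esub> g \<in> ars (fib A x)"
    and "src (fib A x) (f \<Zsemi>\<^bsub>fib A x\<^esub> g) = src (fib A x) f"
    and "tgt (fib A x) (f \<Zsemi>\<^bsub>fib A x\<^esub> g) = tgt (fib A x) g"
    and "\<lbrakk>h \<in> ars (fib A x); tgt (fib A x) g = src (fib A x) h\<rbrakk> \<Longrightarrow>
       (f \<Zsemi>\<^bsub>fib A x\<^esub> g) \<Zsemi>\<^bsub>fib A x\<^esub> h = f \<Zsemi>\<^bsub>fib A x\<^esub> (g \<Zsemi>\<^bsub>fib A x\<^esub> h)"
  using assms fib_category by (simp_all add: category.cmp_ars category.src_cmp category.tgt_cmp
      category.cmp_assoc)

lemma fib_ident_cmp [simp]:
  assumes "x \<in> obs C" "f \<in> ars (fib A x)"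
  shows "src (fib A x) f = I \<Longrightarrow> ident (fib A x) I \<Zsemi>\<^bsub>fib A x\<^esub> f = f"
    and "tgt (fib A x) f = I \<Longrightarrow> f \<Zsemi>\<^bsub>fib A x\<^esub> ident (fib A x) I = f"
  using assms fib_category category.ident_cmp category.cmp_ident by metis+

text \<open>The endpoints are premises rather than literal \<open>src C f\<close> and
  \<open>tgt C f\<close>, so that the rules also match a fibre whose index has already been
  rewritten, for instance to a product or to the source of the next map.\<close>

lemma pb_functor' [simp]:
  assumes "f \<in> ars C" "src C f = x" "tgt C f = y"
  shows "I \<in> obs (fib A y) \<Longrightarrow> pb_ob A f I \<in> obs (fib A x)"
    and "m \<in> ars (fib A y) \<Longrightarrow> pb_ar A f m \<in> ars (fib A x)"
    and "m \<in> ars (fib A y) \<Longrightarrow> src (fib A x) (pb_ar A f m) = pb_ob A f (src (fib A y) m)"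
    and "m \<in> ars (fib A y) \<Longrightarrow> tgt (fib A x) (pb_ar A f m) = pb_ob A f (tgt (fib A y) m)"
    and "I \<in> obs (fib A y) \<Longrightarrow> pb_ar A f (ident (fib A y) I) = ident (fib A x) (pb_ob A f I)"
    and "\<lbrakk>m \<in> ars (fib A y); n \<in> ars (fib A y); tgt (fib A y) m = src (fib A y) n\<rbrakk>
       \<Longrightarrow> pb_ar A f (m \<Zsemi>\<^bsub>fib A y\<^esub> n) = pb_ar A f m \<Zsemi>\<^bsub>fib A x\<^esub> pb_ar A f n"
  using pb_functor[OF assms(1)] assms(2,3) by (simp_all add: cat_functor.Fo_obs cat_functor.Fa_ars
      cat_functor.src_Fa cat_functor.tgt_Fa cat_functor.Fa_ident cat_functor.Fa_cmp)

lemma pb_id_sel [simp]: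
  assumes "x \<in> obs C" "I \<in> obs (fib A x)"
  shows "pb_id A x I \<in> ars (fib A x)"
    and "src (fib A x) (pb_id A x I) = pb_ob A (ident C x) I"
    and "tgt (fib A x) (pb_id A x I) = I"
  using nat_iso.component_homs[OF pb_id_iso] assms by auto

lemma pb_id_natural:
  "\<lbrakk>x \<in> obs C; m \<in> ars (fib A x)\<rbrakk> \<Longrightarrow>
    pb_ar A (ident C x) m \<Zsemi>\<^bsub>fib A x\<^esub> pb_id A x (tgt (fib A x) m)
    = pb_id A x (src (fib A x) m) \<Zsemi>\<^bsub>fib A x\<^esub> m"
  using nat_iso.naturality[OF pb_id_iso, of x m] by simp

lemma pb_cmp_sel [simp]:
  assumes "f \<in> ars C" "g \<in> ars C" "tgt C f = src C g" "I \<in> obs (fib A (tgt C g))" "src C f = x"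
  shows "pb_cmp A f g I \<in> ars (fib A x)"
    and "src (fib A x) (pb_cmp A f g I) = pb_ob A (f \<Zsemi> g) I"
    and "tgt (fib A x) (pb_cmp A f g I) = pb_ob A f (pb_ob A g I)"
  using nat_iso.component_homs[OF pb_cmp_iso] assms by auto

lemma pb_cmp_natural:
  "\<lbrakk>f \<in> ars C; g \<in> ars C; tgt C f = src C g; m \<in> ars (fib A (tgt C g));
    F = fib A (src C f); G = fib A (tgt C g)\<rbrakk> \<Longrightarrow>
    pb_ar A (f \<Zsemi> g) m \<Zsemi>\<^bsub>F\<^esub> pb_cmp A f g (tgt G m)
    = pb_cmp A f g (src G m) \<Zsemi>\<^bsub>F\<^esub> pb_ar A f (pb_ar A g m)"
  using nat_iso.naturality[OF pb_cmp_iso, of f g m] by simp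

text \<open>The endpoints are expressed through the two components, which leaves few equations to
  carry around. Only \<open>J\<close> stays free, because \<open>pb_ob A f J\<close> does not
  determine it.\<close>

lemma lens_arsE:
  assumes "k \<in> lens_ars C A"
  obtains b f J where "k = Lens (tgt (fib A (src C f)) b, src C f) (J, tgt C f) b f"
    "f \<in> ars C" "b \<in> ars (fib A (src C f))" "J \<in> obs (fib A (tgt C f))"
    "src (fib A (src C f)) b = pb_ob A f J"
  using assms unfolding lens_ars_def lens_obs_def by auto

lemma lens_arsI:
  "\<lbrakk>x \<in> obs C; f \<in> ars C; src C f = x; tgt C f = y;
    b \<in> ars (fib A x); J \<in> obs (fib A y);
    src (fib A x) b = pb_ob A f J; tgt (fib A x) b = I\<rbrakk> \<Longrightarrow> Lens (I, x) (J, y) b f \<in> lens_ars C A"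
  unfolding lens_ars_def lens_obs_def by auto

lemma lens_cmp_Lens [simp]:
  "lens_cmp C A (Lens X Y b f) (Lens Z W c g)
   = Lens X W (pb_cmp A f g (fst W) \<Zsemi>\<^bsub>fib A (src C f)\<^esub> pb_ar A f c \<Zsemi>\<^bsub>fib A (src C f)\<^esub> b) (f \<Zsemi> g)"
  by (simp add: lens_cmp_def Let_def)

text \<open>The unit laws are the two unit coherences of the pseudofunctor, the left one after
  naturality of \<open>pb_id\<close>. Associativity is \<open>pb_assoc\<close> once the last
  backward map has been moved past \<open>pb_cmp\<close> by naturality.\<close>

lemma lens_category: "category (lens_cat C A)"
proof (rule category.intro, goal_cases)
  case (1 f)
  then show ?case
    by (auto simp: lens_obs_def elim!: lens_arsE)
next
  case (2 f)
  then show ?case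
    by (auto simp: lens_obs_def elim!: lens_arsE)
next
  case (3 x)
  then show ?case
    by (auto simp: lens_obs_def lens_ident_def intro!: lens_arsI)
next
  case (4 f g)
  then show ?case
    by (auto elim!: lens_arsE intro!: lens_arsI)
next
  case (5 k)
  then have "k \<in> lens_ars C A"
    by simp
  then obtain b f J where k: "k = Lens (tgt (fib A (src C f)) b, src C f) (J, tgt C f) b f"
    "f \<in> ars C" "b \<in> ars (fib A (src C f))" "J \<in> obs (fib A (tgt C f))"
    "src (fib A (src C f)) b = pb_ob A f J"
    by (rule lens_arsE)
  show ?case
    \<comment> \<open>Naturality moves \<open>pb_id\<close> in front of \<open>b\<close>; bracketing
      to the left then brings \<open>pb_cmp\<close> and \<open>pb_id\<close> together, and their
      composite is an identity by \<open>pb_id_cmp\<close>.\<close>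
    using k pb_id_natural[of "src C f" b] pb_id_cmp[of f J]
    by (simp add: lens_ident_def) (simp flip: fib_cmp(4))
next
  case (6 k)
  then have "k \<in> lens_ars C A"
    by simp
  then obtain b f J where k: "k = Lens (tgt (fib A (src C f)) b, src C f) (J, tgt C f) b f"
    "f \<in> ars C" "b \<in> ars (fib A (src C f))" "J \<in> obs (fib A (tgt C f))"
    "src (fib A (src C f)) b = pb_ob A f J"
    by (rule lens_arsE)
  show ?case
    using k pb_cmp_id[of f J]
    by (simp add: lens_ident_def)
next
  case (7 k l m)
  then have "k \<in> lens_ars C A" "l \<in> lens_ars C A" "m \<in> lens_ars C A"
    by simp_all
  then obtain b f J c g K d h L where
    k: "k = Lens (tgt (fib A (src C f)) b, src C f) (J, tgt C f) b f"
    "f \<in> ars C" "b \<in> ars (fib A (src C f))" "J \<in> obs (fib A (tgt C f))"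
    "src (fib A (src C f)) b = pb_ob A f J" and
    l: "l = Lens (tgt (fib A (src C g)) c, src C g) (K, tgt C g) c g"
    "g \<in> ars C" "c \<in> ars (fib A (src C g))" "K \<in> obs (fib A (tgt C g))"
    "src (fib A (src C g)) c = pb_ob A g K" and
    m: "m = Lens (tgt (fib A (src C h)) d, src C h) (L, tgt C h) d h"
    "h \<in> ars C" "d \<in> ars (fib A (src C h))" "L \<in> obs (fib A (tgt C h))"
    "src (fib A (src C h)) d = pb_ob A h L"
    by (elim lens_arsE) blast
  have fgh: "tgt C f = src C g" "tgt C g = src C h"
    and J: "J = tgt (fib A (src C g)) c" and K: "K = tgt (fib A (src C h)) d"
    using 7(4,5) k l m by auto
  let ?F = "fib A (src C f)"
  note [simp] = fgh J K and k' = k(2,3,5) l(2,3,5) m(2-5)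
  have "pb_cmp A (f \<Zsemi> g) h L \<Zsemi>\<^bsub>?F\<^esub> (pb_ar A (f \<Zsemi> g) d \<Zsemi>\<^bsub>?F\<^esub> (pb_cmp A f g K \<Zsemi>\<^bsub>?F\<^esub> (pb_ar A f c \<Zsemi>\<^bsub>?F\<^esub> b)))
    = (pb_cmp A (f \<Zsemi> g) h L \<Zsemi>\<^bsub>?F\<^esub> (pb_ar A (f \<Zsemi> g) d \<Zsemi>\<^bsub>?F\<^esub> pb_cmp A f g K)) \<Zsemi>\<^bsub>?F\<^esub> (pb_ar A f c \<Zsemi>\<^bsub>?F\<^esub> b)"
    using k' by simp
  also have "\<dots> = (pb_cmp A (f \<Zsemi> g) h L \<Zsemi>\<^bsub>?F\<^esub> pb_cmp A f g (pb_ob A h L)) \<Zsemi>\<^bsub>?F\<^esub> (pb_ar A f (pb_ar A g d) \<Zsemi>\<^bsub>?F\<^esub> (pb_ar A f c \<Zsemi>\<^bsub>?F\<^esub> b))"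
    using k' pb_cmp_natural[of f g d] by simp
  also have "\<dots> = pb_cmp A f (g \<Zsemi> h) L \<Zsemi>\<^bsub>?F\<^esub> (pb_ar A f (pb_cmp A g h L) \<Zsemi>\<^bsub>?F\<^esub> (pb_ar A f (pb_ar A g d) \<Zsemi>\<^bsub>?F\<^esub> (pb_ar A f c \<Zsemi>\<^bsub>?F\<^esub> b)))"
    by (subst pb_assoc) (use k' in simp_all)
  finally show ?case
    using k l m by simp
qed

end


section \<open>Cartesian structure\<close>

context cartesian_category
begin

lemmas [simp] = one_obs prd_obs

lemma pr_sel [simp]:
  assumes "x \<in> obs C" "y \<in> obs C"
  shows "pr1 C x y \<in> ars C" "src C (pr1 C x y) = prd C x y" "tgt C (pr1 C x y) = x"
    "pr2 C x y \<in> ars C" "src C (pr2 C x y) = prd C x y" "tgt C (pr2 C x y) = y"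
  using pr1_homs pr2_homs assms by auto

lemma pairing_sel [simp]:
  assumes "f \<in> ars C" "g \<in> ars C" "src C f = src C g"
  shows "pairing C f g \<in> ars C" "src C (pairing C f g) = src C g"
    "tgt C (pairing C f g) = prd C (tgt C f) (tgt C g)"
    "\<lbrakk>tgt C f = x; tgt C g = y\<rbrakk> \<Longrightarrow> pairing C f g \<Zsemi> pr1 C x y = f"
    "\<lbrakk>tgt C f = x; tgt C g = y\<rbrakk> \<Longrightarrow> pairing C f g \<Zsemi> pr2 C x y = g"
proof -
  have "pairing C f g \<in> homs C (src C f) (prd C (tgt C f) (tgt C g))
      \<and> pairing C f g \<Zsemi> pr1 C (tgt C f) (tgt C g) = f \<and> pairing C f g \<Zsemi> pr2 C (tgt C f) (tgt C g) = g"
    unfolding pairing_def by (rule theI'[OF prd_universal[OF assms]])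
  then show "pairing C f g \<in> ars C" "src C (pairing C f g) = src C g"
    "tgt C (pairing C f g) = prd C (tgt C f) (tgt C g)"
    "\<lbrakk>tgt C f = x; tgt C g = y\<rbrakk> \<Longrightarrow> pairing C f g \<Zsemi> pr1 C x y = f"
    "\<lbrakk>tgt C f = x; tgt C g = y\<rbrakk> \<Longrightarrow> pairing C f g \<Zsemi> pr2 C x y = g"
    using assms(3) by simp_all
qed

lemma pairing_cmp [simp]:
  assumes "f \<in> ars C" "g \<in> ars C" "src C f = src C g" "tgt C f = x" "tgt C g = y" "h \<in> ars C"
  shows "src C h = x \<Longrightarrow> pairing C f g \<Zsemi> (pr1 C x y \<Zsemi> h) = f \<Zsemi> h"
    and "src C h = y \<Longrightarrow> pairing C f g \<Zsemi> (pr2 C x y \<Zsemi> h) = g \<Zsemi> h"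
proof -
  have "x \<in> obs C" "y \<in> obs C"
    using assms by auto
  then show "src C h = x \<Longrightarrow> pairing C f g \<Zsemi> (pr1 C x y \<Zsemi> h) = f \<Zsemi> h"
    "src C h = y \<Longrightarrow> pairing C f g \<Zsemi> (pr2 C x y \<Zsemi> h) = g \<Zsemi> h"
    using assms by (simp_all flip: cmp_assoc)
qed

text \<open>Joint monicity of the projections. Identities in the cartesian structure are reduced by
  it to their components, which the rules for \<open>pairing\<close> and \<open>prdar\<close>
  compute.\<close>

lemma prd_eqI:
  assumes "x \<in> obs C" "y \<in> obs C" "h \<in> ars C" "h' \<in> ars C" "src C h = src C h'"
    "tgt C h = prd C x y" "tgt C h' = prd C x y"
    "h \<Zsemi> pr1 C x y = h' \<Zsemi> pr1 C x y" "h \<Zsemi> pr2 C x y = h' \<Zsemi> pr2 C x y"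
  shows "h = h'"
proof -
  have "\<exists>!k. k \<in> homs C (src C h) (prd C x y)
      \<and> k \<Zsemi> pr1 C x y = h \<Zsemi> pr1 C x y \<and> k \<Zsemi> pr2 C x y = h \<Zsemi> pr2 C x y"
    using prd_universal[of "h \<Zsemi> pr1 C x y" "h \<Zsemi> pr2 C x y"] assms(1-7) by simp
  moreover have "h \<in> homs C (src C h) (prd C x y)" "h' \<in> homs C (src C h) (prd C x y)"
    using assms(3-7) by simp_all
  ultimately show ?thesis
    using assms(8,9) by metis
qed

lemma prdar_sel [simp]:
  assumes "f \<in> ars C" "g \<in> ars C"
  shows "prdar C f g \<in> ars C" "src C (prdar C f g) = prd C (src C f) (src C g)"
    "tgt C (prdar C f g) = prd C (tgt C f) (tgt C g)"
    "\<lbrakk>tgt C f = x; tgt C g = y\<rbrakk> \<Longrightarrow> prdar C f g \<Zsemi> pr1 C x y = pr1 C (src C f) (src C g) \<Zsemi> f"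
    "\<lbrakk>tgt C f = x; tgt C g = y\<rbrakk> \<Longrightarrow> prdar C f g \<Zsemi> pr2 C x y = pr2 C (src C f) (src C g) \<Zsemi> g"
    "\<lbrakk>tgt C f = x; tgt C g = y; h \<in> ars C; src C h = x\<rbrakk> \<Longrightarrow>
      prdar C f g \<Zsemi> (pr1 C x y \<Zsemi> h) = pr1 C (src C f) (src C g) \<Zsemi> (f \<Zsemi> h)"
    "\<lbrakk>tgt C f = x; tgt C g = y; h \<in> ars C; src C h = y\<rbrakk> \<Longrightarrow>
      prdar C f g \<Zsemi> (pr2 C x y \<Zsemi> h) = pr2 C (src C f) (src C g) \<Zsemi> (g \<Zsemi> h)"
  using assms unfolding prdar_def by auto

lemma prdar_ident [simp]:
  "\<lbrakk>x \<in> obs C; y \<in> obs C\<rbrakk> \<Longrightarrow> prdar C (ident C x) (ident C y) = ident C (prd C x y)"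
  by (rule prd_eqI[where x = x and y = y]) auto

lemma prdar_cmp:
  "\<lbrakk>f \<in> ars C; g \<in> ars C; f' \<in> ars C; g' \<in> ars C; tgt C f = src C f'; tgt C g = src C g'\<rbrakk> \<Longrightarrow>
    prdar C (f \<Zsemi> f') (g \<Zsemi> g') = prdar C f g \<Zsemi> prdar C f' g'"
  by (rule prd_eqI[where x = "tgt C f'" and y = "tgt C g'"]) auto

lemma prd_assoc_sel [simp]:
  assumes "x \<in> obs C" "y \<in> obs C" "z \<in> obs C"
  shows "prd_assoc C x y z \<in> ars C" "src C (prd_assoc C x y z) = prd C (prd C x y) z"
    "tgt C (prd_assoc C x y z) = prd C x (prd C y z)"
    "prd_assoc C x y z \<Zsemi> pr1 C x (prd C y z) = pr1 C (prd C x y) z \<Zsemi> pr1 C x y"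
    "prd_assoc C x y z \<Zsemi> (pr2 C x (prd C y z) \<Zsemi> pr1 C y z) = pr1 C (prd C x y) z \<Zsemi> pr2 C x y"
    "prd_assoc C x y z \<Zsemi> (pr2 C x (prd C y z) \<Zsemi> pr2 C y z) = pr2 C (prd C x y) z"
    "\<lbrakk>h \<in> ars C; src C h = x\<rbrakk> \<Longrightarrow>
      prd_assoc C x y z \<Zsemi> (pr1 C x (prd C y z) \<Zsemi> h) = pr1 C (prd C x y) z \<Zsemi> (pr1 C x y \<Zsemi> h)"
    "\<lbrakk>h \<in> ars C; src C h = y\<rbrakk> \<Longrightarrow>
      prd_assoc C x y z \<Zsemi> (pr2 C x (prd C y z) \<Zsemi> (pr1 C y z \<Zsemi> h)) = pr1 C (prd C x y) z \<Zsemi> (pr2 C x y \<Zsemi> h)"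
    "\<lbrakk>h \<in> ars C; src C h = z\<rbrakk> \<Longrightarrow>
      prd_assoc C x y z \<Zsemi> (pr2 C x (prd C y z) \<Zsemi> (pr2 C y z \<Zsemi> h)) = pr2 C (prd C x y) z \<Zsemi> h"
  using assms unfolding prd_assoc_def by auto

lemma prd_assoc_natural:
  assumes "f \<in> ars C" "g \<in> ars C" "h \<in> ars C"
  shows "prdar C (prdar C f g) h \<Zsemi> prd_assoc C (tgt C f) (tgt C g) (tgt C h)
    = prd_assoc C (src C f) (src C g) (src C h) \<Zsemi> prdar C f (prdar C g h)"
proof (rule prd_eqI[where x = "tgt C f" and y = "prd C (tgt C g) (tgt C h)"])
  show "prdar C (prdar C f g) h \<Zsemi> prd_assoc C (tgt C f) (tgt C g) (tgt C h) \<Zsemi> pr2 C (tgt C f) (prd C (tgt C g) (tgt C h))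
    = prd_assoc C (src C f) (src C g) (src C h) \<Zsemi> prdar C f (prdar C g h) \<Zsemi> pr2 C (tgt C f) (prd C (tgt C g) (tgt C h))"
    by (rule prd_eqI[where x = "tgt C g" and y = "tgt C h"]) (use assms in auto)
qed (use assms in auto)

lemma prd_assoc_isos [simp]:
  assumes "x \<in> obs C" "y \<in> obs C" "z \<in> obs C"
  shows "prd_assoc C x y z \<in> isos C"
proof -
  let ?p1 = "pr1 C x (prd C y z)" and ?p2 = "pr2 C x (prd C y z)"
  \<comment> \<open>The inverse associator, given by its three components.\<close>
  define s where "s = pairing C (pairing C ?p1 (?p2 \<Zsemi> pr1 C y z)) (?p2 \<Zsemi> pr2 C y z)"
  have s: "s \<in> ars C" "src C s = prd C x (prd C y z)" "tgt C s = prd C (prd C x y) z"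
    using assms by (auto simp: s_def)
  have s1: "s \<Zsemi> pr1 C (prd C x y) z = pairing C ?p1 (?p2 \<Zsemi> pr1 C y z)"
    "s \<Zsemi> pr2 C (prd C x y) z = ?p2 \<Zsemi> pr2 C y z"
    using assms by (auto simp: s_def)
  have s2: "s \<Zsemi> (pr1 C (prd C x y) z \<Zsemi> pr1 C x y) = ?p1"
    "s \<Zsemi> (pr1 C (prd C x y) z \<Zsemi> pr2 C x y) = ?p2 \<Zsemi> pr1 C y z"
    using assms by (auto simp: s_def)
  have "prd_assoc C x y z \<Zsemi> s \<Zsemi> pr1 C (prd C x y) z
    = ident C (prd C (prd C x y) z) \<Zsemi> pr1 C (prd C x y) z"
    by (rule prd_eqI[where x = x and y = y]) (use assms s s1 in auto)
  then have "prd_assoc C x y z \<Zsemi> s = ident C (prd C (prd C x y) z)"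
    by - (rule prd_eqI[where x = "prd C x y" and y = z], use assms s s1 in auto)
  moreover have "s \<Zsemi> prd_assoc C x y z \<Zsemi> pr2 C x (prd C y z)
    = ident C (prd C x (prd C y z)) \<Zsemi> pr2 C x (prd C y z)"
    by (rule prd_eqI[where x = y and y = z]) (use assms s s1 s2 in auto)
  then have "s \<Zsemi> prd_assoc C x y z = ident C (prd C x (prd C y z))"
    by - (rule prd_eqI[where x = x and y = "prd C y z"], use assms s s2 in auto)
  ultimately show ?thesis
    using assms s by (intro isosI[where s = s]) auto
qed

lemma to_one_eqI:
  "\<lbrakk>f \<in> ars C; g \<in> ars C; src C f = src C g; tgt C f = one C; tgt C g = one C\<rbrakk> \<Longrightarrow> f = g"
  using one_terminal[of "src C f"] src_obs[of f] unfolding mem_homs by metis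

lemma prd_lunit_sel [simp]:
  assumes "x \<in> obs C"
  shows "prd_lunit C x \<in> ars C" "src C (prd_lunit C x) = prd C (one C) x" "tgt C (prd_lunit C x) = x"
    "prd_runit C x \<in> ars C" "src C (prd_runit C x) = prd C x (one C)" "tgt C (prd_runit C x) = x"
  using assms by (auto simp: prd_lunit_def prd_runit_def)

lemma prd_lunit_natural:
  "f \<in> ars C \<Longrightarrow>
    prdar C (ident C (one C)) f \<Zsemi> prd_lunit C (tgt C f) = prd_lunit C (src C f) \<Zsemi> f"
  by (simp add: prd_lunit_def)

lemma prd_runit_natural:
  "f \<in> ars C \<Longrightarrow>
    prdar C f (ident C (one C)) \<Zsemi> prd_runit C (tgt C f) = prd_runit C (src C f) \<Zsemi> f"
  by (simp add: prd_runit_def)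

lemma prd_lunit_isos [simp]:
  assumes "x \<in> obs C"
  shows "prd_lunit C x \<in> isos C"
proof -
  \<comment> \<open>The map to the terminal object; paired with the identity it is the inverse of
    the unitor, because any two maps into \<open>one C\<close> with the same source agree.\<close>
  obtain t where t: "t \<in> ars C" "src C t = x" "tgt C t = one C"
    using one_terminal[OF assms] by auto
  have "prd_lunit C x \<Zsemi> pairing C t (ident C x) = ident C (prd C (one C) x)"
    by (rule prd_eqI[where x = "one C" and y = x]) (use assms t in \<open>auto simp: prd_lunit_def intro: to_one_eqI\<close>)
  then show ?thesis
    using assms t by (intro isosI[where s = "pairing C t (ident C x)"]) (auto simp: prd_lunit_def)
qed

lemma prd_runit_isos [simp]:
  assumes "x \<in> obs C"
  shows "prd_runit C x \<in> isos C"
proof -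
  obtain t where t: "t \<in> ars C" "src C t = x" "tgt C t = one C"
    using one_terminal[OF assms] by auto
  have "prd_runit C x \<Zsemi> pairing C (ident C x) t = ident C (prd C x (one C))"
    by (rule prd_eqI[where x = x and y = "one C"]) (use assms t in \<open>auto simp: prd_runit_def intro: to_one_eqI\<close>)
  then show ?thesis
    using assms t by (intro isosI[where s = "pairing C (ident C x) t"]) (auto simp: prd_runit_def)
qed

lemma prdar_isos:
  assumes "f \<in> isos C" "g \<in> isos C"
  shows "prdar C f g \<in> isos C"
proof -
  obtain f' where f: "f' \<in> ars C" "src C f' = tgt C f" "tgt C f' = src C f"
    "f \<Zsemi> f' = ident C (src C f)" "f' \<Zsemi> f = ident C (tgt C f)" "f \<in> ars C"
    using isosE[OF assms(1)] by metis
  obtain g' where g: "g' \<in> ars C" "src C g' = tgt C g" "tgt C g' = src C g"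
    "g \<Zsemi> g' = ident C (src C g)" "g' \<Zsemi> g = ident C (tgt C g)" "g \<in> ars C"
    using isosE[OF assms(2)] by metis
  show ?thesis
    using f g by (intro isosI[where s = "prdar C f' g'"]) (simp_all flip: prdar_cmp)
qed

end


section \<open>The tensor product of lenses\<close>

context monoidal_indexed_category
begin

lemma box_functor' [simp]:
  assumes "x \<in> obs C" "y \<in> obs C"
  shows "\<lbrakk>I \<in> obs (fib A x); J \<in> obs (fib A y)\<rbrakk> \<Longrightarrow> box A x y I J \<in> obs (fib A (prd C x y))"
    and "\<lbrakk>m \<in> ars (fib A x); n \<in> ars (fib A y)\<rbrakk> \<Longrightarrow> boxar A x y m n \<in> ars (fib A (prd C x y))"
    and "\<lbrakk>m \<in> ars (fib A x); n \<in> ars (fib A y)\<rbrakk> \<Longrightarrow>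
      src (fib A (prd C x y)) (boxar A x y m n) = box A x y (src (fib A x) m) (src (fib A y) n)"
    and "\<lbrakk>m \<in> ars (fib A x); n \<in> ars (fib A y)\<rbrakk> \<Longrightarrow>
      tgt (fib A (prd C x y)) (boxar A x y m n) = box A x y (tgt (fib A x) m) (tgt (fib A y) n)"
    and "\<lbrakk>I \<in> obs (fib A x); J \<in> obs (fib A y)\<rbrakk> \<Longrightarrow>
      boxar A x y (ident (fib A x) I) (ident (fib A y) J) = ident (fib A (prd C x y)) (box A x y I J)"
  using cat_functor.Fo_obs[OF box_functor[OF assms], of "(I, J)"]
    cat_functor.Fa_homs[OF box_functor[OF assms], of "(m, n)"]
    cat_functor.Fa_ident[OF box_functor[OF assms], of "(I, J)"]
  by (auto simp: prod_cat_def)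

lemma boxar_cmp:
  assumes "x \<in> obs C" "y \<in> obs C" "m \<in> ars (fib A x)" "n \<in> ars (fib A y)" "m' \<in> ars (fib A x)" "n' \<in> ars (fib A y)"
    "tgt (fib A x) m = src (fib A x) m'" "tgt (fib A y) n = src (fib A y) n'"
  shows "boxar A x y (m \<Zsemi>\<^bsub>fib A x\<^esub> m') (n \<Zsemi>\<^bsub>fib A y\<^esub> n')
    = boxar A x y m n \<Zsemi>\<^bsub>fib A (prd C x y)\<^esub> boxar A x y m' n'"
  using cat_functor.Fa_cmp[OF box_functor[OF assms(1,2)], of "(m, n)" "(m', n')"] assms
  by (auto simp: prod_cat_def)

lemma box_pb_sel [simp]:
  assumes "f \<in> ars C" "g \<in> ars C" "I \<in> obs (fib A (tgt C f))" "J \<in> obs (fib A (tgt C g))"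
    "prd C (src C f) (src C g) = z"
  shows "box_pb A f g I J \<in> ars (fib A z)"
    and "src (fib A z) (box_pb A f g I J) = pb_ob A (prdar C f g) (box A (tgt C f) (tgt C g) I J)"
    and "tgt (fib A z) (box_pb A f g I J) = box A (src C f) (src C g) (pb_ob A f I) (pb_ob A g J)"
  using nat_iso.component_homs[OF box_pb_iso, of f g "(I, J)"] assms by (auto simp: prod_cat_def)

lemma box_pb_natural:
  "\<lbrakk>f \<in> ars C; g \<in> ars C; m \<in> ars (fib A (tgt C f)); n \<in> ars (fib A (tgt C g));
    tgt (fib A (tgt C f)) m = I; tgt (fib A (tgt C g)) n = J; prd C (src C f) (src C g) = z\<rbrakk> \<Longrightarrow>
    pb_ar A (prdar C f g) (boxar A (tgt C f) (tgt C g) m n) \<Zsemi>\<^bsub>fib A z\<^esub> box_pb A f g I J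
    = box_pb A f g (src (fib A (tgt C f)) m) (src (fib A (tgt C g)) n)
      \<Zsemi>\<^bsub>fib A z\<^esub> boxar A (src C f) (src C g) (pb_ar A f m) (pb_ar A g n)"
  using nat_iso.naturality[OF box_pb_iso, of f g "(m, n)"] by (auto simp: prod_cat_def)

lemma box_assoc_sel [simp]:
  assumes "x \<in> obs C" "y \<in> obs C" "z \<in> obs C" "I \<in> obs (fib A x)" "J \<in> obs (fib A y)" "K \<in> obs (fib A z)"
  shows "box_assoc A x y z I J K \<in> ars (fib A (prd C (prd C x y) z))"
    and "src (fib A (prd C (prd C x y) z)) (box_assoc A x y z I J K)
      = pb_ob A (prd_assoc C x y z) (box A x (prd C y z) I (box A y z J K))"
    and "tgt (fib A (prd C (prd C x y) z)) (box_assoc A x y z I J K) = box A (prd C x y) z (box A x y I J) K"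
  using nat_iso.component_homs[OF box_assoc_iso, of x y z "((I, J), K)"] assms by (auto simp: prod_cat_def)

lemma box_assoc_natural:
  "\<lbrakk>x \<in> obs C; y \<in> obs C; z \<in> obs C; l \<in> ars (fib A x); m \<in> ars (fib A y); n \<in> ars (fib A z);
    F = fib A (prd C (prd C x y) z)\<rbrakk> \<Longrightarrow>
    pb_ar A (prd_assoc C x y z) (boxar A x (prd C y z) l (boxar A y z m n))
      \<Zsemi>\<^bsub>F\<^esub> box_assoc A x y z (tgt (fib A x) l) (tgt (fib A y) m) (tgt (fib A z) n)
    = box_assoc A x y z (src (fib A x) l) (src (fib A y) m) (src (fib A z) n)
      \<Zsemi>\<^bsub>F\<^esub> boxar A (prd C x y) z (boxar A x y l m) n"
  using nat_iso.naturality[OF box_assoc_iso, of x y z "((l, m), n)"] by (auto simp: prod_cat_def)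

lemmas [simp] = box_unit_obs

lemma box_lunit_sel [simp]:
  assumes "x \<in> obs C" "I \<in> obs (fib A x)"
  shows "box_lunit A x I \<in> ars (fib A (prd C (one C) x))"
    and "src (fib A (prd C (one C) x)) (box_lunit A x I) = pb_ob A (prd_lunit C x) I"
    and "tgt (fib A (prd C (one C) x)) (box_lunit A x I) = box A (one C) x (box_unit A) I"
    and "box_runit A x I \<in> ars (fib A (prd C x (one C)))"
    and "src (fib A (prd C x (one C))) (box_runit A x I) = pb_ob A (prd_runit C x) I"
    and "tgt (fib A (prd C x (one C))) (box_runit A x I) = box A x (one C) I (box_unit A)"
  using nat_iso.component_homs[OF box_lunit_iso, of x I]
    nat_iso.component_homs[OF box_runit_iso, of x I] assms by auto

lemma box_lunit_natural:
  "\<lbrakk>x \<in> obs C; m \<in> ars (fib A x); F = fib A (prd C (one C) x)\<rbrakk> \<Longrightarrow>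
    pb_ar A (prd_lunit C x) m \<Zsemi>\<^bsub>F\<^esub> box_lunit A x (tgt (fib A x) m)
    = box_lunit A x (src (fib A x) m)
      \<Zsemi>\<^bsub>F\<^esub> boxar A (one C) x (ident (fib A (one C)) (box_unit A)) m"
  using nat_iso.naturality[OF box_lunit_iso, of x m] by auto

lemma box_runit_natural:
  "\<lbrakk>x \<in> obs C; m \<in> ars (fib A x); F = fib A (prd C x (one C))\<rbrakk> \<Longrightarrow>
    pb_ar A (prd_runit C x) m \<Zsemi>\<^bsub>F\<^esub> box_runit A x (tgt (fib A x) m)
    = box_runit A x (src (fib A x) m)
      \<Zsemi>\<^bsub>F\<^esub> boxar A x (one C) m (ident (fib A (one C)) (box_unit A))"
  using nat_iso.naturality[OF box_runit_iso, of x m] by auto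

lemma lens_tenar_Lens [simp]:
  "lens_tenar C A (Lens X X' b f) (Lens Y Y' c g)
   = Lens (lens_ten C A X Y) (lens_ten C A X' Y')
       (box_pb A f g (fst X') (fst Y')
         \<Zsemi>\<^bsub>fib A (prd C (src C f) (src C g))\<^esub> boxar A (src C f) (src C g) b c)
       (prdar C f g)"
  by (simp add: lens_tenar_def Let_def)

lemma lens_ten_pair [simp]: "lens_ten C A (I, x) (J, y) = (box A x y I J, prd C x y)"
  by (simp add: lens_ten_def)

lemma lens_munit_obs [simp]: "lens_munit C A \<in> lens_obs C A"
  by (simp add: lens_obs_def lens_munit_def)

lemma lens_tenar_ars [simp]:
  assumes "k \<in> lens_ars C A" "l \<in> lens_ars C A"
  shows "lens_tenar C A k l \<in> lens_ars C A"
    and "lens_src (lens_tenar C A k l) = lens_ten C A (lens_src k) (lens_src l)"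
    and "lens_tgt (lens_tenar C A k l) = lens_ten C A (lens_tgt k) (lens_tgt l)"
  using assms by (auto elim!: lens_arsE intro!: lens_arsI)

text \<open>Interchange. The forward maps agree by \<open>prdar_cmp\<close>. For the backward maps,
  functoriality of the laxator splits the box of composites, \<open>box_pb_cmp\<close> exchanges the
  composition coherences, and naturality of \<open>box_pb\<close> puts \<open>b'\<close> and
  \<open>c'\<close> under the pullback along \<open>prdar C f g\<close>.\<close>

lemma lens_tenar_cmp:
  assumes "k \<in> lens_ars C A" "l \<in> lens_ars C A" "k' \<in> lens_ars C A" "l' \<in> lens_ars C A"
    "lens_tgt k = lens_src k'" "lens_tgt l = lens_src l'"
  shows "lens_tenar C A (lens_cmp C A k k') (lens_cmp C A l l')
    = lens_cmp C A (lens_tenar C A k l) (lens_tenar C A k' l')"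
proof -
  obtain b f J where
    k: "k = Lens (tgt (fib A (src C f)) b, src C f) (J, tgt C f) b f"
    "f \<in> ars C" "b \<in> ars (fib A (src C f))" "src (fib A (src C f)) b = pb_ob A f J"
    using assms(1) by (rule lens_arsE)
  obtain c g K where
    l: "l = Lens (tgt (fib A (src C g)) c, src C g) (K, tgt C g) c g"
    "g \<in> ars C" "c \<in> ars (fib A (src C g))" "src (fib A (src C g)) c = pb_ob A g K"
    using assms(2) by (rule lens_arsE)
  obtain b' f' I' where
    k': "k' = Lens (tgt (fib A (src C f')) b', src C f') (I', tgt C f') b' f'"
    "f' \<in> ars C" "b' \<in> ars (fib A (src C f'))" "I' \<in> obs (fib A (tgt C f'))"
    "src (fib A (src C f')) b' = pb_ob A f' I'"
    using assms(3) by (rule lens_arsE)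
  obtain c' g' J' where
    l': "l' = Lens (tgt (fib A (src C g')) c', src C g') (J', tgt C g') c' g'"
    "g' \<in> ars C" "c' \<in> ars (fib A (src C g'))" "J' \<in> obs (fib A (tgt C g'))"
    "src (fib A (src C g')) c' = pb_ob A g' J'"
    using assms(4) by (rule lens_arsE)
  have eqs [simp]: "tgt C f = src C f'" "tgt C g = src C g'"
    and J: "J = tgt (fib A (src C f')) b'" and K: "K = tgt (fib A (src C g')) c'"
    using assms(5,6) k l k' l' by auto
  note [simp] = k(2-) l(2-) k'(2-) l'(2-)
  let ?F = "fib A (prd C (src C f) (src C g))" and ?B = "boxar A (src C f) (src C g)"
  let ?X = "box A (tgt C f') (tgt C g') I' J'"
  have "box_pb A (f \<Zsemi> f') (g \<Zsemi> g') I' J'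
      \<Zsemi>\<^bsub>?F\<^esub> ?B (pb_cmp A f f' I' \<Zsemi>\<^bsub>fib A (src C f)\<^esub> (pb_ar A f b' \<Zsemi>\<^bsub>fib A (src C f)\<^esub> b))
          (pb_cmp A g g' J' \<Zsemi>\<^bsub>fib A (src C g)\<^esub> (pb_ar A g c' \<Zsemi>\<^bsub>fib A (src C g)\<^esub> c))
    = (box_pb A (f \<Zsemi> f') (g \<Zsemi> g') I' J' \<Zsemi>\<^bsub>?F\<^esub> ?B (pb_cmp A f f' I') (pb_cmp A g g' J'))
      \<Zsemi>\<^bsub>?F\<^esub> ?B (pb_ar A f b') (pb_ar A g c') \<Zsemi>\<^bsub>?F\<^esub> ?B b c"
    by (simp add: boxar_cmp J K)
  also have "\<dots> = pb_cmp A (prdar C f g) (prdar C f' g') ?X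
      \<Zsemi>\<^bsub>?F\<^esub> pb_ar A (prdar C f g) (box_pb A f' g' I' J')
      \<Zsemi>\<^bsub>?F\<^esub> (box_pb A f g (pb_ob A f' I') (pb_ob A g' J') \<Zsemi>\<^bsub>?F\<^esub> ?B (pb_ar A f b') (pb_ar A g c'))
      \<Zsemi>\<^bsub>?F\<^esub> ?B b c"
    \<comment> \<open>\<open>refl\<close> instantiates the fibre \<open>F\<close>, which the axiom
      introduces through an equational premise.\<close>
    by (subst box_pb_cmp[symmetric, OF _ _ _ _ _ _ _ _ refl]) (simp_all add: J K)
  also have "\<dots> = pb_cmp A (prdar C f g) (prdar C f' g') ?X
      \<Zsemi>\<^bsub>?F\<^esub> pb_ar A (prdar C f g) (box_pb A f' g' I' J')
      \<Zsemi>\<^bsub>?F\<^esub> (pb_ar A (prdar C f g) (boxar A (tgt C f) (tgt C g) b' c') \<Zsemi>\<^bsub>?F\<^esub> box_pb A f g J K)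
      \<Zsemi>\<^bsub>?F\<^esub> ?B b c"
    by (subst box_pb_natural) (simp_all add: J K)
  finally show ?thesis
    by (simp add: k(1) l(1) k'(1) l'(1) J K prdar_cmp)
qed

lemma lens_assoc_ars [simp]:
  assumes "X \<in> lens_obs C A" "Y \<in> lens_obs C A" "Z \<in> lens_obs C A"
  shows "lens_assoc C A X Y Z \<in> lens_ars C A"
    and "lens_src (lens_assoc C A X Y Z) = lens_ten C A (lens_ten C A X Y) Z"
    and "lens_tgt (lens_assoc C A X Y Z) = lens_ten C A X (lens_ten C A Y Z)"
  using assms by (auto simp: lens_obs_def lens_assoc_def intro!: lens_arsI)

text \<open>Two kinds of naturality combine: that of the associator in the base maps is
  \<open>box_assoc_modification\<close>, and that in the backward maps, which live in the fibres, is
  \<open>box_assoc_natural\<close>.\<close>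

lemma lens_assoc_natural:
  assumes "k \<in> lens_ars C A" "l \<in> lens_ars C A" "m \<in> lens_ars C A"
  shows "lens_cmp C A (lens_tenar C A (lens_tenar C A k l) m)
      (lens_assoc C A (lens_tgt k) (lens_tgt l) (lens_tgt m))
    = lens_cmp C A (lens_assoc C A (lens_src k) (lens_src l) (lens_src m))
      (lens_tenar C A k (lens_tenar C A l m))"
proof -
  obtain a f I where
    k: "k = Lens (tgt (fib A (src C f)) a, src C f) (I, tgt C f) a f"
    "f \<in> ars C" "a \<in> ars (fib A (src C f))" "I \<in> obs (fib A (tgt C f))"
    "src (fib A (src C f)) a = pb_ob A f I"
    using assms(1) by (rule lens_arsE)
  obtain b g J where
    l: "l = Lens (tgt (fib A (src C g)) b, src C g) (J, tgt C g) b g"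
    "g \<in> ars C" "b \<in> ars (fib A (src C g))" "J \<in> obs (fib A (tgt C g))"
    "src (fib A (src C g)) b = pb_ob A g J"
    using assms(2) by (rule lens_arsE)
  obtain c h K where
    m: "m = Lens (tgt (fib A (src C h)) c, src C h) (K, tgt C h) c h"
    "h \<in> ars C" "c \<in> ars (fib A (src C h))" "K \<in> obs (fib A (tgt C h))"
    "src (fib A (src C h)) c = pb_ob A h K"
    using assms(3) by (rule lens_arsE)
  note [simp] = k(2-) l(2-) m(2-)
  let ?x = "src C f" and ?y = "src C g" and ?z = "src C h"
  let ?x' = "tgt C f" and ?y' = "tgt C g" and ?z' = "tgt C h"
  let ?F = "fib A (prd C (prd C ?x ?y) ?z)" and ?p = "prdar C (prdar C f g) h"
  let ?B = "boxar A (prd C ?x ?y) ?z"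
  let ?X = "box A ?x' (prd C ?y' ?z') I (box A ?y' ?z' J K)"
  \<comment> \<open>\<open>?P\<close> and, below, \<open>?R\<close> are the two sides of
    \<open>box_assoc_modification\<close> without their last factors.\<close>
  let ?P = "pb_cmp A ?p (prd_assoc C ?x' ?y' ?z') ?X \<Zsemi>\<^bsub>?F\<^esub> pb_ar A ?p (box_assoc A ?x' ?y' ?z' I J K)
      \<Zsemi>\<^bsub>?F\<^esub> box_pb A (prdar C f g) h (box A ?x' ?y' I J) K"
  let ?a = "prd_assoc C ?x ?y ?z"
  let ?G = "fib A (prd C ?x (prd C ?y ?z))"
  let ?R = "pb_cmp A ?a (prdar C f (prdar C g h)) ?X
      \<Zsemi>\<^bsub>?F\<^esub> pb_ar A ?a (box_pb A f (prdar C g h) I (box A ?y' ?z' J K)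
          \<Zsemi>\<^bsub>?G\<^esub> boxar A ?x (prd C ?y ?z) (ident (fib A ?x) (pb_ob A f I)) (box_pb A g h J K))"
  \<comment> \<open>Writing \<open>c\<close> as an identity followed by \<open>c\<close> lets
    \<open>boxar_cmp\<close> split off the factor with an identity in the second slot, as the
    modification axiom requires.\<close>
  have "?P \<Zsemi>\<^bsub>?F\<^esub> ?B (box_pb A f g I J \<Zsemi>\<^bsub>fib A (prd C ?x ?y)\<^esub> boxar A ?x ?y a b) c
    = ?P \<Zsemi>\<^bsub>?F\<^esub> ?B (box_pb A f g I J \<Zsemi>\<^bsub>fib A (prd C ?x ?y)\<^esub> boxar A ?x ?y a b)
        (ident (fib A ?z) (pb_ob A h K) \<Zsemi>\<^bsub>fib A ?z\<^esub> c)"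
    by simp
  also have "\<dots> = (?P \<Zsemi>\<^bsub>?F\<^esub> ?B (box_pb A f g I J) (ident (fib A ?z) (pb_ob A h K)))
      \<Zsemi>\<^bsub>?F\<^esub> ?B (boxar A ?x ?y a b) c"
    by (subst boxar_cmp) simp_all
  also have "\<dots> = ?R \<Zsemi>\<^bsub>?F\<^esub> (box_assoc A ?x ?y ?z (pb_ob A f I) (pb_ob A g J) (pb_ob A h K)
      \<Zsemi>\<^bsub>?F\<^esub> ?B (boxar A ?x ?y a b) c)"
    by (subst box_assoc_modification[OF _ _ _ _ _ _ refl refl]) simp_all
  also have "box_assoc A ?x ?y ?z (pb_ob A f I) (pb_ob A g J) (pb_ob A h K) \<Zsemi>\<^bsub>?F\<^esub> ?B (boxar A ?x ?y a b) c
      = pb_ar A ?a (boxar A ?x (prd C ?y ?z) a (boxar A ?y ?z b c))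
      \<Zsemi>\<^bsub>?F\<^esub> box_assoc A ?x ?y ?z (tgt (fib A ?x) a) (tgt (fib A ?y) b) (tgt (fib A ?z) c)"
    by (subst box_assoc_natural[OF _ _ _ _ _ _ refl]) simp_all
  finally have *: "?P \<Zsemi>\<^bsub>?F\<^esub> ?B (box_pb A f g I J \<Zsemi>\<^bsub>fib A (prd C ?x ?y)\<^esub> boxar A ?x ?y a b) c
    = ?R \<Zsemi>\<^bsub>?F\<^esub> (pb_ar A ?a (boxar A ?x (prd C ?y ?z) a (boxar A ?y ?z b c))
      \<Zsemi>\<^bsub>?F\<^esub> box_assoc A ?x ?y ?z (tgt (fib A ?x) a) (tgt (fib A ?y) b) (tgt (fib A ?z) c))" .
  \<comment> \<open>The same splitting for the other lens, now with an identity in front of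
    \<open>a\<close>, so that its coherence part becomes the one inside \<open>?R\<close>.\<close>
  have **: "boxar A ?x (prd C ?y ?z) a (box_pb A g h J K \<Zsemi>\<^bsub>fib A (prd C ?y ?z)\<^esub> boxar A ?y ?z b c)
    = boxar A ?x (prd C ?y ?z) (ident (fib A ?x) (pb_ob A f I)) (box_pb A g h J K)
      \<Zsemi>\<^bsub>?G\<^esub> boxar A ?x (prd C ?y ?z) a (boxar A ?y ?z b c)"
    by (subst boxar_cmp[symmetric]) simp_all
  show ?thesis
    using * by (simp add: k(1) l(1) m(1) lens_assoc_def prd_assoc_natural **)
qed

lemma lens_lunit_ars [simp]:
  assumes "X \<in> lens_obs C A"
  shows "lens_lunit C A X \<in> lens_ars C A"
    and "lens_src (lens_lunit C A X) = lens_ten C A (lens_munit C A) X"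
    and "lens_tgt (lens_lunit C A X) = X"
  using assms by (auto simp: lens_obs_def lens_lunit_def lens_munit_def intro!: lens_arsI)

lemma lens_runit_ars [simp]:
  assumes "X \<in> lens_obs C A"
  shows "lens_runit C A X \<in> lens_ars C A"
    and "lens_src (lens_runit C A X) = lens_ten C A X (lens_munit C A)"
    and "lens_tgt (lens_runit C A X) = X"
  using assms by (auto simp: lens_obs_def lens_runit_def lens_munit_def intro!: lens_arsI)

text \<open>The identity lens on the monoidal unit has backward map \<open>pb_id\<close>, which is
  the last ingredient of \<open>box_lunit_modification\<close>; that axiom treats the base map, and
  \<open>box_lunit_natural\<close> the backward map.\<close>

lemma lens_lunit_natural:
  assumes "k \<in> lens_ars C A"
  shows "lens_cmp C A (lens_tenar C A (lens_ident C A (lens_munit C A)) k) (lens_lunit C A (lens_tgt k))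
    = lens_cmp C A (lens_lunit C A (lens_src k)) k"
proof -
  obtain b f I where
    k: "k = Lens (tgt (fib A (src C f)) b, src C f) (I, tgt C f) b f"
    "f \<in> ars C" "b \<in> ars (fib A (src C f))" "I \<in> obs (fib A (tgt C f))"
    "src (fib A (src C f)) b = pb_ob A f I"
    using assms by (rule lens_arsE)
  note [simp] = k(2-)
  let ?x = "src C f" and ?x' = "tgt C f" and ?e = "one C" and ?U = "box_unit A"
  let ?F = "fib A (prd C ?e ?x)" and ?B = "boxar A ?e ?x" and ?p = "prdar C (ident C ?e) f"
  let ?P = "pb_cmp A ?p (prd_lunit C ?x') I \<Zsemi>\<^bsub>?F\<^esub> pb_ar A ?p (box_lunit A ?x' I)
    \<Zsemi>\<^bsub>?F\<^esub> box_pb A (ident C ?e) f ?U I"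
  \<comment> \<open>Padding both slots with identities separates the coherence part, ending in
    \<open>pb_id\<close>, from the backward map \<open>b\<close>.\<close>
  have "?P \<Zsemi>\<^bsub>?F\<^esub> ?B (pb_id A ?e ?U) b
      = ?P \<Zsemi>\<^bsub>?F\<^esub> ?B (pb_id A ?e ?U \<Zsemi>\<^bsub>fib A ?e\<^esub> ident (fib A ?e) ?U) (ident (fib A ?x) (pb_ob A f I) \<Zsemi>\<^bsub>fib A ?x\<^esub> b)"
    by simp
  also have "\<dots> = (?P \<Zsemi>\<^bsub>?F\<^esub> ?B (pb_id A ?e ?U) (ident (fib A ?x) (pb_ob A f I))) \<Zsemi>\<^bsub>?F\<^esub> ?B (ident (fib A ?e) ?U) b"
    by (subst boxar_cmp) simp_all
  also have "\<dots> = pb_cmp A (prd_lunit C ?x) f I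
      \<Zsemi>\<^bsub>?F\<^esub> (box_lunit A ?x (pb_ob A f I) \<Zsemi>\<^bsub>?F\<^esub> ?B (ident (fib A ?e) ?U) b)"
    by (subst box_lunit_modification[symmetric, OF _ _ refl]) simp_all
  also have "\<dots> = pb_cmp A (prd_lunit C ?x) f I
      \<Zsemi>\<^bsub>?F\<^esub> (pb_ar A (prd_lunit C ?x) b \<Zsemi>\<^bsub>?F\<^esub> box_lunit A ?x (tgt (fib A ?x) b))"
    by (subst box_lunit_natural[OF _ _ refl]) simp_all
  finally show ?thesis
    by (simp add: k(1) lens_lunit_def lens_munit_def lens_ident_def prd_lunit_natural)
qed

text \<open>The mirror image of the argument for \<open>lens_lunit_natural\<close>, with the two
  slots of the box exchanged.\<close>

lemma lens_runit_natural:
  assumes "k \<in> lens_ars C A"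
  shows "lens_cmp C A (lens_tenar C A k (lens_ident C A (lens_munit C A))) (lens_runit C A (lens_tgt k))
    = lens_cmp C A (lens_runit C A (lens_src k)) k"
proof -
  obtain b f I where
    k: "k = Lens (tgt (fib A (src C f)) b, src C f) (I, tgt C f) b f"
    "f \<in> ars C" "b \<in> ars (fib A (src C f))" "I \<in> obs (fib A (tgt C f))"
    "src (fib A (src C f)) b = pb_ob A f I"
    using assms by (rule lens_arsE)
  note [simp] = k(2-)
  let ?x = "src C f" and ?x' = "tgt C f" and ?e = "one C" and ?U = "box_unit A"
  let ?F = "fib A (prd C ?x ?e)" and ?B = "boxar A ?x ?e" and ?p = "prdar C f (ident C ?e)"
  let ?P = "pb_cmp A ?p (prd_runit C ?x') I \<Zsemi>\<^bsub>?F\<^esub> pb_ar A ?p (box_runit A ?x' I)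
    \<Zsemi>\<^bsub>?F\<^esub> box_pb A f (ident C ?e) I ?U"
  have "?P \<Zsemi>\<^bsub>?F\<^esub> ?B b (pb_id A ?e ?U)
      = ?P \<Zsemi>\<^bsub>?F\<^esub> ?B (ident (fib A ?x) (pb_ob A f I) \<Zsemi>\<^bsub>fib A ?x\<^esub> b) (pb_id A ?e ?U \<Zsemi>\<^bsub>fib A ?e\<^esub> ident (fib A ?e) ?U)"
    by simp
  also have "\<dots> = (?P \<Zsemi>\<^bsub>?F\<^esub> ?B (ident (fib A ?x) (pb_ob A f I)) (pb_id A ?e ?U)) \<Zsemi>\<^bsub>?F\<^esub> ?B b (ident (fib A ?e) ?U)"
    by (subst boxar_cmp) simp_all
  also have "\<dots> = pb_cmp A (prd_runit C ?x) f I
      \<Zsemi>\<^bsub>?F\<^esub> (box_runit A ?x (pb_ob A f I) \<Zsemi>\<^bsub>?F\<^esub> ?B b (ident (fib A ?e) ?U))"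
    by (subst box_runit_modification[symmetric, OF _ _ refl]) simp_all
  also have "\<dots> = pb_cmp A (prd_runit C ?x) f I
      \<Zsemi>\<^bsub>?F\<^esub> (pb_ar A (prd_runit C ?x) b \<Zsemi>\<^bsub>?F\<^esub> box_runit A ?x (tgt (fib A ?x) b))"
    by (subst box_runit_natural[OF _ _ refl]) simp_all
  finally show ?thesis
    by (simp add: k(1) lens_runit_def lens_munit_def lens_ident_def prd_runit_natural)
qed

end


section \<open>Pullbacks and spans\<close>

context category
begin

lemma is_pullbackD:
  assumes "is_pullback C h k p i"
  shows "h \<in> ars C" "k \<in> ars C" "p \<in> ars C" "i \<in> ars C" "src C k = src C h" "tgt C h = src C p"
    "tgt C k = src C i" "tgt C p = tgt C i" "h \<Zsemi> p = k \<Zsemi> i"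
  using assms by (simp_all add: is_pullback_def)

lemma pullback_lift:
  assumes "is_pullback C h k p i" "h' \<in> ars C" "k' \<in> ars C" "src C h' = src C k'" "tgt C h' = src C p"
    "tgt C k' = src C i" "h' \<Zsemi> p = k' \<Zsemi> i"
  obtains t where "t \<in> ars C" "src C t = src C k'" "tgt C t = src C h" "t \<Zsemi> h = h'" "t \<Zsemi> k = k'"
  using assms unfolding is_pullback_def mem_homs by metis

text \<open>Both maps mediate the one cone with legs \<open>t \<Zsemi> h\<close> and
  \<open>t \<Zsemi> k\<close>, so uniqueness in the universal property identifies them.\<close>

lemma pullback_eqI:
  assumes P: "is_pullback C h k p i"
    and t: "t \<in> ars C" "t' \<in> ars C" "src C t = src C t'" "tgt C t = src C h" "tgt C t' = src C h"
    and eq: "t \<Zsemi> h = t' \<Zsemi> h" "t \<Zsemi> k = t' \<Zsemi> k"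
  shows "t = t'"
proof -
  note d = is_pullbackD[OF P]
  have "\<exists>!s. s \<in> homs C (src C (t \<Zsemi> h)) (src C h) \<and> s \<Zsemi> h = t \<Zsemi> h \<and> s \<Zsemi> k = t \<Zsemi> k"
  proof -
    have "(t \<Zsemi> h) \<Zsemi> p = (t \<Zsemi> k) \<Zsemi> i"
      using d t by simp
    moreover have "t \<Zsemi> h \<in> ars C" "t \<Zsemi> k \<in> ars C" "src C (t \<Zsemi> h) = src C (t \<Zsemi> k)"
      "tgt C (t \<Zsemi> h) = src C p" "tgt C (t \<Zsemi> k) = src C i"
      using d t by simp_all
    ultimately show ?thesis
      using P unfolding is_pullback_def by blast
  qed
  moreover have "t \<in> homs C (src C (t \<Zsemi> h)) (src C h)" "t' \<in> homs C (src C (t \<Zsemi> h)) (src C h)"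
    using t d by simp_all
  ultimately show ?thesis
    using eq by metis
qed

text \<open>Unique existence is split into lifting and joint monicity of the projections. Among the
  resulting goals, 9 is commutativity of the square, 10 the lifting and 11 the uniqueness; the
  numbered cases in later proofs refer to these.\<close>

lemma is_pullbackI:
  assumes "h \<in> ars C" "k \<in> ars C" "p \<in> ars C" "i \<in> ars C" "src C k = src C h" "tgt C h = src C p"
    "tgt C k = src C i" "tgt C p = tgt C i" "h \<Zsemi> p = k \<Zsemi> i"
    and lift: "\<And>h' k'. \<lbrakk>h' \<in> ars C; k' \<in> ars C; src C h' = src C k'; tgt C h' = src C p;
        tgt C k' = src C i; h' \<Zsemi> p = k' \<Zsemi> i\<rbrakk>
      \<Longrightarrow> \<exists>t. t \<in> ars C \<and> src C t = src C k' \<and> tgt C t = src C h \<and> t \<Zsemi> h = h' \<and> t \<Zsemi> k = k'"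
    and eq: "\<And>t t'. \<lbrakk>t \<in> ars C; t' \<in> ars C; src C t = src C t'; tgt C t = src C h; tgt C t' = src C h;
        t \<Zsemi> h = t' \<Zsemi> h; t \<Zsemi> k = t' \<Zsemi> k\<rbrakk> \<Longrightarrow> t = t'"
  shows "is_pullback C h k p i"
  unfolding is_pullback_def
proof (intro conjI allI impI, goal_cases)
  case (10 h' k')
  then obtain t where "t \<in> ars C" "src C t = src C k'" "tgt C t = src C h" "t \<Zsemi> h = h'" "t \<Zsemi> k = k'"
    using lift[of h' k'] by blast
  then show ?case
    using 10 by (intro ex1I[of _ t]) (auto intro!: eq)
qed (use assms in simp_all)

lemma is_pullback_sym:
  assumes P: "is_pullback C h k p i"
  shows "is_pullback C k h i p"
proof (rule is_pullbackI, goal_cases)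
  case (10 h' k')
  then show ?case
    using pullback_lift[OF P, of k' h'] is_pullbackD[OF P] by metis
next
  case (11 t t')
  then show ?case
    using is_pullbackD[OF P] by (rule_tac pullback_eqI[OF P]) simp_all
qed (use is_pullbackD[OF P] in simp_all)

lemma is_pullback_ident:
  assumes "p \<in> ars C"
  shows "is_pullback C (ident C (src C p)) p p (ident C (tgt C p))"
proof (rule is_pullbackI, goal_cases)
  case (10 h' k')
  then show ?case
    using assms by (intro exI[of _ h']) simp
next
  case (11 t t')
  then show ?case
    using assms by simp
qed (use assms in simp_all)

text \<open>A cone \<open>h'\<close>, \<open>k'\<close> over the composite cospan first lifts
  through \<open>P\<close>, with \<open>k' \<Zsemi> u\<close> as second leg; this lift together with
  \<open>k'\<close> is then a cone for \<open>R\<close>. Uniqueness runs the same way: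
  \<open>P\<close> fixes the composite with \<open>t\<close>, then \<open>R\<close> fixes the
  map.\<close>

lemma is_pullback_paste:
  assumes P: "is_pullback C h k p i" and R: "is_pullback C t s k u"
  shows "is_pullback C (t \<Zsemi> h) s p (u \<Zsemi> i)"
proof -
  note P' = is_pullbackD[OF P] and R' = is_pullbackD[OF R]
  show ?thesis
  proof (rule is_pullbackI, goal_cases)
    case 9
    show ?case
      using P' R' cmp_reassoc[OF R'(9), of i] by simp
  next
    case (10 h' k')
    then obtain v where v: "v \<in> ars C" "src C v = src C k'" "tgt C v = src C h" "v \<Zsemi> h = h'" "v \<Zsemi> k = k' \<Zsemi> u"
      using pullback_lift[OF P, of h' "k' \<Zsemi> u"] P' R' by auto
    then obtain w where "w \<in> ars C" "src C w = src C k'" "tgt C w = src C t" "w \<Zsemi> t = v" "w \<Zsemi> s = k'"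
      using pullback_lift[OF R, of v k'] 10 P' R' by auto
    then show ?case
      using v P' R' by (intro exI[of _ w]) (auto simp flip: cmp_assoc)
  next
    case (11 w w')
    have "w \<Zsemi> t = w' \<Zsemi> t"
    proof (rule pullback_eqI[OF P])
      show "(w \<Zsemi> t) \<Zsemi> k = (w' \<Zsemi> t) \<Zsemi> k"
        using 11 P' R' cmp_reassoc[OF 11(7), of u] by simp
    qed (use 11 P' R' in simp_all)
    then show ?case
      by - (rule pullback_eqI[OF R], use 11 P' R' in simp_all)
  qed (use P' R' in simp_all)
qed

lemma pullback_map:
  assumes P: "is_pullback C h k p i" and P': "is_pullback C h' k' p' i'"
    and t: "t \<in> ars C" "src C t = src C p" "tgt C t = src C p'" "t \<Zsemi> p' = p"
    and s: "s \<in> ars C" "src C s = src C i" "tgt C s = src C i'" "s \<Zsemi> i' = i"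
  obtains w where "w \<in> ars C" "src C w = src C h" "tgt C w = src C h'"
    "w \<Zsemi> h' = h \<Zsemi> t" "w \<Zsemi> k' = k \<Zsemi> s"
proof (rule pullback_lift[OF P', of "h \<Zsemi> t" "k \<Zsemi> s"])
qed (use is_pullbackD[OF P] is_pullbackD[OF P'] t s in simp_all)

text \<open>The source of independence from the choice of a pullback. The maps induced by
  \<open>t\<close>, \<open>s\<close> and by their inverses compose to endomorphisms that commute
  with both projections, hence to identities.\<close>

lemma pullback_iso:
  assumes P: "is_pullback C h k p i" and P': "is_pullback C h' k' p' i'"
    and t: "t \<in> isos C" "src C t = src C p" "tgt C t = src C p'" "t \<Zsemi> p' = p"
    and s: "s \<in> isos C" "src C s = src C i" "tgt C s = src C i'" "s \<Zsemi> i' = i"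
  obtains w where "w \<in> isos C" "w \<in> ars C" "src C w = src C h" "tgt C w = src C h'"
    "w \<Zsemi> h' = h \<Zsemi> t" "w \<Zsemi> k' = k \<Zsemi> s"
proof -
  note d = is_pullbackD[OF P] and d' = is_pullbackD[OF P']
  obtain t' where t': "t' \<in> ars C" "src C t' = tgt C t" "tgt C t' = src C t"
    "t \<Zsemi> t' = ident C (src C t)" "t' \<Zsemi> t = ident C (tgt C t)" "t \<in> ars C"
    using isosE[OF t(1)] by metis
  obtain s' where s': "s' \<in> ars C" "src C s' = tgt C s" "tgt C s' = src C s"
    "s \<Zsemi> s' = ident C (src C s)" "s' \<Zsemi> s = ident C (tgt C s)" "s \<in> ars C"
    using isosE[OF s(1)] by metis
  have "t' \<Zsemi> (t \<Zsemi> p') = p'" "s' \<Zsemi> (s \<Zsemi> i') = i'"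
    using t(1-3) t' s(1-3) s' d(1-8) d'(1-8) by (simp_all flip: cmp_assoc)
  then have p: "t' \<Zsemi> p = p'" "s' \<Zsemi> i = i'"
    by (simp_all add: t(4) s(4))
  obtain w where w: "w \<in> ars C" "src C w = src C h" "tgt C w = src C h'"
    "w \<Zsemi> h' = h \<Zsemi> t" "w \<Zsemi> k' = k \<Zsemi> s"
    using t s t' s' by (rule_tac pullback_map[OF P P', of t s]) auto
  obtain v where v: "v \<in> ars C" "src C v = src C h'" "tgt C v = src C h"
    "v \<Zsemi> h = h' \<Zsemi> t'" "v \<Zsemi> k = k' \<Zsemi> s'"
    using t s t' s' p by (rule_tac pullback_map[OF P' P, of t' s']) auto
  have hk: "w \<Zsemi> (h' \<Zsemi> t') = h" "w \<Zsemi> (k' \<Zsemi> s') = k" "v \<Zsemi> (h \<Zsemi> t) = h'" "v \<Zsemi> (k \<Zsemi> s) = k'"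
    using w v d d' t t' s s'
    by (simp_all add: cmp_reassoc[OF w(4)] cmp_reassoc[OF w(5)] cmp_reassoc[OF v(4)] cmp_reassoc[OF v(5)])
  have "w \<Zsemi> v = ident C (src C w)"
    by (rule pullback_eqI[OF P]) (use w v d d' hk in simp_all)
  moreover have "v \<Zsemi> w = ident C (tgt C w)"
    by (rule pullback_eqI[OF P']) (use w v d d' hk in simp_all)
  ultimately have "w \<in> isos C"
    using w v by (intro isosI[where s = v]) simp_all
  with w show thesis
    by (intro that)
qed

section \<open>Isomorphism classes of spans and their composition\<close>

definition spans :: "('a \<times> 'a) set" where
  "spans = {(i, i'). i \<in> ars C \<and> i' \<in> ars C \<and> src C i' = src C i}"

lemma span_iso_iff:
  "((i, i'), (j, j')) \<in> span_iso C \<longleftrightarrow> (i, i') \<in> spans \<and> (j, j') \<in> spans \<and>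
     (\<exists>t \<in> isos C. t \<in> ars C \<and> src C t = src C i \<and> tgt C t = src C j \<and> t \<Zsemi> j = i \<and> t \<Zsemi> j' = i')"
  unfolding span_iso_def spans_def mem_homs mem_Collect_eq case_prod_conv
  by (simp only: conj_assoc eq_commute[of "src C i" "src C i'"] eq_commute[of "src C j" "src C j'"])

text \<open>The first span is presented as \<open>t\<close> followed by the second, so that the
  equations for the legs disappear by substitution.\<close>

lemma span_isoE:
  assumes "(x, y) \<in> span_iso C"
  obtains t j j' where "x = (t \<Zsemi> j, t \<Zsemi> j')" "y = (j, j')" "t \<in> isos C" "t \<in> ars C" "tgt C t = src C j"
    "j \<in> ars C" "j' \<in> ars C" "src C j' = src C j"
proof -
  obtain i i' j j' where xy: "x = (i, i')" "y = (j, j')"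
    by (cases x; cases y) blast
  obtain t where "t \<in> isos C" "t \<in> ars C" "tgt C t = src C j" "t \<Zsemi> j = i" "t \<Zsemi> j' = i'"
    and "(j, j') \<in> spans"
    using assms unfolding xy span_iso_iff by blast
  then show thesis
    using that[of t j j'] xy by (simp add: spans_def)
qed

lemma span_isoI:
  "\<lbrakk>t \<in> isos C; t \<in> ars C; j \<in> ars C; j' \<in> ars C; src C j' = src C j; tgt C t = src C j;
    t \<Zsemi> j = i; t \<Zsemi> j' = i'\<rbrakk> \<Longrightarrow> ((i, i'), (j, j')) \<in> span_iso C"
  unfolding span_iso_iff spans_def by (auto intro!: bexI[of _ t])

lemma equiv_span_iso: "equiv spans (span_iso C)"
proof (rule equivI)
  show "span_iso C \<subseteq> spans \<times> spans"
    by (auto elim!: span_isoE simp: spans_def)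
  show "refl_on spans (span_iso C)"
  proof (rule refl_onI, clarify)
    fix i i'
    assume "(i, i') \<in> spans"
    then show "((i, i'), (i, i')) \<in> span_iso C"
      by (intro span_isoI[of "ident C (src C i)"]) (auto simp: spans_def)
  qed
  show "sym (span_iso C)"
  proof (rule symI)
    fix x y
    assume "(x, y) \<in> span_iso C"
    then obtain t j j' where t: "x = (t \<Zsemi> j, t \<Zsemi> j')" "y = (j, j')" "t \<in> isos C" "t \<in> ars C"
      "tgt C t = src C j" "j \<in> ars C" "j' \<in> ars C" "src C j' = src C j"
      by (rule span_isoE)
    obtain s where s: "s \<in> isos C" "s \<in> ars C" "src C s = tgt C t" "tgt C s = src C t"
      "s \<Zsemi> t = ident C (tgt C t)"
      using isosE[OF t(3)] by metis
    show "(y, x) \<in> span_iso C"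
      unfolding t(1,2) by (rule span_isoI[OF s(1)]) (use t s in \<open>simp_all add: cmp_inverse_cancel[OF s(5)]\<close>)
  qed
  show "trans (span_iso C)"
  proof (rule transI)
    fix x y z
    assume xy: "(x, y) \<in> span_iso C" and yz: "(y, z) \<in> span_iso C"
    obtain t j j' where t: "x = (t \<Zsemi> j, t \<Zsemi> j')" "y = (j, j')" "t \<in> isos C" "t \<in> ars C" "tgt C t = src C j"
      using xy by (rule span_isoE)
    obtain s l l' where s: "y = (s \<Zsemi> l, s \<Zsemi> l')" "z = (l, l')" "s \<in> isos C" "s \<in> ars C"
      "tgt C s = src C l" "l \<in> ars C" "l' \<in> ars C" "src C l' = src C l"
      using yz by (rule span_isoE)
    have j: "j = s \<Zsemi> l" "j' = s \<Zsemi> l'"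
      using t(2) s(1) by simp_all
    then have *: "tgt C t = src C s"
      using t(5) s by simp
    show "(x, z) \<in> span_iso C"
      unfolding t(1) s(2) j by (rule span_isoI[OF cmp_isos[OF t(3) s(3) *]]) (use t(4) s * in simp_all)
  qed
qed

lemma span_arsE:
  assumes "X \<in> span_ars C"
  obtains i i' where "X = span_class C i i'" "i \<in> ars C" "i' \<in> ars C" "src C i' = src C i"
  using assms unfolding span_ars_def by auto

lemma span_iso_refl: "\<lbrakk>i \<in> ars C; i' \<in> ars C; src C i' = src C i\<rbrakk> \<Longrightarrow> ((i, i'), (i, i')) \<in> span_iso C"
  using equiv_span_iso unfolding equiv_def refl_on_def by (simp add: spans_def)

text \<open>Other representatives differ by isomorphisms \<open>t\<close> and \<open>s\<close> of
  apexes; \<open>pullback_iso\<close> turns these into an isomorphism \<open>w\<close> between the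
  two pullbacks, and \<open>w\<close> commutes with the outer legs.\<close>

lemma span_cmp_class:
  assumes i: "i \<in> ars C" "i' \<in> ars C" "src C i' = src C i"
    and j: "j \<in> ars C" "j' \<in> ars C" "src C j' = src C j"
    and P: "is_pullback C h k i' j"
  shows "span_cmp C (span_class C i i') (span_class C j j') = span_class C (h \<Zsemi> i) (k \<Zsemi> j')"
proof -
  note d = is_pullbackD[OF P]
  have eq: "span_iso C `` {(h1 \<Zsemi> u, k1 \<Zsemi> v')} = span_iso C `` {(h \<Zsemi> i, k \<Zsemi> j')}"
    if u: "((i, i'), (u, u')) \<in> span_iso C" and v: "((j, j'), (v, v')) \<in> span_iso C"
      and P1: "is_pullback C h1 k1 u' v" for h1 k1 u u' v v'
  proof -
    note d1 = is_pullbackD[OF P1]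
    obtain t where t: "t \<in> isos C" "t \<in> ars C" "src C t = src C i" "tgt C t = src C u"
      "t \<Zsemi> u = i" "t \<Zsemi> u' = i'" and u': "u \<in> ars C" "u' \<in> ars C" "src C u' = src C u"
      using u unfolding span_iso_iff spans_def by blast
    obtain s where s: "s \<in> isos C" "s \<in> ars C" "src C s = src C j" "tgt C s = src C v"
      "s \<Zsemi> v = j" "s \<Zsemi> v' = j'" and v': "v \<in> ars C" "v' \<in> ars C" "src C v' = src C v"
      using v unfolding span_iso_iff spans_def by blast
    obtain w where w: "w \<in> isos C" "w \<in> ars C" "src C w = src C h" "tgt C w = src C h1"
      "w \<Zsemi> h1 = h \<Zsemi> t" "w \<Zsemi> k1 = k \<Zsemi> s"
      by (rule pullback_iso[OF P P1, of t s]) (use t s u' v' i j d d1 in auto)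
    have "w \<Zsemi> (h1 \<Zsemi> u) = h \<Zsemi> i" "w \<Zsemi> (k1 \<Zsemi> v') = k \<Zsemi> j'"
      using w(1-4) t s u' v' i j d d1 by (simp_all add: cmp_reassoc[OF w(5)] cmp_reassoc[OF w(6)])
    then have "((h \<Zsemi> i, k \<Zsemi> j'), (h1 \<Zsemi> u, k1 \<Zsemi> v')) \<in> span_iso C"
      using w t s u' v' i j d d1 unfolding span_iso_iff by (auto simp: spans_def)
    from equiv_class_eq[OF equiv_span_iso this] show ?thesis ..
  qed
  have "\<Union>{span_iso C `` {(h \<Zsemi> u, k \<Zsemi> v')} | h k u u' v v'.
      (u, u') \<in> span_iso C `` {(i, i')} \<and> (v, v') \<in> span_iso C `` {(j, j')} \<and> is_pullback C h k u' v}
    = span_iso C `` {(h \<Zsemi> i, k \<Zsemi> j')}"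
    using span_iso_refl[OF i] span_iso_refl[OF j] P by (intro Union_eq) (blast, use eq in blast)
  then show ?thesis
    using i j d by (simp add: span_cmp_def span_class_def)
qed

end

section \<open>Products of pullback squares and of spans\<close>

context cartesian_category
begin

text \<open>Limits commute with products: the projections split a cone over the product cospan into
  one cone for each square, and the two lifts are paired. Uniqueness is likewise checked after each
  projection.\<close>

lemma is_pullback_prdar:
  assumes P: "is_pullback C h k p i" and P': "is_pullback C h' k' p' i'"
  shows "is_pullback C (prdar C h h') (prdar C k k') (prdar C p p') (prdar C i i')"
proof -
  note d = is_pullbackD[OF P] and d' = is_pullbackD[OF P']
  show ?thesis
  proof (rule is_pullbackI, goal_cases)
    case 9
    then show ?case
      using d d' by (simp flip: prdar_cmp)
  next
    case (10 m n)
    let ?h1 = "pr1 C (src C p) (src C p')" and ?h2 = "pr2 C (src C p) (src C p')"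
    let ?k1 = "pr1 C (src C i) (src C i')" and ?k2 = "pr2 C (src C i) (src C i')"
    \<comment> \<open>The cone equation \<open>10(6)\<close> is projected to the two
      factors.\<close>
    have "m \<Zsemi> prdar C p p' \<Zsemi> pr1 C (tgt C i) (tgt C i') = n \<Zsemi> prdar C i i' \<Zsemi> pr1 C (tgt C i) (tgt C i')"
      "m \<Zsemi> prdar C p p' \<Zsemi> pr2 C (tgt C i) (tgt C i') = n \<Zsemi> prdar C i i' \<Zsemi> pr2 C (tgt C i) (tgt C i')"
      using 10(6) by simp_all
    then have *: "m \<Zsemi> ?h1 \<Zsemi> p = n \<Zsemi> ?k1 \<Zsemi> i" "m \<Zsemi> ?h2 \<Zsemi> p' = n \<Zsemi> ?k2 \<Zsemi> i'"
      using 10(1-5) d d' by simp_all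
    obtain t where t: "t \<in> ars C" "src C t = src C n" "tgt C t = src C h" "t \<Zsemi> h = m \<Zsemi> ?h1" "t \<Zsemi> k = n \<Zsemi> ?k1"
      using pullback_lift[OF P, of "m \<Zsemi> ?h1" "n \<Zsemi> ?k1"] *(1) 10(1-5) d d' by auto
    obtain s where s: "s \<in> ars C" "src C s = src C n" "tgt C s = src C h'" "s \<Zsemi> h' = m \<Zsemi> ?h2" "s \<Zsemi> k' = n \<Zsemi> ?k2"
      using pullback_lift[OF P', of "m \<Zsemi> ?h2" "n \<Zsemi> ?k2"] *(2) 10(1-5) d d' by auto
    have "pairing C t s \<Zsemi> prdar C h h' = m"
      by (rule prd_eqI[where x = "src C p" and y = "src C p'"]) (use t s 10(1-5) d d' in simp_all)
    moreover have "pairing C t s \<Zsemi> prdar C k k' = n"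
      by (rule prd_eqI[where x = "src C i" and y = "src C i'"]) (use t s 10(1-5) d d' in simp_all)
    ultimately show ?case
      using t s d d' by (intro exI[of _ "pairing C t s"]) simp
  next
    case (11 t s)
    let ?q1 = "pr1 C (src C h) (src C h')" and ?q2 = "pr2 C (src C h) (src C h')"
    have "t \<Zsemi> prdar C h h' \<Zsemi> pr1 C (src C p) (src C p') = s \<Zsemi> prdar C h h' \<Zsemi> pr1 C (src C p) (src C p')"
      "t \<Zsemi> prdar C h h' \<Zsemi> pr2 C (src C p) (src C p') = s \<Zsemi> prdar C h h' \<Zsemi> pr2 C (src C p) (src C p')"
      "t \<Zsemi> prdar C k k' \<Zsemi> pr1 C (src C i) (src C i') = s \<Zsemi> prdar C k k' \<Zsemi> pr1 C (src C i) (src C i')"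
      "t \<Zsemi> prdar C k k' \<Zsemi> pr2 C (src C i) (src C i') = s \<Zsemi> prdar C k k' \<Zsemi> pr2 C (src C i) (src C i')"
      using 11(6,7) by simp_all
    then have *: "(t \<Zsemi> ?q1) \<Zsemi> h = (s \<Zsemi> ?q1) \<Zsemi> h" "(t \<Zsemi> ?q2) \<Zsemi> h' = (s \<Zsemi> ?q2) \<Zsemi> h'"
      "(t \<Zsemi> ?q1) \<Zsemi> k = (s \<Zsemi> ?q1) \<Zsemi> k" "(t \<Zsemi> ?q2) \<Zsemi> k' = (s \<Zsemi> ?q2) \<Zsemi> k'"
      using 11(1-5) d d' by simp_all
    have "t \<Zsemi> ?q1 = s \<Zsemi> ?q1"
      by (rule pullback_eqI[OF P _ _ _ _ _ *(1,3)]) (use 11(1-5) d d' in simp_all)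
    moreover have "t \<Zsemi> ?q2 = s \<Zsemi> ?q2"
      by (rule pullback_eqI[OF P' _ _ _ _ _ *(2,4)]) (use 11(1-5) d d' in simp_all)
    ultimately show ?case
      by - (rule prd_eqI[where x = "src C h" and y = "src C h'"], use 11(1-5) d d' in simp_all)
  qed (use d d' in simp_all)
qed

text \<open>Isomorphisms between representatives in the two factors multiply to an isomorphism of
  the product spans, by \<open>prdar_isos\<close> and \<open>prdar_cmp\<close>.\<close>

lemma span_tenar_class:
  assumes i: "i \<in> ars C" "i' \<in> ars C" "src C i' = src C i"
    and j: "j \<in> ars C" "j' \<in> ars C" "src C j' = src C j"
  shows "span_tenar C (span_class C i i') (span_class C j j') = span_class C (prdar C i j) (prdar C i' j')"
proof -
  let ?c = "span_iso C `` {(prdar C i j, prdar C i' j')}"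
  have eq: "span_iso C `` {(prdar C u v, prdar C u' v')} = ?c"
    if u: "((i, i'), (u, u')) \<in> span_iso C" and v: "((j, j'), (v, v')) \<in> span_iso C" for u u' v v'
  proof -
    obtain t where t: "t \<in> isos C" "t \<in> ars C" "src C t = src C i" "tgt C t = src C u"
      "t \<Zsemi> u = i" "t \<Zsemi> u' = i'" and u': "u \<in> ars C" "u' \<in> ars C" "src C u' = src C u"
      using u unfolding span_iso_iff spans_def by blast
    obtain s where s: "s \<in> isos C" "s \<in> ars C" "src C s = src C j" "tgt C s = src C v"
      "s \<Zsemi> v = j" "s \<Zsemi> v' = j'" and v': "v \<in> ars C" "v' \<in> ars C" "src C v' = src C v"
      using v unfolding span_iso_iff spans_def by blast
    have "((prdar C i j, prdar C i' j'), (prdar C u v, prdar C u' v')) \<in> span_iso C"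
      unfolding span_iso_iff
      by (intro conjI bexI[OF _ prdar_isos[OF t(1) s(1)]])
        (use t s u' v' i j in \<open>simp_all add: spans_def flip: prdar_cmp\<close>)
    from equiv_class_eq[OF equiv_span_iso this] show ?thesis ..
  qed
  have "\<Union>{span_iso C `` {(prdar C u v, prdar C u' v')} | u u' v v'.
      (u, u') \<in> span_iso C `` {(i, i')} \<and> (v, v') \<in> span_iso C `` {(j, j')}} = ?c"
    using span_iso_refl[OF i] span_iso_refl[OF j] by (intro Union_eq) (blast, use eq in blast)
  then show ?thesis
    using i j by (simp add: span_tenar_def span_class_def)
qed

end


section \<open>The functor RSM\<close>

lemma lens_moncat_sel [simp]:
  "obs (lens_moncat C A) = lens_obs C A" "ars (lens_moncat C A) = lens_ars C A"
  "src (lens_moncat C A) = lens_src" "tgt (lens_moncat C A) = lens_tgt"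
  "ident (lens_moncat C A) = lens_ident C A" "cmp (lens_moncat C A) = lens_cmp C A"
  "ten (lens_moncat C A) = lens_ten C A" "tenar (lens_moncat C A) = lens_tenar C A"
  "munit (lens_moncat C A) = lens_munit C A" "assoc (lens_moncat C A) = lens_assoc C A"
  "lunit (lens_moncat C A) = lens_lunit C A" "runit (lens_moncat C A) = lens_runit C A"
  by (simp_all add: lens_moncat_def lens_cat_def cat.defs moncat.defs)

lemma cart_moncat_sel [simp]:
  "obs (cart_moncat C) = obs C" "ars (cart_moncat C) = ars C"
  "src (cart_moncat C) = src C" "tgt (cart_moncat C) = tgt C"
  "ident (cart_moncat C) = ident C" "cmp (cart_moncat C) = cmp C"
  "ten (cart_moncat C) = prd C" "tenar (cart_moncat C) = prdar C"
  "munit (cart_moncat C) = one C" "assoc (cart_moncat C) = prd_assoc C"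
  "lunit (cart_moncat C) = prd_lunit C" "runit (cart_moncat C) = prd_runit C"
  by (simp_all add: cart_moncat_def cat.defs moncat.defs)

lemma span_moncat_sel [simp]:
  "obs (span_moncat C) = obs C" "ars (span_moncat C) = span_ars C"
  "src (span_moncat C) = fst" "tgt (span_moncat C) = snd \<circ> snd"
  "ident (span_moncat C) = (\<lambda>x. span_of C (ident C x))" "cmp (span_moncat C) = span_cmp C"
  "ten (span_moncat C) = prd C" "tenar (span_moncat C) = span_tenar C"
  "munit (span_moncat C) = one C" "assoc (span_moncat C) = (\<lambda>x y z. span_of C (prd_assoc C x y z))"
  "lunit (span_moncat C) = (\<lambda>x. span_of C (prd_lunit C x))"
  "runit (span_moncat C) = (\<lambda>x. span_of C (prd_runit C x))"
  by (simp_all add: span_moncat_def)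

lemma prod_moncat_sel [simp]:
  "obs (prod_moncat M N) = obs M \<times> obs N" "ars (prod_moncat M N) = ars M \<times> ars N"
  "src (prod_moncat M N) (f, f') = (src M f, src N f')" "tgt (prod_moncat M N) (f, f') = (tgt M f, tgt N f')"
  "ident (prod_moncat M N) (x, x') = (ident M x, ident N x')"
  "cmp (prod_moncat M N) (f, f') (g, g') = (cmp M f g, cmp N f' g')"
  "ten (prod_moncat M N) (x, x') (y, y') = (ten M x y, ten N x' y')"
  "tenar (prod_moncat M N) (f, f') (g, g') = (tenar M f g, tenar N f' g')"
  "munit (prod_moncat M N) = (munit M, munit N)"
  "assoc (prod_moncat M N) (x, x') (y, y') (z, z') = (assoc M x y z, assoc N x' y' z')"
  "lunit (prod_moncat M N) (x, x') = (lunit M x, lunit N x')"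
  "runit (prod_moncat M N) (x, x') = (runit M x, runit N x')"
  by (simp_all add: prod_moncat_def prod_cat_def cat.defs moncat.defs)

lemma span_class_sel [simp]:
  "fst (span_class C i i') = tgt C i" "snd (snd (span_class C i i')) = tgt C i'"
  by (simp_all add: span_class_def)

text \<open>The section \<open>T\<close> enters twice, as a functor into \<open>lens_cat C A\<close>
  and as an oplax functor into \<open>lens_moncat C A\<close>; the prefix \<open>oplax\<close> keeps
  the two families of functor facts apart.\<close>

locale rsm_data =
  monoidal_indexed_category C A + dynamical_system_doctrine C A To Ta +
  oplax: oplax_monoidal_functor "cart_moncat C" "lens_moncat C A" To Ta e d
  for C :: "('o, 'a, 'z) cartcat_scheme" (structure)
    and A :: "('o, 'a, 'p, 'q, 'y) mon_indexed_scheme"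
    and To :: "'o \<Rightarrow> 'p \<times> 'o" and Ta :: "'a \<Rightarrow> ('o, 'a, 'p, 'q) lens"
    and e :: "('o, 'a, 'p, 'q) lens" and d :: "'o \<Rightarrow> 'o \<Rightarrow> ('o, 'a, 'p, 'q) lens" +
  assumes pullbacks: "has_pullbacks C"
begin

abbreviation lcmp (infixl "\<odot>" 70) where "k \<odot> l \<equiv> lens_cmp C A k l"

abbreviation triples where "triples \<equiv> rsm_triples C A To"

abbreviation cls where "cls x a \<equiv> rsm_iso C A To Ta x `` {a}"

text \<open>The category laws are restated with \<open>lens_ars\<close> and \<open>lens_cmp\<close>.
  The selector rules rewrite both \<open>lens_cat C A\<close> and \<open>lens_moncat C A\<close> to
  these, so one set of rules serves both records.\<close>

lemmas lens_category_simps [simp] =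
  category.src_obs[OF lens_category, unfolded lens_cat_sel]
  category.tgt_obs[OF lens_category, unfolded lens_cat_sel]
  category.cmp_ars[OF lens_category, unfolded lens_cat_sel]
  category.src_cmp[OF lens_category, unfolded lens_cat_sel]
  category.tgt_cmp[OF lens_category, unfolded lens_cat_sel]
  category.ident_ars[OF lens_category, unfolded lens_cat_sel]
  category.src_ident[OF lens_category, unfolded lens_cat_sel]
  category.tgt_ident[OF lens_category, unfolded lens_cat_sel]
  category.ident_cmp_eq[OF lens_category, unfolded lens_cat_sel]
  category.cmp_ident_eq[OF lens_category, unfolded lens_cat_sel]
  category.cmp_assoc[OF lens_category, unfolded lens_cat_sel]

lemmas lens_cmp_reassoc = category.cmp_reassoc[OF lens_category, unfolded lens_cat_sel]

lemmas T_simps [simp] = oplax.Fo_obs[simplified] oplax.Fa_ars[simplified] oplax.src_Fa[simplified]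
  oplax.tgt_Fa[simplified] oplax.Fa_ident[simplified] oplax.Fa_cmp[simplified]

lemma oplax_simps [simp]:
  "e \<in> lens_ars C A" "lens_src e = To (one C)" "lens_tgt e = lens_munit C A"
  "\<lbrakk>x \<in> obs C; y \<in> obs C\<rbrakk> \<Longrightarrow> d x y \<in> lens_ars C A"
  "\<lbrakk>x \<in> obs C; y \<in> obs C\<rbrakk> \<Longrightarrow> lens_src (d x y) = To (prd C x y)"
  "\<lbrakk>x \<in> obs C; y \<in> obs C\<rbrakk> \<Longrightarrow> lens_tgt (d x y) = lens_ten C A (To x) (To y)"
  using oplax.e_homs oplax.d_homs by simp_all

lemmas d_natural = oplax.d_natural[simplified]
lemmas d_assoc = oplax.d_assoc[unfolded lens_moncat_sel cart_moncat_sel]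
lemmas d_lunit = oplax.d_lunit[unfolded lens_moncat_sel cart_moncat_sel]
lemmas d_runit = oplax.d_runit[unfolded lens_moncat_sel cart_moncat_sel]

text \<open>Folds back what \<open>T_simps\<close> unfolds, for composites
  \<open>s \<Zsemi> t\<close> that simplify further, such as an isomorphism and its inverse.\<close>

lemma Ta_cmp_lens:
  "\<lbrakk>s \<in> ars C; t \<in> ars C; tgt C s = src C t; l \<in> lens_ars C A; lens_src l = To (tgt C t)\<rbrakk>
    \<Longrightarrow> Ta s \<odot> (Ta t \<odot> l) = Ta (s \<Zsemi> t) \<odot> l"
  by simp

lemma triples_iff:
  "(S, l, p) \<in> triples (X, M) \<longleftrightarrow> S \<in> obs C \<and> l \<in> lens_ars C A \<and> lens_src l = To S \<and> lens_tgt l = X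
    \<and> p \<in> ars C \<and> src C p = S \<and> tgt C p = M"
  by (simp add: rsm_triples_def)

lemma rsm_isoE:
  assumes "(a, b) \<in> rsm_iso C A To Ta x"
  obtains t S l p where "a = (src C t, Ta t \<odot> l, t \<Zsemi> p)" "b = (S, l, p)" "t \<in> isos C" "t \<in> ars C"
    "tgt C t = S" "(S, l, p) \<in> triples x"
proof -
  obtain S l p S' l' p' where ab: "a = (S, l, p)" "b = (S', l', p')"
    by (cases a; cases b) blast
  obtain t where "t \<in> isos C" "t \<in> homs C S S'" "Ta t \<odot> l' = l" "t \<Zsemi> p' = p" "(S', l', p') \<in> triples x"
    using assms unfolding ab rsm_iso_def lens_cat_sel by blast
  then show thesis
    using that[of t l' p' S'] ab by simp
qed

lemma rsm_isoI:
  assumes "t \<in> isos C" "t \<in> ars C" "(tgt C t, l, p) \<in> triples x"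
    "S = src C t" "Ta t \<odot> l = k" "t \<Zsemi> p = q"
  shows "((S, k, q), (tgt C t, l, p)) \<in> rsm_iso C A To Ta x"
proof -
  obtain X M where x: "x = (X, M)"
    by (cases x)
  have "(S, k, q) \<in> triples x"
    using assms unfolding x triples_iff by auto
  then show ?thesis
    using assms unfolding rsm_iso_def by auto
qed

text \<open>An isomorphism of triples acts on the lens through \<open>Ta\<close>. Since
  \<open>Ta\<close> preserves identities and composites, identities, inverses and composites of
  state maps give reflexivity, symmetry and transitivity.\<close>

lemma equiv_rsm_iso: "equiv (triples x) (rsm_iso C A To Ta x)"
proof (rule equivI)
  show "rsm_iso C A To Ta x \<subseteq> triples x \<times> triples x"
    unfolding rsm_iso_def by blast
  obtain X M where x: "x = (X, M)"
    by (cases x)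
  show "refl_on (triples x) (rsm_iso C A To Ta x)"
  proof (rule refl_onI, clarify)
    fix S l p
    assume *: "(S, l, p) \<in> triples x"
    then have **: "S \<in> obs C" "l \<in> lens_ars C A" "lens_src l = To S" "p \<in> ars C" "src C p = S"
      unfolding x triples_iff by blast+
    show "((S, l, p), (S, l, p)) \<in> rsm_iso C A To Ta x"
      using rsm_isoI[of "ident C S" l p x S l p] * ** by simp
  qed
  show "sym (rsm_iso C A To Ta x)"
  proof (rule symI)
    fix a b
    assume "(a, b) \<in> rsm_iso C A To Ta x"
    then obtain t S l p where t: "a = (src C t, Ta t \<odot> l, t \<Zsemi> p)" "b = (S, l, p)" "t \<in> isos C" "t \<in> ars C"
      "tgt C t = S" "(S, l, p) \<in> triples x"
      by (rule rsm_isoE)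
    obtain s where s: "s \<in> isos C" "s \<in> ars C" "src C s = tgt C t" "tgt C s = src C t"
      "s \<Zsemi> t = ident C (tgt C t)"
      using isosE[OF t(3)] by metis
    have l: "S \<in> obs C" "l \<in> lens_ars C A" "lens_src l = To S" "p \<in> ars C" "src C p = S"
      using t(6) unfolding x triples_iff by blast+
    have "Ta s \<odot> (Ta t \<odot> l) = l"
      using Ta_cmp_lens[OF s(2) t(4), of l] s(3-5) t(5) l by simp
    moreover have "s \<Zsemi> (t \<Zsemi> p) = p"
      using s t(4,5) l by (simp add: cmp_inverse_cancel[OF s(5)])
    moreover have "(src C t, Ta t \<odot> l, t \<Zsemi> p) \<in> triples x"
      using t(4-6) unfolding x triples_iff by simp
    ultimately show "(b, a) \<in> rsm_iso C A To Ta x"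
      using rsm_isoI[OF s(1,2), of "Ta t \<odot> l" "t \<Zsemi> p" x S l p] s t(1,2,5) by simp
  qed
  show "trans (rsm_iso C A To Ta x)"
  proof (rule transI)
    fix a b c
    assume ab: "(a, b) \<in> rsm_iso C A To Ta x" and bc: "(b, c) \<in> rsm_iso C A To Ta x"
    obtain t S l p where t: "a = (src C t, Ta t \<odot> l, t \<Zsemi> p)" "b = (S, l, p)" "t \<in> isos C" "t \<in> ars C"
      "tgt C t = S"
      using ab by (rule rsm_isoE)
    obtain s S' l' p' where s: "b = (src C s, Ta s \<odot> l', s \<Zsemi> p')" "c = (S', l', p')" "s \<in> isos C" "s \<in> ars C"
      "tgt C s = S'" "(S', l', p') \<in> triples x"
      using bc by (rule rsm_isoE)
    have l: "S = src C s" "l = Ta s \<odot> l'" "p = s \<Zsemi> p'"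
      using t(2) s(1) by simp_all
    have l': "S' \<in> obs C" "l' \<in> lens_ars C A" "lens_src l' = To S'" "p' \<in> ars C" "src C p' = S'"
      using s(6) unfolding x triples_iff by blast+
    have ts: "tgt C t = src C s"
      using t(5) l by simp
    show "(a, c) \<in> rsm_iso C A To Ta x"
      using rsm_isoI[OF cmp_isos[OF t(3) s(3) ts], of l' p' x] t(1,4) s(2,4-6) ts l l' by simp
  qed
qed

lemma cls_self: "a \<in> triples x \<Longrightarrow> a \<in> cls x a"
  using equiv_class_self[OF equiv_rsm_iso] .

lemma cls_eqI: "(a, b) \<in> rsm_iso C A To Ta x \<Longrightarrow> cls x a = cls x b"
  using equiv_class_eq[OF equiv_rsm_iso] .

lemma classE:
  assumes "E \<in> triples (X, M) // rsm_iso C A To Ta (X, M)"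
  obtains S l p where "E = cls (X, M) (S, l, p)" "(S, l, p) \<in> triples (X, M)"
    "S \<in> obs C" "l \<in> lens_ars C A" "lens_src l = To S" "lens_tgt l = X" "p \<in> ars C" "src C p = S" "tgt C p = M"
  using assms unfolding quotient_def by (auto simp: triples_iff)

text \<open>All sets in the unions below coincide, by independence of representatives and of the pullback.\<close>

definition rsm_ar ::
  "('o, 'a, 'p, 'q) lens \<times> 'o \<times> ('a \<times> 'a) set \<times> 'o
    \<Rightarrow> ('o \<times> ('o, 'a, 'p, 'q) lens \<times> 'a) set \<Rightarrow> ('o \<times> ('o, 'a, 'p, 'q) lens \<times> 'a) set" where
  "rsm_ar = (\<lambda>(f, M, Q, M') E. \<Union>{cls (lens_tgt f, M') (src C h, Ta h \<odot> (l \<odot> f), k \<Zsemi> i') |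
     h k i i' S l p. (i, i') \<in> Q \<and> (S, l, p) \<in> E \<and> is_pullback C h k p i})"

definition rsm_mul ::
  "('p \<times> 'o) \<times> 'o \<Rightarrow> ('p \<times> 'o) \<times> 'o \<Rightarrow> ('o \<times> ('o, 'a, 'p, 'q) lens \<times> 'a) set
    \<Rightarrow> ('o \<times> ('o, 'a, 'p, 'q) lens \<times> 'a) set \<Rightarrow> ('o \<times> ('o, 'a, 'p, 'q) lens \<times> 'a) set" where
  "rsm_mul = (\<lambda>(X, M) (Y, N) E E'. \<Union>{cls (lens_ten C A X Y, prd C M N)
       (prd C S S', d S S' \<odot> lens_tenar C A l l', prdar C p p') |
     S l p S' l' p'. (S, l, p) \<in> E \<and> (S', l', p') \<in> E'})"

definition rsm_unit :: "('o \<times> ('o, 'a, 'p, 'q) lens \<times> 'a) set" where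
  "rsm_unit = cls (lens_munit C A, one C) (one C, e, ident C (one C))"

section \<open>Evaluation of the action and of the laxator on representatives\<close>

text \<open>For isomorphic representatives, \<open>pullback_iso\<close> yields an isomorphism
  \<open>w\<close> of the new state objects. Its equation over \<open>h\<close> is carried to lenses
  by functoriality of \<open>Ta\<close>; its equation over \<open>k\<close> gives agreement of the
  right legs.\<close>

lemma rsm_ar_class:
  assumes f: "f \<in> lens_ars C A" "lens_src f = X" "lens_tgt f = Y"
    and a: "(S, l, p) \<in> triples (X, M)"
    and i: "i \<in> ars C" "i' \<in> ars C" "src C i' = src C i" "tgt C i' = N"
    and P: "is_pullback C h k p i"
  shows "rsm_ar (f, span_class C i i') (cls (X, M) (S, l, p))
    = cls (Y, N) (src C h, Ta h \<odot> (l \<odot> f), k \<Zsemi> i')"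
proof -
  note D = is_pullbackD[OF P]
  have l: "S \<in> obs C" "l \<in> lens_ars C A" "lens_src l = To S" "lens_tgt l = X" "p \<in> ars C" "src C p = S" "tgt C p = M"
    using a unfolding triples_iff by blast+
  have eq: "cls (Y, N) (src C h1, Ta h1 \<odot> (l1 \<odot> f), k1 \<Zsemi> u') = cls (Y, N) (src C h, Ta h \<odot> (l \<odot> f), k \<Zsemi> i')"
    if u: "((i, i'), (u, u')) \<in> span_iso C" and b: "((S, l, p), (S1, l1, p1)) \<in> rsm_iso C A To Ta (X, M)"
      and P1: "is_pullback C h1 k1 p1 u" for h1 k1 u u' S1 l1 p1
  proof -
    note D1 = is_pullbackD[OF P1]
    obtain s where s: "s \<in> isos C" "s \<in> ars C" "src C s = src C i" "tgt C s = src C u"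
      "s \<Zsemi> u = i" "s \<Zsemi> u' = i'" and u': "u \<in> ars C" "u' \<in> ars C" "src C u' = src C u"
      using u unfolding span_iso_iff spans_def by blast
    obtain t where t: "S = src C t" "l = Ta t \<odot> l1" "p = t \<Zsemi> p1" "t \<in> isos C" "t \<in> ars C" "tgt C t = S1"
      and "(S1, l1, p1) \<in> triples (X, M)"
      using b by (elim rsm_isoE) blast
    then have l1: "S1 \<in> obs C" "l1 \<in> lens_ars C A" "lens_src l1 = To S1" "lens_tgt l1 = X" "p1 \<in> ars C"
      "src C p1 = S1" "tgt C p1 = M"
      unfolding triples_iff by blast+
    obtain w where w: "w \<in> isos C" "w \<in> ars C" "src C w = src C h" "tgt C w = src C h1"
      "w \<Zsemi> h1 = h \<Zsemi> t" "w \<Zsemi> k1 = k \<Zsemi> s"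
    proof (rule pullback_iso[OF P P1, of t s])
    qed (use t l1 s l in simp_all)
    have th: "tgt C h = src C t"
      using D l t by simp
    have "Ta w \<odot> (Ta h1 \<odot> (l1 \<odot> f)) = Ta (w \<Zsemi> h1) \<odot> (l1 \<odot> f)"
      using w(1-4) D1 l1 f by simp
    also have "\<dots> = Ta h \<odot> (l \<odot> f)"
      unfolding w(5) t(2) using D l1 f th t(5,6) by simp
    finally have 1: "Ta w \<odot> (Ta h1 \<odot> (l1 \<odot> f)) = Ta h \<odot> (l \<odot> f)" .
    have 2: "w \<Zsemi> (k1 \<Zsemi> u') = k \<Zsemi> i'"
      using w(1-4) s u' D D1 by (simp add: cmp_reassoc[OF w(6)])
    have "tgt C u' = N"
      using s u' i by (metis tgt_cmp)
    then have "(tgt C w, Ta h1 \<odot> (l1 \<odot> f), k1 \<Zsemi> u') \<in> triples (Y, N)"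
      using w(4) D1 l1 f u' unfolding triples_iff by simp
    then show ?thesis
      using cls_eqI[OF rsm_isoI[OF w(1,2) _ _ 1 2]] w(3,4) by simp
  qed
  have "\<Union>{cls (Y, N) (src C h, Ta h \<odot> (l1 \<odot> f), k \<Zsemi> u') |
     h k u u' S1 l1 p1. (u, u') \<in> span_iso C `` {(i, i')} \<and> (S1, l1, p1) \<in> cls (X, M) (S, l, p)
       \<and> is_pullback C h k p1 u}
    = cls (Y, N) (src C h, Ta h \<odot> (l \<odot> f), k \<Zsemi> i')"
    using span_iso_refl[OF i(1-3)] cls_self[OF a] P by (intro Union_eq) (blast, use eq in blast)
  then show ?thesis
    using f i by (simp add: rsm_ar_def span_class_def)
qed

text \<open>A pullback of \<open>p\<close> along an identity is \<open>p\<close> itself, so the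
  graph of a map acts by composition. Identities, associators and unitors of
  \<open>span_moncat C\<close> are all such graphs.\<close>

lemma rsm_ar_span_of:
  assumes f: "f \<in> lens_ars C A" "lens_src f = X" "lens_tgt f = Y"
    and a: "(S, l, p) \<in> triples (X, M)" and g: "g \<in> ars C" "src C g = M" "tgt C g = N"
  shows "rsm_ar (f, span_of C g) (cls (X, M) (S, l, p)) = cls (Y, N) (S, l \<odot> f, p \<Zsemi> g)"
proof -
  have l: "S \<in> obs C" "l \<in> lens_ars C A" "lens_src l = To S" "lens_tgt l = X" "p \<in> ars C" "src C p = S" "tgt C p = M"
    using a unfolding triples_iff by blast+
  have M: "M \<in> obs C"
    using g by auto
  have P: "is_pullback C (ident C S) p p (ident C M)"
    using is_pullback_ident[OF l(5)] l(6,7) by simp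
  show ?thesis
    unfolding span_of_def g(2)
    using rsm_ar_class[OF f a, of "ident C M" g N "ident C S" p] P l M g f by simp
qed

text \<open>For isomorphisms \<open>t\<close> and \<open>s\<close> of the two state objects,
  \<open>prdar C t s\<close> is the isomorphism of products: naturality of \<open>d\<close> turns
  its image under \<open>Ta\<close> into the tensor of \<open>Ta t\<close> and \<open>Ta s\<close>,
  and interchange absorbs these into the lenses.\<close>

lemma rsm_mul_class:
  assumes a: "(S, l, p) \<in> triples (X, M)" and b: "(S', l', p') \<in> triples (Y, N)"
  shows "rsm_mul (X, M) (Y, N) (cls (X, M) (S, l, p)) (cls (Y, N) (S', l', p'))
    = cls (lens_ten C A X Y, prd C M N) (prd C S S', d S S' \<odot> lens_tenar C A l l', prdar C p p')"
proof -
  have eq: "cls (lens_ten C A X Y, prd C M N) (prd C R R', d R R' \<odot> lens_tenar C A k k', prdar C q q')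
    = cls (lens_ten C A X Y, prd C M N) (prd C S S', d S S' \<odot> lens_tenar C A l l', prdar C p p')"
    if a: "((S, l, p), (R, k, q)) \<in> rsm_iso C A To Ta (X, M)"
      and b: "((S', l', p'), (R', k', q')) \<in> rsm_iso C A To Ta (Y, N)" for R k q R' k' q'
  proof -
    obtain t where t: "S = src C t" "l = Ta t \<odot> k" "p = t \<Zsemi> q" "t \<in> isos C" "t \<in> ars C" "tgt C t = R"
      and "(R, k, q) \<in> triples (X, M)"
      using a by (elim rsm_isoE) blast
    then have k: "R \<in> obs C" "k \<in> lens_ars C A" "lens_src k = To R" "lens_tgt k = X" "q \<in> ars C"
      "src C q = R" "tgt C q = M"
      unfolding triples_iff by blast+
    obtain s where s: "S' = src C s" "l' = Ta s \<odot> k'" "p' = s \<Zsemi> q'" "s \<in> isos C" "s \<in> ars C" "tgt C s = R'"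
      and "(R', k', q') \<in> triples (Y, N)"
      using b by (elim rsm_isoE) blast
    then have k': "R' \<in> obs C" "k' \<in> lens_ars C A" "lens_src k' = To R'" "lens_tgt k' = Y" "q' \<in> ars C"
      "src C q' = R'" "tgt C q' = N"
      unfolding triples_iff by blast+
    have "Ta (prdar C t s) \<odot> (d R R' \<odot> lens_tenar C A k k')
      = d (src C t) (src C s) \<odot> (lens_tenar C A (Ta t) (Ta s) \<odot> lens_tenar C A k k')"
      using d_natural[of t s] t(5,6) s(5,6) k k' by (intro lens_cmp_reassoc) simp_all
    also have "\<dots> = d S S' \<odot> lens_tenar C A l l'"
      unfolding t(1,2) s(1,2) using t(5,6) s(5,6) k k' by (subst lens_tenar_cmp) simp_all
    finally have 1: "Ta (prdar C t s) \<odot> (d R R' \<odot> lens_tenar C A k k') = d S S' \<odot> lens_tenar C A l l'" .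
    have 2: "prdar C t s \<Zsemi> prdar C q q' = prdar C p p'"
      unfolding t(3) s(3) using t(5,6) s(5,6) k k' by (simp add: prdar_cmp)
    have "(tgt C (prdar C t s), d R R' \<odot> lens_tenar C A k k', prdar C q q') \<in> triples (lens_ten C A X Y, prd C M N)"
      using t(5,6) s(5,6) k k' unfolding triples_iff by simp
    then show ?thesis
      using cls_eqI[OF rsm_isoI[OF prdar_isos[OF t(4) s(4)] _ _ _ 1 2]] t(1,5,6) s(1,5,6) by simp
  qed
  have "\<Union>{cls (lens_ten C A X Y, prd C M N) (prd C R R', d R R' \<odot> lens_tenar C A k k', prdar C q q') |
     R k q R' k' q'. (R, k, q) \<in> cls (X, M) (S, l, p) \<and> (R', k', q') \<in> cls (Y, N) (S', l', p')}
    = cls (lens_ten C A X Y, prd C M N) (prd C S S', d S S' \<odot> lens_tenar C A l l', prdar C p p')"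
    using cls_self[OF a] cls_self[OF b] by (intro Union_eq) (blast, use eq in blast)
  then show ?thesis
    by (simp add: rsm_mul_def)
qed

lemma mul_triples:
  "\<lbrakk>(S, l, p) \<in> triples (X, M); (S', l', p') \<in> triples (Y, N)\<rbrakk> \<Longrightarrow>
    (prd C S S', d S S' \<odot> lens_tenar C A l l', prdar C p p') \<in> triples (lens_ten C A X Y, prd C M N)"
  unfolding triples_iff by simp

lemma unit_triples: "(one C, e, ident C (one C)) \<in> triples (lens_munit C A, one C)"
  unfolding triples_iff by simp

lemma obtain_pullback:
  assumes "p \<in> ars C" "i \<in> ars C" "tgt C p = tgt C i"
  obtains h k where "is_pullback C h k p i"
  using pullbacks assms unfolding has_pullbacks_def by blast

lemma ar_triples:
  assumes "f \<in> lens_ars C A" "(S, l, p) \<in> triples (lens_src f, tgt C i)"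
    "i \<in> ars C" "i' \<in> ars C" "src C i' = src C i" "is_pullback C h k p i"
  shows "(src C h, Ta h \<odot> (l \<odot> f), k \<Zsemi> i') \<in> triples (lens_tgt f, tgt C i')"
  using assms is_pullbackD[OF assms(6)] unfolding triples_iff by simp

section \<open>Verification of the lax monoidal functor laws\<close>

lemma rsm_lax_monoidal:
  "lax_monoidal_functor_to_Set (prod_moncat (lens_moncat C A) (span_moncat C))
     (\<lambda>x. triples x // rsm_iso C A To Ta x) rsm_ar rsm_unit rsm_mul"
proof (rule lax_monoidal_functor_to_Set.intro, goal_cases)
  case (1 F a)
  obtain f X where F: "F = (f, X)" "f \<in> lens_ars C A" "X \<in> span_ars C"
    using 1(1) by (cases F) simp
  obtain i i' where X: "X = span_class C i i'" and i: "i \<in> ars C" "i' \<in> ars C" "src C i' = src C i"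
    using F(3) by (rule span_arsE)
  have "a \<in> triples (lens_src f, tgt C i) // rsm_iso C A To Ta (lens_src f, tgt C i)"
    using 1(2) by (simp add: F X)
  then obtain S l p where a: "a = cls (lens_src f, tgt C i) (S, l, p)" "(S, l, p) \<in> triples (lens_src f, tgt C i)"
    "p \<in> ars C" "tgt C p = tgt C i"
    by (rule classE)
  obtain h k where P: "is_pullback C h k p i"
    using obtain_pullback[OF a(3) i(1) a(4)] .
  have "rsm_ar F a = cls (lens_tgt f, tgt C i') (src C h, Ta h \<odot> (l \<odot> f), k \<Zsemi> i')"
    unfolding F(1) X a(1) by (rule rsm_ar_class[OF F(2) refl refl a(2) i refl P])
  then show ?case
    using quotientI[OF ar_triples[OF F(2) a(2) i P]] by (simp add: F X)
next
  case (2 x a)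
  obtain X M where x: "x = (X, M)" "X \<in> lens_obs C A" "M \<in> obs C"
    using 2(1) by (cases x) simp
  obtain S l p where a: "a = cls (X, M) (S, l, p)" "(S, l, p) \<in> triples (X, M)"
    "l \<in> lens_ars C A" "lens_tgt l = X" "p \<in> ars C" "tgt C p = M"
    using 2(2) unfolding x(1) by (rule classE)
  show ?case
    using rsm_ar_span_of[OF _ _ _ a(2), of "lens_ident C A X" X "ident C M" M] x a(3-6)
    by (simp add: a(1) x(1))
next
  case (3 F G a)
  obtain f X where F: "F = (f, X)" "f \<in> lens_ars C A" "X \<in> span_ars C"
    using 3(1) by (cases F) simp
  obtain g Y where G: "G = (g, Y)" "g \<in> lens_ars C A" "Y \<in> span_ars C"
    using 3(2) by (cases G) simp
  obtain i i' where X: "X = span_class C i i'" and i: "i \<in> ars C" "i' \<in> ars C" "src C i' = src C i"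
    using F(3) by (rule span_arsE)
  obtain j j' where Y: "Y = span_class C j j'" and j: "j \<in> ars C" "j' \<in> ars C" "src C j' = src C j"
    using G(3) by (rule span_arsE)
  have fg: "lens_tgt f = lens_src g" and ij: "tgt C i' = tgt C j"
    using 3(3) by (simp_all add: F G X Y)
  have "a \<in> triples (lens_src f, tgt C i) // rsm_iso C A To Ta (lens_src f, tgt C i)"
    using 3(4) by (simp add: F X)
  then obtain S l p where a: "a = cls (lens_src f, tgt C i) (S, l, p)" "(S, l, p) \<in> triples (lens_src f, tgt C i)"
    "S \<in> obs C" "l \<in> lens_ars C A" "lens_src l = To S" "lens_tgt l = lens_src f"
    "p \<in> ars C" "src C p = S" "tgt C p = tgt C i"
    by (rule classE)
  obtain h k where P: "is_pullback C h k p i"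
    using obtain_pullback[OF a(7) i(1) a(9)] .
  obtain u v where Q: "is_pullback C u v i' j"
    using obtain_pullback[OF i(2) j(1) ij] .
  note D = is_pullbackD[OF P] and D' = is_pullbackD[OF Q]
  obtain t s where R: "is_pullback C t s k u"
    by (rule obtain_pullback[OF D(2) D'(1)]) (use D D' i in simp)
  note D'' = is_pullbackD[OF R]
  have PR: "is_pullback C (t \<Zsemi> h) s p (u \<Zsemi> i)"
    by (rule is_pullback_paste[OF P R])
  have QR: "is_pullback C t (s \<Zsemi> v) (k \<Zsemi> i') j"
    by (rule is_pullback_sym[OF is_pullback_paste[OF is_pullback_sym[OF Q] is_pullback_sym[OF R]]])
  have "rsm_ar (cmp (prod_moncat (lens_moncat C A) (span_moncat C)) F G) a
    = rsm_ar (f \<odot> g, span_class C (u \<Zsemi> i) (v \<Zsemi> j')) a"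
    by (simp add: F G X Y span_cmp_class[OF i j Q])
  also have "\<dots> = cls (lens_tgt g, tgt C j') (src C (t \<Zsemi> h), Ta (t \<Zsemi> h) \<odot> (l \<odot> (f \<odot> g)), s \<Zsemi> (v \<Zsemi> j'))"
    unfolding a(1)
    by (rule rsm_ar_class[OF _ _ _ _ _ _ _ _ PR]) (use F G fg a i j D' in simp_all)
  also have "\<dots> = cls (lens_tgt g, tgt C j') (src C t, Ta t \<odot> ((Ta h \<odot> (l \<odot> f)) \<odot> g), (s \<Zsemi> v) \<Zsemi> j')"
    using F G fg a i j D D' D'' by simp
  also have "\<dots> = rsm_ar (g, Y) (cls (lens_tgt f, tgt C i') (src C h, Ta h \<odot> (l \<odot> f), k \<Zsemi> i'))"
    unfolding Y fg
    by (rule rsm_ar_class[OF _ _ _ _ _ _ _ _ QR, symmetric])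
      (use ar_triples[OF F(2) a(2) i P] G fg ij j in simp_all)
  also have "\<dots> = rsm_ar G (rsm_ar F a)"
    unfolding F(1) G(1) X a(1) by (subst rsm_ar_class[OF F(2) refl refl a(2) i refl P]) (rule refl)
  finally show ?case .
next
  case 4
  then show ?case
    using quotientI[OF unit_triples] by (simp add: rsm_unit_def)
next
  case (5 x y a b)
  obtain X M where x: "x = (X, M)"
    by (cases x)
  obtain Y N where y: "y = (Y, N)"
    by (cases y)
  obtain S l p where a: "a = cls (X, M) (S, l, p)" "(S, l, p) \<in> triples (X, M)"
    using 5(3) unfolding x by (rule classE)
  obtain S' l' p' where b: "b = cls (Y, N) (S', l', p')" "(S', l', p') \<in> triples (Y, N)"
    using 5(4) unfolding y by (rule classE)
  show ?case
    using quotientI[OF mul_triples[OF a(2) b(2)]] rsm_mul_class[OF a(2) b(2)] by (simp add: x y a(1) b(1))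
next
  case (6 F G a b)
  obtain f X where F: "F = (f, X)" "f \<in> lens_ars C A" "X \<in> span_ars C"
    using 6(1) by (cases F) simp
  obtain g Y where G: "G = (g, Y)" "g \<in> lens_ars C A" "Y \<in> span_ars C"
    using 6(2) by (cases G) simp
  obtain i i' where X: "X = span_class C i i'" and i: "i \<in> ars C" "i' \<in> ars C" "src C i' = src C i"
    using F(3) by (rule span_arsE)
  obtain j j' where Y: "Y = span_class C j j'" and j: "j \<in> ars C" "j' \<in> ars C" "src C j' = src C j"
    using G(3) by (rule span_arsE)
  have "a \<in> triples (lens_src f, tgt C i) // rsm_iso C A To Ta (lens_src f, tgt C i)"
    using 6(3) by (simp add: F X)
  then obtain S l p where a: "a = cls (lens_src f, tgt C i) (S, l, p)" "(S, l, p) \<in> triples (lens_src f, tgt C i)"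
    "S \<in> obs C" "l \<in> lens_ars C A" "lens_src l = To S" "lens_tgt l = lens_src f"
    "p \<in> ars C" "src C p = S" "tgt C p = tgt C i"
    by (rule classE)
  have "b \<in> triples (lens_src g, tgt C j) // rsm_iso C A To Ta (lens_src g, tgt C j)"
    using 6(4) by (simp add: G Y)
  then obtain S' l' p' where b: "b = cls (lens_src g, tgt C j) (S', l', p')" "(S', l', p') \<in> triples (lens_src g, tgt C j)"
    "S' \<in> obs C" "l' \<in> lens_ars C A" "lens_src l' = To S'" "lens_tgt l' = lens_src g"
    "p' \<in> ars C" "src C p' = S'" "tgt C p' = tgt C j"
    by (rule classE)
  obtain h k where P: "is_pullback C h k p i"
    using obtain_pullback[OF a(7) i(1) a(9)] .
  obtain h' k' where Q: "is_pullback C h' k' p' j"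
    using obtain_pullback[OF b(7) j(1) b(9)] .
  note D = is_pullbackD[OF P] and D' = is_pullbackD[OF Q]
  let ?Z = "lens_ten C A (lens_tgt f) (lens_tgt g)" and ?M = "prd C (tgt C i') (tgt C j')"
  have "rsm_ar (lens_tenar C A f g, span_class C (prdar C i j) (prdar C i' j'))
      (cls (lens_ten C A (lens_src f) (lens_src g), prd C (tgt C i) (tgt C j))
        (prd C S S', d S S' \<odot> lens_tenar C A l l', prdar C p p'))
    = cls (?Z, ?M) (src C (prdar C h h'), Ta (prdar C h h') \<odot> ((d S S' \<odot> lens_tenar C A l l') \<odot> lens_tenar C A f g),
        prdar C k k' \<Zsemi> prdar C i' j')"
    by (rule rsm_ar_class[OF _ _ _ mul_triples[OF a(2) b(2)] _ _ _ _ is_pullback_prdar[OF P Q]])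
      (use F G i j in simp_all)
  also have "prdar C k k' \<Zsemi> prdar C i' j' = prdar C (k \<Zsemi> i') (k' \<Zsemi> j')"
    using i j D D' by (simp add: prdar_cmp)
  also have "Ta (prdar C h h') \<odot> ((d S S' \<odot> lens_tenar C A l l') \<odot> lens_tenar C A f g)
    = Ta (prdar C h h') \<odot> (d S S' \<odot> lens_tenar C A (l \<odot> f) (l' \<odot> g))"
    using F G a b D D' by (simp add: lens_tenar_cmp)
  \<comment> \<open>Naturality of \<open>d\<close> at \<open>h\<close> and \<open>h'\<close>
    replaces \<open>Ta\<close> of the product projection by a tensor of lenses. Interchange then
    merges the factors into the two transported lenses, which is what the laxator produces after
    acting separately.\<close>
  also have "\<dots> = d (src C h) (src C h') \<odot> (lens_tenar C A (Ta h) (Ta h') \<odot> lens_tenar C A (l \<odot> f) (l' \<odot> g))"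
    using d_natural[of h h'] F G a b D D' by (intro lens_cmp_reassoc) simp_all
  also have "lens_tenar C A (Ta h) (Ta h') \<odot> lens_tenar C A (l \<odot> f) (l' \<odot> g)
    = lens_tenar C A (Ta h \<odot> (l \<odot> f)) (Ta h' \<odot> (l' \<odot> g))"
    by (rule lens_tenar_cmp[symmetric]) (use F G a b D D' in simp_all)
  finally have *: "rsm_ar (lens_tenar C A f g, span_class C (prdar C i j) (prdar C i' j'))
      (cls (lens_ten C A (lens_src f) (lens_src g), prd C (tgt C i) (tgt C j))
        (prd C S S', d S S' \<odot> lens_tenar C A l l', prdar C p p'))
    = cls (?Z, ?M) (src C (prdar C h h'), d (src C h) (src C h') \<odot> lens_tenar C A (Ta h \<odot> (l \<odot> f)) (Ta h' \<odot> (l' \<odot> g)),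
        prdar C (k \<Zsemi> i') (k' \<Zsemi> j'))" .
  have 1: "rsm_mul (lens_src f, tgt C i) (lens_src g, tgt C j) a b
    = cls (lens_ten C A (lens_src f) (lens_src g), prd C (tgt C i) (tgt C j))
        (prd C S S', d S S' \<odot> lens_tenar C A l l', prdar C p p')"
    unfolding a(1) b(1) by (rule rsm_mul_class[OF a(2) b(2)])
  have 2: "rsm_ar (f, X) a = cls (lens_tgt f, tgt C i') (src C h, Ta h \<odot> (l \<odot> f), k \<Zsemi> i')"
    unfolding X a(1) by (rule rsm_ar_class[OF F(2) refl refl a(2) i refl P])
  have 3: "rsm_ar (g, Y) b = cls (lens_tgt g, tgt C j') (src C h', Ta h' \<odot> (l' \<odot> g), k' \<Zsemi> j')"
    unfolding Y b(1) by (rule rsm_ar_class[OF G(2) refl refl b(2) j refl Q])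
  have 4: "rsm_mul (lens_tgt f, tgt C i') (lens_tgt g, tgt C j') (rsm_ar (f, X) a) (rsm_ar (g, Y) b)
    = cls (?Z, ?M) (prd C (src C h) (src C h'),
        d (src C h) (src C h') \<odot> lens_tenar C A (Ta h \<odot> (l \<odot> f)) (Ta h' \<odot> (l' \<odot> g)),
        prdar C (k \<Zsemi> i') (k' \<Zsemi> j'))"
    unfolding 2 3 by (rule rsm_mul_class[OF ar_triples[OF F(2) a(2) i P] ar_triples[OF G(2) b(2) j Q]])
  show ?case
    unfolding F(1) G(1) prod_moncat_sel
    using * 1 4 D D' by (simp add: X Y span_tenar_class[OF i j])
next
  case (7 x y z a b c)
  obtain X M where x: "x = (X, M)" "X \<in> lens_obs C A" "M \<in> obs C"
    using 7(1) by (cases x) simp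
  obtain Y N where y: "y = (Y, N)" "Y \<in> lens_obs C A" "N \<in> obs C"
    using 7(2) by (cases y) simp
  obtain Z L where z: "z = (Z, L)" "Z \<in> lens_obs C A" "L \<in> obs C"
    using 7(3) by (cases z) simp
  obtain S l p where a: "a = cls (X, M) (S, l, p)" "(S, l, p) \<in> triples (X, M)"
    "S \<in> obs C" "l \<in> lens_ars C A" "lens_src l = To S" "lens_tgt l = X" "p \<in> ars C" "src C p = S" "tgt C p = M"
    using 7(4) unfolding x(1) by (rule classE)
  obtain R k q where b: "b = cls (Y, N) (R, k, q)" "(R, k, q) \<in> triples (Y, N)"
    "R \<in> obs C" "k \<in> lens_ars C A" "lens_src k = To R" "lens_tgt k = Y" "q \<in> ars C" "src C q = R" "tgt C q = N"
    using 7(5) unfolding y(1) by (rule classE)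
  obtain Q j r where c: "c = cls (Z, L) (Q, j, r)" "(Q, j, r) \<in> triples (Z, L)"
    "Q \<in> obs C" "j \<in> lens_ars C A" "lens_src j = To Q" "lens_tgt j = Z" "r \<in> ars C" "src C r = Q" "tgt C r = L"
    using 7(6) unfolding z(1) by (rule classE)
  let ?t = "lens_tenar C A"
  let ?W = "lens_ten C A X (lens_ten C A Y Z)" and ?O = "prd C M (prd C N L)"
  note abc = a(3-) b(3-) c(3-)
  have "rsm_ar (lens_assoc C A X Y Z, span_of C (prd_assoc C M N L))
      (rsm_mul (lens_ten C A X Y, prd C M N) (Z, L) (rsm_mul (X, M) (Y, N) a b) c)
    = cls (?W, ?O) (prd C (prd C S R) Q, (d (prd C S R) Q \<odot> ?t (d S R \<odot> ?t l k) j) \<odot> lens_assoc C A X Y Z,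
        prdar C (prdar C p q) r \<Zsemi> prd_assoc C M N L)"
    unfolding a(1) b(1) c(1) rsm_mul_class[OF a(2) b(2)] rsm_mul_class[OF mul_triples[OF a(2) b(2)] c(2)]
    by (rule rsm_ar_span_of[OF _ _ _ mul_triples[OF mul_triples[OF a(2) b(2)] c(2)]]) (use x y z in simp_all)
  also have "\<dots> = cls (?W, ?O) (prd C S (prd C R Q), d S (prd C R Q) \<odot> ?t l (d R Q \<odot> ?t k j), prdar C p (prdar C q r))"
  proof -
    let ?a = "prd_assoc C S R Q" and ?i = "lens_ident C A"
    \<comment> \<open>The right-bracketed triple is transported along the associator
      \<open>?a\<close>. An identity inserted before \<open>l\<close> lets interchange split off
      \<open>?t (?i (To S)) (d R Q)\<close>, which completes the right-hand side of
      \<open>d_assoc\<close>; naturality of \<open>lens_assoc\<close> then moves the associator to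
      the end.\<close>
    have "Ta ?a \<odot> (d S (prd C R Q) \<odot> ?t l (d R Q \<odot> ?t k j))
      = Ta ?a \<odot> (d S (prd C R Q) \<odot> ?t (?i (To S) \<odot> l) (d R Q \<odot> ?t k j))"
      using abc by simp
    also have "\<dots> = (Ta ?a \<odot> d S (prd C R Q) \<odot> ?t (?i (To S)) (d R Q)) \<odot> ?t l (?t k j)"
      using abc by (subst lens_tenar_cmp) simp_all
    also have "Ta ?a \<odot> d S (prd C R Q) \<odot> ?t (?i (To S)) (d R Q)
      = d (prd C S R) Q \<odot> ?t (d S R) (?i (To Q)) \<odot> lens_assoc C A (To S) (To R) (To Q)"
      using d_assoc[of S R Q] abc by simp
    also have "\<dots> \<odot> ?t l (?t k j)
      = d (prd C S R) Q \<odot> (?t (d S R) (?i (To Q)) \<odot> (lens_assoc C A (To S) (To R) (To Q) \<odot> ?t l (?t k j)))"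
      using abc by simp
    also have "lens_assoc C A (To S) (To R) (To Q) \<odot> ?t l (?t k j) = ?t (?t l k) j \<odot> lens_assoc C A X Y Z"
      using lens_assoc_natural[of l k j] abc by simp
    also have "d (prd C S R) Q \<odot> (?t (d S R) (?i (To Q)) \<odot> (?t (?t l k) j \<odot> lens_assoc C A X Y Z))
      = d (prd C S R) Q \<odot> ((?t (d S R) (?i (To Q)) \<odot> ?t (?t l k) j) \<odot> lens_assoc C A X Y Z)"
      using abc x y z by simp
    also have "?t (d S R) (?i (To Q)) \<odot> ?t (?t l k) j = ?t (d S R \<odot> ?t l k) j"
      using abc by (subst lens_tenar_cmp[symmetric]) simp_all
    finally have 1: "Ta ?a \<odot> (d S (prd C R Q) \<odot> ?t l (d R Q \<odot> ?t k j))
      = (d (prd C S R) Q \<odot> ?t (d S R \<odot> ?t l k) j) \<odot> lens_assoc C A X Y Z"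
      using abc x y z by simp
    have 2: "?a \<Zsemi> prdar C p (prdar C q r) = prdar C (prdar C p q) r \<Zsemi> prd_assoc C M N L"
      using prd_assoc_natural[of p q r] abc by simp
    show ?thesis
      using cls_eqI[OF rsm_isoI[OF prd_assoc_isos _ _ _ 1 2]] mul_triples[OF a(2) mul_triples[OF b(2) c(2)]] abc
      by simp
  qed
  also have "\<dots> = rsm_mul (X, M) (lens_ten C A Y Z, prd C N L) a (rsm_mul (Y, N) (Z, L) b c)"
    unfolding a(1) b(1) c(1) rsm_mul_class[OF b(2) c(2)] rsm_mul_class[OF a(2) mul_triples[OF b(2) c(2)]] ..
  finally show ?case
    by (simp add: x(1) y(1) z(1))
next
  case (8 x a)
  obtain X M where x: "x = (X, M)" "X \<in> lens_obs C A" "M \<in> obs C"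
    using 8(1) by (cases x) simp
  obtain S l p where a: "a = cls (X, M) (S, l, p)" "(S, l, p) \<in> triples (X, M)"
    "S \<in> obs C" "l \<in> lens_ars C A" "lens_src l = To S" "lens_tgt l = X" "p \<in> ars C" "src C p = S" "tgt C p = M"
    using 8(2) unfolding x(1) by (rule classE)
  let ?t = "lens_tenar C A" and ?i = "lens_ident C A" and ?U = "lens_munit C A"
  have "rsm_ar (lens_lunit C A X, span_of C (prd_lunit C M)) (rsm_mul (?U, one C) (X, M) rsm_unit a)
    = cls (X, M) (prd C (one C) S, (d (one C) S \<odot> ?t e l) \<odot> lens_lunit C A X, prdar C (ident C (one C)) p \<Zsemi> prd_lunit C M)"
    unfolding a(1) rsm_unit_def rsm_mul_class[OF unit_triples a(2)]
    by (rule rsm_ar_span_of[OF _ _ _ mul_triples[OF unit_triples a(2)]]) (use x in simp_all)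
  also have "\<dots> = cls (X, M) (S, l, p)"
  proof -
    \<comment> \<open>Identities are inserted after \<open>e\<close> and before \<open>l\<close>, so
      that interchange separates \<open>e\<close> from \<open>l\<close>. Naturality of the unitor
      then moves it past \<open>l\<close>, where it completes the left-hand side of
      \<open>d_lunit\<close>.\<close>
    have "(d (one C) S \<odot> ?t e l) \<odot> lens_lunit C A X
      = (d (one C) S \<odot> ?t (e \<odot> ?i ?U) (?i (To S) \<odot> l)) \<odot> lens_lunit C A X"
      using a(3-) by simp
    also have "\<dots> = d (one C) S \<odot> (?t e (?i (To S)) \<odot> (?t (?i ?U) l \<odot> lens_lunit C A X))"
      using a(3-) x by (subst lens_tenar_cmp) simp_all
    also have "?t (?i ?U) l \<odot> lens_lunit C A X = lens_lunit C A (To S) \<odot> l"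
      using lens_lunit_natural[of l] a(3-) by simp
    also have "d (one C) S \<odot> (?t e (?i (To S)) \<odot> (lens_lunit C A (To S) \<odot> l))
      = (d (one C) S \<odot> ?t e (?i (To S)) \<odot> lens_lunit C A (To S)) \<odot> l"
      using a(3-) by simp
    also have "\<dots> = Ta (prd_lunit C S) \<odot> l"
      using d_lunit[of S] a(3-) by simp
    finally have 1: "Ta (prd_lunit C S) \<odot> l = (d (one C) S \<odot> ?t e l) \<odot> lens_lunit C A X" ..
    have 2: "prd_lunit C S \<Zsemi> p = prdar C (ident C (one C)) p \<Zsemi> prd_lunit C M"
      using prd_lunit_natural[of p] a(3-) by simp
    show ?thesis
      using cls_eqI[OF rsm_isoI[OF prd_lunit_isos _ _ _ 1 2]] a(2,3) by simp
  qed
  finally show ?case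
    by (simp add: x(1) a(1))
next
  case (9 x a)
  obtain X M where x: "x = (X, M)" "X \<in> lens_obs C A" "M \<in> obs C"
    using 9(1) by (cases x) simp
  obtain S l p where a: "a = cls (X, M) (S, l, p)" "(S, l, p) \<in> triples (X, M)"
    "S \<in> obs C" "l \<in> lens_ars C A" "lens_src l = To S" "lens_tgt l = X" "p \<in> ars C" "src C p = S" "tgt C p = M"
    using 9(2) unfolding x(1) by (rule classE)
  let ?t = "lens_tenar C A" and ?i = "lens_ident C A" and ?U = "lens_munit C A"
  have "rsm_ar (lens_runit C A X, span_of C (prd_runit C M)) (rsm_mul (X, M) (?U, one C) a rsm_unit)
    = cls (X, M) (prd C S (one C), (d S (one C) \<odot> ?t l e) \<odot> lens_runit C A X, prdar C p (ident C (one C)) \<Zsemi> prd_runit C M)"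
    unfolding a(1) rsm_unit_def rsm_mul_class[OF a(2) unit_triples]
    by (rule rsm_ar_span_of[OF _ _ _ mul_triples[OF a(2) unit_triples]]) (use x in simp_all)
  also have "\<dots> = cls (X, M) (S, l, p)"
  proof -
    \<comment> \<open>As for the left unit with the slots exchanged: interchange separates
      \<open>e\<close> from \<open>l\<close>, and \<open>d_runit\<close> recognises what is left in
      front of \<open>l\<close>.\<close>
    have "(d S (one C) \<odot> ?t l e) \<odot> lens_runit C A X
      = (d S (one C) \<odot> ?t (?i (To S) \<odot> l) (e \<odot> ?i ?U)) \<odot> lens_runit C A X"
      using a(3-) by simp
    also have "\<dots> = d S (one C) \<odot> (?t (?i (To S)) e \<odot> (?t l (?i ?U) \<odot> lens_runit C A X))"
      using a(3-) x by (subst lens_tenar_cmp) simp_all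
    also have "?t l (?i ?U) \<odot> lens_runit C A X = lens_runit C A (To S) \<odot> l"
      using lens_runit_natural[of l] a(3-) by simp
    also have "d S (one C) \<odot> (?t (?i (To S)) e \<odot> (lens_runit C A (To S) \<odot> l))
      = (d S (one C) \<odot> ?t (?i (To S)) e \<odot> lens_runit C A (To S)) \<odot> l"
      using a(3-) by simp
    also have "\<dots> = Ta (prd_runit C S) \<odot> l"
      using d_runit[of S] a(3-) by simp
    finally have 1: "Ta (prd_runit C S) \<odot> l = (d S (one C) \<odot> ?t l e) \<odot> lens_runit C A X" ..
    have 2: "prd_runit C S \<Zsemi> p = prdar C p (ident C (one C)) \<Zsemi> prd_runit C M"
      using prd_runit_natural[of p] a(3-) by simp
    show ?thesis
      using cls_eqI[OF rsm_isoI[OF prd_runit_isos _ _ _ 1 2]] a(2,3) by simp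
  qed
  finally show ?case
    by (simp add: x(1) a(1))
qed

end

theorem theorem0p7:
  fixes C :: "('o, 'a, 'z) cartcat_scheme"
    and A :: "('o, 'a, 'p, 'q, 'y) mon_indexed_scheme"
    and To :: "'o \<Rightarrow> 'p \<times> 'o" and Ta :: "'a \<Rightarrow> ('o, 'a, 'p, 'q) lens"
    and e :: "('o, 'a, 'p, 'q) lens" and d :: "'o \<Rightarrow> 'o \<Rightarrow> ('o, 'a, 'p, 'q) lens"
  assumes "cartesian_category C"
    and "has_pullbacks C"
    and "dynamical_system_doctrine C A To Ta"
    and "monoidal_indexed_category C A"
    and "oplax_monoidal_functor (cart_moncat C) (lens_moncat C A) To Ta e d"
  shows "\<exists>RSMo RSMa u m.
    lax_monoidal_functor_to_Set (prod_moncat (lens_moncat C A) (span_moncat C)) RSMo RSMa u m \<and>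
    (\<forall>IO \<in> obs (lens_cat C A). \<forall>M \<in> obs C.
       RSMo (IO, M) = rsm_triples C A To (IO, M) // rsm_iso C A To Ta (IO, M)) \<and>
    (\<forall>IO \<in> obs (lens_cat C A). \<forall>IO' \<in> obs (lens_cat C A). \<forall>f \<in> homs (lens_cat C A) IO IO'.
     \<forall>M \<in> obs C. \<forall>Q \<in> obs C. \<forall>M' \<in> obs C. \<forall>i \<in> homs C Q M. \<forall>i' \<in> homs C Q M'.
     \<forall>(S, ur, p) \<in> rsm_triples C A To (IO, M).
     \<forall>i_t p_t. is_pullback C i_t p_t p i \<longrightarrow>
       RSMa (f, span_class C i i') (rsm_iso C A To Ta (IO, M) `` {(S, ur, p)})
       = rsm_iso C A To Ta (IO', M') ``
           {(src C i_t,
             Ta i_t \<Zsemi>\<^bsub>lens_cat C A\<^esub> ur \<Zsemi>\<^bsub>lens_cat C A\<^esub> f,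
             p_t \<Zsemi>\<^bsub>C\<^esub> i')})"
proof -
  interpret rsm_data C A To Ta e d
    by (intro rsm_data.intro rsm_data_axioms.intro assms)
  show ?thesis
  proof (rule exI[of _ "\<lambda>x. triples x // rsm_iso C A To Ta x"], rule exI[of _ rsm_ar],
      rule exI[of _ rsm_unit], rule exI[of _ rsm_mul], intro conjI ballI, goal_cases)
    case 1
    show ?case
      by (rule rsm_lax_monoidal)
  next
    case (2 IO M)
    show ?case ..
  next
    case (3 IO IO' f M Q M' i i' a)
    obtain S l p where a: "a = (S, l, p)"
      by (cases a)
    have act: "rsm_ar (f, span_class C i i') (cls (IO, M) (S, l, p))
        = cls (IO', M') (src C h, Ta h \<odot> l \<odot> f, k \<Zsemi>\<^bsub>C\<^esub> i')"
      if P: "is_pullback C h k p i" for h k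
    proof -
      \<comment> \<open>The theorem brackets the three lenses to the left and
        \<open>rsm_ar_class\<close> brackets them to the right; associativity of
        \<open>lens_cmp\<close> bridges the two.\<close>
      have "(S, l, p) \<in> triples (IO, M)" "f \<in> lens_ars C A" "lens_src f = IO"
        using 3(3,9) a by simp_all
      then have "Ta h \<odot> l \<odot> f = Ta h \<odot> (l \<odot> f)"
        using is_pullbackD[OF P] unfolding triples_iff by simp
      then show ?thesis
        using rsm_ar_class[OF _ _ _ _ _ _ _ _ P, of f IO IO' S l M i' M'] 3 a by simp
    qed
    then show ?case
      by (simp add: a)
  qed
qed

end
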